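(* Let $d\ge 2$. For each $s\in(d-1,d)$ there exists a uniform domain $\Omega\subset\mathbb{R}^{d+1}$ such that (1) $\partial\Omega$ is lower Ahlfors-David $s$-regular, (2) $\mathcal{H}^d|_{\partial\Omega}$ is locally finite, and there exists a set $E\subset\partial\Omega$ for which $\mathcal{H}^d(E)>0=\omega(E)$.
   Context: $\mathcal{H}^s$ denotes $s$-dimensional Hausdorff measure in $\mathbb{R}^{d+1}$, and $B(x,r)$ is the open ball with center $x$ and radius $r$. A domain is a connected open set. $\omega$ is the harmonic measure (for the Laplacian) of $\Omega$ with some fixed pole in $\Omega$. A set $A\subset\mathbb{R}^{d+1}$ is lower Ahlfors-David $s$-regular if there is $C\ge 1$ such that $\mathcal{H}^s(B(x,r)\cap A)\ge r^s/C$ for all $x\in A$ and $0<r<\operatorname{diam}A$. A domain $\Omega$ is uniform if there is $C_\Omega>0$ such that for all $x,y\in\overline{\Omega}$ there is a path $\gamma\subset\Omega$ connecting $x$ and $y$ with (a) length $\ell(\gamma)\le C_\Omega|x-y|$ and (b) $\operatorname{dist}(z,\partial\Omega)\ge \operatorname{dist}(z,\{x,y\})/C_\Omega$ for all $z\in\gamma$. $\mathcal{H}^d|_{\partial\Omega}$ is locally finite if $\mathcal{H}^d(\partial\Omega\cap K)<\infty$ for every compact $K\subset\mathbb{R}^{d+1}$. *)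

theory Defs
  imports "HOL-Analysis.Analysis"
begin

section \<open>Hausdorff measure\<close>

text \<open>No normalising constant. For \<open>s > 0\<close> only: in HOL \<open>0 powr 0 = 0\<close>. Boundedness of the covering sets
  is required explicitly because \<^const>\<open>diameter\<close> is unspecified on unbounded sets. The result is the
  Hausdorff outer measure on all sets; it is a measure on the Borel sets.\<close>

definition hausdorff_content :: "real \<Rightarrow> real \<Rightarrow> 'a::metric_space set \<Rightarrow> ennreal" where
  "hausdorff_content s \<delta> A =
     (INF U \<in> {U :: nat \<Rightarrow> 'a set. A \<subseteq> (\<Union>i. U i) \<and> (\<forall>i. bounded (U i) \<and> diameter (U i) \<le> \<delta>)}.
        \<Sum>i. ennreal (diameter (U i) powr s))"

definition hausdorff_measure :: "real \<Rightarrow> 'a::metric_space set \<Rightarrow> ennreal" where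
  "hausdorff_measure s A = (SUP \<delta>\<in>{0<..}. hausdorff_content s \<delta> A)"

text \<open>The condition on \<open>r\<close> is \<open>0 < r < diam A\<close>, with \<open>diam A = \<infinity>\<close> for unbounded \<open>A\<close>.\<close>

definition lower_AD_regular :: "real \<Rightarrow> 'a::metric_space set \<Rightarrow> bool" where
  "lower_AD_regular s A \<longleftrightarrow>
     (\<exists>C\<ge>1. \<forall>x\<in>A. \<forall>r>0. (bounded A \<longrightarrow> r < diameter A) \<longrightarrow>
        hausdorff_measure s (ball x r \<inter> A) \<ge> ennreal (r powr s / C))"

definition locally_finite_hausdorff :: "real \<Rightarrow> 'a::metric_space set \<Rightarrow> bool" where
  "locally_finite_hausdorff s A \<longleftrightarrow> (\<forall>K. compact K \<longrightarrow> hausdorff_measure s (A \<inter> K) < \<infinity>)"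


section \<open>Uniform domains\<close>

definition path_length :: "(real \<Rightarrow> 'a::metric_space) \<Rightarrow> ennreal" where
  "path_length g =
     (SUP n. SUP t \<in> {t :: nat \<Rightarrow> real. mono t \<and> range t \<subseteq> {0..1}}.
        \<Sum>i<n. ennreal (dist (g (t i)) (g (t (Suc i)))))"

definition domain :: "'a::topological_space set \<Rightarrow> bool" where
  "domain \<Omega> \<longleftrightarrow> open \<Omega> \<and> connected \<Omega> \<and> \<Omega> \<noteq> {}"

text \<open>Since \<open>x\<close> and \<open>y\<close> may lie on the boundary, the path is required to stay in \<open>\<Omega>\<close> up to its end
  points. The condition on \<open>w\<close> says \<open>dist (z, \<partial>\<Omega>) \<ge> dist (z, {x, y}) / C\<close>.\<close>

definition uniform_domain :: "'a::real_normed_vector set \<Rightarrow> bool" where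
  "uniform_domain \<Omega> \<longleftrightarrow> domain \<Omega> \<and>
     (\<exists>C>0. \<forall>x\<in>closure \<Omega>. \<forall>y\<in>closure \<Omega>. \<exists>\<gamma>.
        path \<gamma> \<and> pathstart \<gamma> = x \<and> pathfinish \<gamma> = y \<and> path_image \<gamma> \<subseteq> \<Omega> \<union> {x, y} \<and>
        path_length \<gamma> \<le> ennreal (C * dist x y) \<and>
        (\<forall>z\<in>path_image \<gamma>. \<forall>w\<in>frontier \<Omega>. dist z w \<ge> infdist z {x, y} / C))"


section \<open>Harmonic measure\<close>

text \<open>Real-valued superharmonic functions on an open set: lower semicontinuous with the
  super-mean-value property for (solid) balls. Allowing also the value \<open>\<infinity>\<close> would not change the Perron
  solutions below for bounded \<open>f\<close>, because a member \<open>u\<close> of the upper class can be replaced by \<open>min u M\<close>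
  for a large constant \<open>M\<close>.\<close>

definition superharmonic_on :: "('a::euclidean_space \<Rightarrow> real) \<Rightarrow> 'a set \<Rightarrow> bool" where
  "superharmonic_on u \<Omega> \<longleftrightarrow>
     (\<forall>x\<in>\<Omega>. \<forall>c<u x. \<forall>\<^sub>F y in at x within \<Omega>. c < u y) \<and>
     (\<forall>x r. 0 < r \<and> cball x r \<subseteq> \<Omega> \<longrightarrow>
        set_integrable lborel (cball x r) u \<and>
        (LINT y:cball x r|lborel. u y) / measure lborel (cball x r) \<le> u x)"

text \<open>Perron--Wiener--Brelot solutions of the Dirichlet problem with boundary data \<open>f\<close> on the Euclidean
  boundary and, if \<open>\<Omega>\<close> is unbounded, \<open>0\<close> at infinity. If \<open>\<Omega>\<close> is bounded, the filter in the last condition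
  is trivial and the condition is void.\<close>

definition upper_class :: "'a::euclidean_space set \<Rightarrow> ('a \<Rightarrow> real) \<Rightarrow> ('a \<Rightarrow> real) set" where
  "upper_class \<Omega> f =
     {u. superharmonic_on u \<Omega> \<and> bdd_below (u ` \<Omega>) \<and>
         (\<forall>\<zeta>\<in>frontier \<Omega>. ereal (f \<zeta>) \<le> Liminf (at \<zeta> within \<Omega>) (\<lambda>x. ereal (u x))) \<and>
         0 \<le> Liminf (inf at_infinity (principal \<Omega>)) (\<lambda>x. ereal (u x))}"

definition upper_perron :: "'a::euclidean_space set \<Rightarrow> ('a \<Rightarrow> real) \<Rightarrow> 'a \<Rightarrow> ereal" where
  "upper_perron \<Omega> f p = (INF u\<in>upper_class \<Omega> f. ereal (u p))"

definition lower_perron :: "'a::euclidean_space set \<Rightarrow> ('a \<Rightarrow> real) \<Rightarrow> 'a \<Rightarrow> ereal" where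
  "lower_perron \<Omega> f p = - upper_perron \<Omega> (\<lambda>x. - f x) p"

text \<open>Harmonic measure in the sense of Doob: \<open>E \<subseteq> \<partial>\<Omega>\<close> is measurable if its indicator function is
  resolutive, and then \<open>\<omega>\<^sup>p(E)\<close> is the value at the pole \<open>p\<close> of the Perron solution with this boundary
  function. By Brelot's theorem all Borel sets are measurable, and \<open>\<omega>\<^sup>p\<close> is the Borel measure on \<open>\<partial>\<Omega>\<close> that
  represents \<open>f \<mapsto> H\<^sub>f(p)\<close> for continuous \<open>f\<close> with compact support.\<close>

definition harmonic_measurable :: "'a::euclidean_space set \<Rightarrow> 'a set \<Rightarrow> bool" where
  "harmonic_measurable \<Omega> E \<longleftrightarrow>
     (\<forall>p\<in>\<Omega>. lower_perron \<Omega> (indicator E) p = upper_perron \<Omega> (indicator E) p)"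

definition harmonic_measure :: "'a::euclidean_space set \<Rightarrow> 'a \<Rightarrow> 'a set \<Rightarrow> ereal" where
  "harmonic_measure \<Omega> p E = upper_perron \<Omega> (indicator E) p"

end

theory Submission
  imports Defs "HOL-Complex_Analysis.Cauchy_Integral_Formula"
begin

text \<open>
  Two of the coordinates are singled out, a height and a horizontal one. From the half-space of positive
  height infinitely many cylinders are removed, whose cross-sections are squares in the plane of these two
  coordinates: one small closed square in the middle of every Whitney square
  \<open>[m 2\<^sup>-\<^sup>k, (m + 1) 2\<^sup>-\<^sup>k] \<times> [2\<^sup>-\<^sup>k, 2\<^sup>1\<^sup>-\<^sup>k]\<close>, for all integers \<open>k\<close> and \<open>m\<close>. For \<open>k \<ge> 0\<close> its side relative to that of
  the Whitney square is \<open>2\<^sup>-\<^sup>k\<close> up to a factor. The set \<open>E\<close> is the bounding hyperplane of height \<open>0\<close>.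

  Two series decide. Per unit area of \<open>E\<close>, the surface of the obstacles of generation \<open>k\<close> is proportional to
  their relative size \<open>2\<^sup>-\<^sup>k\<close>, which is summable; hence the surface measure is locally finite
  (\<open>locally_finite_frontier\<close>). But capacity in the plane is logarithmic: a Brownian path descending
  towards \<open>E\<close> hits an obstacle of generation \<open>k\<close> with a probability comparable with \<open>1 / k\<close>, and since the
  harmonic series diverges it never reaches \<open>E\<close>.

  The second half of this is made rigorous by explicit potentials. Let \<open>potential k\<close> be the sum of the Green
  functions of the half-plane with poles at the centres of generation \<open>k\<close>; it is the logarithm of the
  modulus of a quotient of two cosines. It vanishes on \<open>E\<close>, is close to \<open>3 pi\<close> well above generation \<open>k\<close> and
  close to \<open>0\<close> well below it, and outside the obstacles of its own generation it is at most \<open>3 pi k\<close> up to a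
  constant. Therefore the sum over the generations from \<open>1\<close> to \<open>N\<close> is at most \<open>3 pi N + Q\<close> on the whole
  domain (\<open>sum_potential_le\<close>), while at any fixed point it is at least \<open>3 pi N - K\<close>
  (\<open>sum_potential_ge\<close>). One minus the quotient of the sum by \<open>3 pi N + Q\<close> is then a nonnegative harmonic
  function with boundary values \<open>1\<close> on \<open>E\<close> that tends to \<open>0\<close> with growing \<open>N\<close> at every point of the domain
  (\<open>barrier\<close>). Together with a minimum principle this shows that the Perron solutions for the indicator
  of \<open>E\<close> vanish (\<open>harmonic_null_if_barriers\<close>). That real parts of holomorphic functions of two coordinates
  satisfy the mean value equation for balls in all dimensions is \<open>integral_holomorphic_ball\<close>.

  Lower regularity holds because every ball around a boundary point contains a flat piece of dimension \<open>d\<close>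
  of the boundary, which has infinite measure in dimension \<open>s < d\<close> (\<open>lower_AD_regular_frontier\<close>).

  The domain is uniform (\<open>uniform_Dom\<close>) because the obstacles are square and well separated: their
  distances from each other and from \<open>E\<close> are bounded below by a multiple of the Whitney scale. Close to an obstacle one moves
  away from its centre and, if necessary, around it. At large distances one climbs, avoiding the obstacles
  of each generation by a sideways movement of the size of its Whitney squares, until the height is
  comparable with the distance of the two points.
\<close>

section \<open>Hausdorff measure of flat boxes\<close>

lemma hausdorff_content_mono:
  assumes "A \<subseteq> B"
  shows "hausdorff_content s \<delta> A \<le> hausdorff_content s \<delta> B"
  unfolding hausdorff_content_def
  by (rule INF_superset_mono) (use assms in auto)

lemma hausdorff_measure_mono:
  assumes "A \<subseteq> B"
  shows "hausdorff_measure s A \<le> hausdorff_measure s B"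
  unfolding hausdorff_measure_def
  by (rule SUP_mono) (use hausdorff_content_mono[OF assms] in blast)

lemma hausdorff_content_le_measure:
  assumes "\<delta> > 0"
  shows "hausdorff_content s \<delta> A \<le> hausdorff_measure s A"
  unfolding hausdorff_measure_def using assms by (auto intro: SUP_upper)

lemma hausdorff_content_finite_cover:
  fixes U :: "'i \<Rightarrow> 'a::metric_space set"
  assumes "finite I" "A \<subseteq> (\<Union>i\<in>I. U i)" "\<And>i. i \<in> I \<Longrightarrow> bounded (U i)"
    and diam: "\<And>i. i \<in> I \<Longrightarrow> diameter (U i) \<le> \<delta>" and "0 \<le> \<delta>"
  shows "hausdorff_content s \<delta> A \<le> (\<Sum>i\<in>I. ennreal (diameter (U i) powr s))"
proof -
  obtain h and n :: nat where h: "bij_betw h {0..<n} I"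
    using ex_bij_betw_nat_finite[OF assms(1)] by blast
  define V where "V k = (if k < n then U (h k) else {})" for k
  have hI: "h k \<in> I" if "k < n" for k
    using h that by (auto simp: bij_betw_def)
  have "I = h ` {0..<n}" using h by (simp add: bij_betw_def)
  then have "(\<Union>i\<in>I. U i) = (\<Union>k\<in>{0..<n}. V k)"
    by (auto simp: V_def)
  moreover have "(\<Union>k\<in>{0..<n}. V k) \<subseteq> (\<Union>k. V k)"
    by (rule UN_mono) auto
  ultimately have "A \<subseteq> (\<Union>k. V k)"
    using assms(2) by simp
  moreover have "bounded (V k) \<and> diameter (V k) \<le> \<delta>" for k
    using hI assms by (auto simp: V_def)
  ultimately have "hausdorff_content s \<delta> A \<le> (\<Sum>k. ennreal (diameter (V k) powr s))"
    unfolding hausdorff_content_def by (intro INF_lower) auto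
  also have "\<dots> = (\<Sum>k\<in>{0..<n}. ennreal (diameter (V k) powr s))"
    by (rule suminf_finite) (auto simp: V_def)
  also have "\<dots> = (\<Sum>k\<in>{0..<n}. ennreal (diameter (U (h k)) powr s))"
    by (rule sum.cong) (auto simp: V_def)
  also have "\<dots> = (\<Sum>i\<in>I. ennreal (diameter (U i) powr s))"
    by (rule sum.reindex_bij_betw[OF h])
  finally show ?thesis .
qed

lemma hausdorff_content_countably_subadditive:
  "hausdorff_content s \<delta> (\<Union>n. A n) \<le> (\<Sum>n. hausdorff_content s \<delta> (A n))"
proof (rule ennreal_le_epsilon)
  fix e :: real
  assume fin: "(\<Sum>n. hausdorff_content s \<delta> (A n)) < top" and e: "0 < e"
  define f where "f V = ennreal (diameter V powr s)" for V :: "'a set"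
  have "\<exists>U. A n \<subseteq> (\<Union>i. U i) \<and> (\<forall>i. bounded (U i) \<and> diameter (U i) \<le> \<delta>)
      \<and> (\<Sum>i. f (U i)) \<le> hausdorff_content s \<delta> (A n) + ennreal (e * (1/2) ^ Suc n)" for n
  proof -
    have "hausdorff_content s \<delta> (A n) < top"
      using fin ennreal_suminf_lessD by blast
    then have "hausdorff_content s \<delta> (A n) < hausdorff_content s \<delta> (A n) + ennreal (e * (1/2) ^ Suc n)"
      using e by (simp add: ennreal_add_left_cancel_less)
    then show ?thesis
      unfolding hausdorff_content_def f_def INF_less_iff using less_imp_le by blast
  qed
  then obtain U where U: "\<And>n. A n \<subseteq> (\<Union>i. U n i)"
      "\<And>n i. bounded (U n i) \<and> diameter (U n i) \<le> \<delta>"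
      "\<And>n. (\<Sum>i. f (U n i)) \<le> hausdorff_content s \<delta> (A n) + ennreal (e * (1/2) ^ Suc n)"
    by metis
  define V where "V k = case_prod U (prod_decode k)" for k
  have "(\<Union>n. A n) \<subseteq> (\<Union>k. V k)"
  proof
    fix x assume "x \<in> (\<Union>n. A n)"
    then obtain n i where "x \<in> U n i" using U(1) by blast
    then have "x \<in> V (prod_encode (n, i))" by (simp add: V_def)
    then show "x \<in> (\<Union>k. V k)" by blast
  qed
  moreover have "bounded (V k) \<and> diameter (V k) \<le> \<delta>" for k
    using U(2) by (simp add: V_def split: prod.split)
  ultimately have "hausdorff_content s \<delta> (\<Union>n. A n) \<le> (\<Sum>k. f (V k))"
    unfolding hausdorff_content_def f_def by (intro INF_lower) auto
  also have "\<dots> = (\<Sum>k. (\<lambda>p. f (case_prod U p)) (prod_decode k))"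
    by (simp add: V_def)
  also have "\<dots> = (\<Sum>n. \<Sum>i. f (U n i))"
    by (subst suminf_ennreal_2dimen[where g = "\<lambda>n. \<Sum>i. f (U n i)"]) auto
  also have "\<dots> \<le> (\<Sum>n. hausdorff_content s \<delta> (A n) + ennreal (e * (1/2) ^ Suc n))"
    by (intro suminf_le U(3)) auto
  also have "\<dots> = (\<Sum>n. hausdorff_content s \<delta> (A n)) + (\<Sum>n. ennreal (e * (1/2) ^ Suc n))"
    by (rule suminf_add[symmetric]) auto
  also have "(\<Sum>n. ennreal (e * (1/2) ^ Suc n)) = ennreal e"
    by (rule suminf_ennreal_eq) (use e sums_mult[OF power_half_series, of e] in auto)
  finally show "hausdorff_content s \<delta> (\<Union>n. A n) \<le> (\<Sum>n. hausdorff_content s \<delta> (A n)) + ennreal e" .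
qed

lemma hausdorff_measure_countably_subadditive:
  "hausdorff_measure s (\<Union>n. A n) \<le> (\<Sum>n. hausdorff_measure s (A n))"
  unfolding hausdorff_measure_def[of _ "\<Union>n. A n"]
proof (rule SUP_least)
  fix \<delta> :: real assume "\<delta> \<in> {0<..}"
  then have "hausdorff_content s \<delta> (A n) \<le> hausdorff_measure s (A n)" for n
    by (simp add: hausdorff_content_le_measure)
  then have "(\<Sum>n. hausdorff_content s \<delta> (A n)) \<le> (\<Sum>n. hausdorff_measure s (A n))"
    by (intro suminf_le) auto
  then show "hausdorff_content s \<delta> (\<Union>n. A n) \<le> (\<Sum>n. hausdorff_measure s (A n))"
    using hausdorff_content_countably_subadditive order_trans by blast
qed

lemma hausdorff_measure_empty [simp]: "hausdorff_measure s {} = 0"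
proof -
  have "hausdorff_content s \<delta> ({} :: 'a set) = 0" if "\<delta> > 0" for \<delta>
    using hausdorff_content_finite_cover[of "{}" "{} :: 'a set" _ \<delta> s] that by simp
  then show ?thesis by (auto simp: hausdorff_measure_def intro!: antisym SUP_least)
qed

lemma hausdorff_measure_finite_UN:
  assumes "finite I"
  shows "hausdorff_measure s (\<Union>i\<in>I. A i) \<le> (\<Sum>i\<in>I. hausdorff_measure s (A i))"
proof -
  obtain h and n :: nat where h: "bij_betw h {0..<n} I"
    using ex_bij_betw_nat_finite[OF assms] by blast
  define V where "V k = (if k < n then A (h k) else {})" for k
  have "I = h ` {0..<n}" using h by (simp add: bij_betw_def)
  then have "(\<Union>i\<in>I. A i) = (\<Union>k\<in>{0..<n}. V k)"
    by (auto simp: V_def)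
  moreover have "(\<Union>k\<in>{0..<n}. V k) \<subseteq> (\<Union>k. V k)"
    by (rule UN_mono) auto
  ultimately have "(\<Union>i\<in>I. A i) \<subseteq> (\<Union>k. V k)" by simp
  then have "hausdorff_measure s (\<Union>i\<in>I. A i) \<le> (\<Sum>k. hausdorff_measure s (V k))"
    using hausdorff_measure_mono hausdorff_measure_countably_subadditive order_trans by metis
  also have "\<dots> = (\<Sum>k\<in>{0..<n}. hausdorff_measure s (V k))"
    by (rule suminf_finite) (auto simp: V_def)
  also have "\<dots> = (\<Sum>k\<in>{0..<n}. hausdorff_measure s (A (h k)))"
    by (rule sum.cong) (auto simp: V_def)
  also have "\<dots> = (\<Sum>i\<in>I. hausdorff_measure s (A i))"
    by (rule sum.reindex_bij_betw[OF h])
  finally show ?thesis .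
qed

lemma hausdorff_measure_Un:
  "hausdorff_measure s (A \<union> B) \<le> hausdorff_measure s A + hausdorff_measure s B"
  using hausdorff_measure_finite_UN[of "{True, False}" s "\<lambda>b. if b then A else B"]
  by (simp add: Un_commute)

definition flat_box :: "'n \<Rightarrow> (real, 'n::finite) vec \<Rightarrow> (real, 'n) vec \<Rightarrow> (real, 'n) vec set" where
  "flat_box i l u = {z. z $ i = l $ i \<and> (\<forall>j. j \<noteq> i \<longrightarrow> l $ j \<le> z $ j \<and> z $ j \<le> u $ j)}"

lemma hausdorff_measure_flat_box_le:
  fixes l u :: "(real, 'n::finite) vec"
  assumes less: "\<And>j. j \<noteq> i \<Longrightarrow> l $ j < u $ j" and d: "CARD('n) = d + 1"
  shows "hausdorff_measure (real d) (flat_box i l u)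
     \<le> ennreal ((2 * real (d + 1)) ^ d * (\<Prod>j\<in>-{i}. u $ j - l $ j))"
  unfolding hausdorff_measure_def
proof (rule SUP_least)
  fix \<delta> :: real assume "\<delta> \<in> {0<..}"
  then have \<delta>: "\<delta> > 0" by simp
  have cardc: "card (-{i}) = d" using d by (simp add: Compl_eq_Diff_UNIV)
  define n where "n = real (d + 1)"
  have n: "n > 0" by (simp add: n_def)
  \<comment> \<open>Fine enough for \<open>\<delta>\<close>, and for rounding up the numbers of cubes to at most double each side.\<close>
  define mu where "mu = Min (insert (\<delta> / n) ((\<lambda>j. u $ j - l $ j) ` (-{i})))"
  have mu: "mu > 0" "mu \<le> \<delta> / n" "\<And>j. j \<noteq> i \<Longrightarrow> mu \<le> u $ j - l $ j"
    unfolding mu_def using less \<delta> n by (auto simp: Min_gr_iff intro: Min_le)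
  define N where "N j = nat \<lceil>(u $ j - l $ j) / mu\<rceil>" for j
  have N: "(u $ j - l $ j) / mu \<le> real (N j)" "real (N j) * mu \<le> 2 * (u $ j - l $ j)" if "j \<noteq> i" for j
  proof -
    have q: "0 < (u $ j - l $ j) / mu" using mu less[OF that] by simp
    show "(u $ j - l $ j) / mu \<le> real (N j)" unfolding N_def by linarith
    have "real (N j) \<le> (u $ j - l $ j) / mu + 1" unfolding N_def using q by linarith
    then have "real (N j) * mu \<le> ((u $ j - l $ j) / mu + 1) * mu" using mu(1) by simp
    also have "\<dots> = u $ j - l $ j + mu" using mu(1) by (simp add: field_simps)
    finally show "real (N j) * mu \<le> 2 * (u $ j - l $ j)" using mu(3)[OF that] by simp
  qed
  define Q where "Q p = {z. z $ i = l $ i \<and> (\<forall>j. j \<noteq> i \<longrightarrow>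
      l $ j + real (p j) * mu \<le> z $ j \<and> z $ j \<le> l $ j + real (p j) * mu + mu)}" for p :: "'n \<Rightarrow> nat"
  define I' where "I' = Pi\<^sub>E (-{i}) (\<lambda>j. {..<N j})"
  have cardI: "card I' = (\<Prod>j\<in>-{i}. N j)" unfolding I'_def by (simp add: card_PiE)
  have finI: "finite I'" unfolding I'_def by (intro finite_PiE) auto
  have distQ: "dist z w \<le> n * mu" if "z \<in> Q p" "w \<in> Q p" for z w p
  proof -
    have "\<bar>(z - w) $ j\<bar> \<le> mu" for j
      using that mu(1) unfolding Q_def by (cases "j = i") (auto dest!: spec[of _ j] simp: abs_le_iff)
    then have "(\<Sum>j\<in>UNIV. \<bar>(z - w) $ j\<bar>) \<le> (\<Sum>j\<in>(UNIV::'n set). mu)" by (intro sum_mono) auto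
    then show ?thesis
      using norm_le_l1_cart[of "z - w"] d by (simp add: dist_norm n_def)
  qed
  have bQ: "bounded (Q p)" for p
  proof (cases "Q p = {}")
    case False
    then obtain z where "z \<in> Q p" by blast
    then show ?thesis unfolding bounded_def using distQ by blast
  qed simp
  have dQ: "diameter (Q p) \<le> n * mu" for p
    by (rule diameter_le) (use distQ n mu in \<open>auto simp: dist_norm\<close>)
  have cover: "flat_box i l u \<subseteq> (\<Union>p\<in>I'. Q p)"
  proof
    fix z assume z: "z \<in> flat_box i l u"
    define p where "p j = (if j = i then undefined else
        min (N j - 1) (nat \<lfloor>(z $ j - l $ j) / mu\<rfloor>))" for j
    have Npos: "N j > 0" if "j \<noteq> i" for j
      using N(1)[OF that] mu(1) less[OF that]
      by (metis diff_gt_0_iff_gt divide_pos_pos gr0I not_le of_nat_0)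
    have "p \<in> I'" using Npos by (force simp: I'_def p_def PiE_iff extensional_def)
    moreover have "z \<in> Q p"
    proof -
      have "l $ j + real (p j) * mu \<le> z $ j \<and> z $ j \<le> l $ j + real (p j) * mu + mu" if ji: "j \<noteq> i" for j
      proof -
        define q where "q = (z $ j - l $ j) / mu"
        have zj: "l $ j \<le> z $ j" "z $ j \<le> u $ j" using z ji by (auto simp: flat_box_def)
        have q0: "0 \<le> q" using zj mu(1) by (simp add: q_def)
        have qN: "q \<le> real (N j)"
          using N(1)[OF ji] divide_right_mono[of "z $ j - l $ j" "u $ j - l $ j" mu] zj mu(1)
          unfolding q_def by linarith
        have pj: "p j = min (N j - 1) (nat \<lfloor>q\<rfloor>)" using ji by (simp add: p_def q_def)
        have "real (p j) \<le> q" unfolding pj using q0 by (simp add: min_def) linarith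
        moreover have "q \<le> real (p j) + 1"
          unfolding pj using q0 qN Npos[OF ji] by (simp add: min_def of_nat_diff)
        moreover have "z $ j = l $ j + q * mu" using mu(1) by (simp add: q_def)
        moreover have "q * mu \<le> (real (p j) + 1) * mu" "real (p j) * mu \<le> q * mu"
          using calculation mu(1) by (auto intro!: mult_right_mono)
        ultimately show ?thesis by (simp add: algebra_simps)
      qed
      then show ?thesis using z by (auto simp: Q_def flat_box_def)
    qed
    ultimately show "z \<in> (\<Union>p\<in>I'. Q p)" by blast
  qed
  have "hausdorff_content (real d) \<delta> (flat_box i l u) \<le> (\<Sum>p\<in>I'. ennreal (diameter (Q p) powr real d))"
  proof (rule hausdorff_content_finite_cover[OF finI cover bQ])
    show "diameter (Q p) \<le> \<delta>" for p
      using dQ[of p] mu(2) n by (simp add: field_simps)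
  qed (use \<delta> in simp)
  also have "\<dots> \<le> (\<Sum>p\<in>I'. ennreal ((n * mu) ^ d))"
  proof (intro sum_mono ennreal_leI)
    fix p
    have "diameter (Q p) powr real d \<le> (n * mu) powr real d"
      by (rule powr_mono2) (use dQ diameter_ge_0[OF bQ] in auto)
    also have "\<dots> = (n * mu) ^ d" using n mu(1) by (simp add: powr_realpow)
    finally show "diameter (Q p) powr real d \<le> (n * mu) ^ d" .
  qed
  also have "\<dots> = ennreal (real (card I') * (n * mu) ^ d)"
    by (simp add: ennreal_mult ennreal_of_nat_eq_real_of_nat n less_imp_le[OF n] less_imp_le[OF mu(1)])
  also have "real (card I') * (n * mu) ^ d = n ^ d * (\<Prod>j\<in>-{i}. real (N j) * mu)"
    unfolding cardI prod.distrib using d by (simp add: power_mult_distrib cardc)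
  also have "ennreal \<dots> \<le> ennreal (n ^ d * (\<Prod>j\<in>-{i}. 2 * (u $ j - l $ j)))"
    using n mu(1) N(2) by (intro ennreal_leI mult_left_mono prod_mono) auto
  also have "n ^ d * (\<Prod>j\<in>-{i}. 2 * (u $ j - l $ j)) = (2 * real (d + 1)) ^ d * (\<Prod>j\<in>-{i}. u $ j - l $ j)"
    by (simp add: prod.distrib power_mult_distrib n_def cardc del: right_diff_distrib_numeral of_nat_add of_nat_Suc)
  finally show "hausdorff_content (real d) \<delta> (flat_box i l u)
      \<le> ennreal ((2 * real (d + 1)) ^ d * (\<Prod>j\<in>-{i}. u $ j - l $ j))" .
qed

text \<open>A volume comparison. Both the box and the covering sets are thickened to unit length in the
  degenerate direction, which replaces \<open>d\<close>-dimensional by \<open>(d + 1)\<close>-dimensional Lebesgue measure; a set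
  of diameter \<open>D\<close> lies in a cube of side \<open>2 D\<close>, and this costs the factor \<open>2 ^ d\<close>.\<close>
lemma hausdorff_content_flat_box_ge:
  fixes l u :: "(real, 'n::finite) vec"
  assumes less: "\<And>j. j \<noteq> i \<Longrightarrow> l $ j < u $ j" and d: "CARD('n) = d + 1" "d > 0"
  shows "ennreal ((\<Prod>j\<in>-{i}. u $ j - l $ j) / 2 ^ d) \<le> hausdorff_content (real d) \<delta> (flat_box i l u)"
  unfolding hausdorff_content_def
proof (rule INF_greatest, clarify)
  fix U :: "nat \<Rightarrow> (real, 'n) vec set"
  assume cov: "flat_box i l u \<subseteq> (\<Union>k. U k)" and bd: "\<forall>k. bounded (U k) \<and> diameter (U k) \<le> \<delta>"
  have cardc: "card (-{i}) = d" using d by (simp add: Compl_eq_Diff_UNIV)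
  define thick where "thick p q = cbox (\<chi> j. if j = i then 0 else p $ j) (\<chi> j. if j = i then 1 else q $ j)"
    for p q :: "(real, 'n) vec"
  have memt: "z \<in> thick p q \<longleftrightarrow> 0 \<le> z $ i \<and> z $ i \<le> 1 \<and> (\<forall>j. j \<noteq> i \<longrightarrow> p $ j \<le> z $ j \<and> z $ j \<le> q $ j)" for z p q
    by (auto simp: thick_def mem_box_cart)
  have thick: "emeasure lborel (thick p q) = ennreal (\<Prod>j\<in>-{i}. q $ j - p $ j)"
    if "\<And>j. j \<noteq> i \<Longrightarrow> p $ j \<le> q $ j" for p q
  proof -
    have "(\<chi> j. if j = i then 0 else p $ j) \<in> thick p q" using that by (simp add: memt)
    then have "thick p q \<noteq> {}" by blast
    then have "measure lborel (thick p q) = (\<Prod>j\<in>UNIV. (if j = i then 1 else q $ j) - (if j = i then 0 else p $ j))"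
      unfolding thick_def by (subst content_cbox_cart) auto
    also have "\<dots> = (\<Prod>j\<in>-{i}. q $ j - p $ j)"
      by (subst prod.remove[of UNIV i]) (auto intro!: prod.cong)
    finally have "measure lborel (thick p q) = (\<Prod>j\<in>-{i}. q $ j - p $ j)" .
    then show ?thesis
      by (metis emeasure_eq_ennreal_measure emeasure_lborel_cbox_finite infinity_ennreal_def less_irrefl thick_def top.not_eq_extremum)
  qed
  define c where "c k = (SOME z. z \<in> U k)" for k
  define D where "D k = diameter (U k)" for k
  define T where "T k = (if U k = {} then {} else thick (c k - (\<chi> j. D k)) (c k + (\<chi> j. D k)))" for k
  have D0: "D k \<ge> 0" for k using bd by (simp add: D_def diameter_ge_0)
  have close: "\<bar>z $ j - c k $ j\<bar> \<le> D k" if "z \<in> U k" for z j k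
  proof -
    have "c k \<in> U k" unfolding c_def using that by (rule someI)
    then have "dist z (c k) \<le> D k" unfolding D_def using bd that by (intro diameter_bounded_bound) auto
    then show ?thesis
      using component_le_norm_cart[of "z - c k" j] by (simp add: dist_norm)
  qed
  have Tm: "T k \<in> sets lborel" for k by (simp add: T_def thick_def)
  have "thick l u \<subseteq> (\<Union>k. T k)"
  proof
    fix z assume z: "z \<in> thick l u"
    define w where "w = (\<chi> j. if j = i then l $ i else z $ j)"
    have "w \<in> flat_box i l u" using z by (auto simp: memt flat_box_def w_def)
    then obtain k where k: "w \<in> U k" using cov by blast
    have "z \<in> thick (c k - (\<chi> j. D k)) (c k + (\<chi> j. D k))"
      unfolding memt
    proof (intro conjI allI impI)
      fix j assume "j \<noteq> i"
      then have "w $ j = z $ j" by (simp add: w_def)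
      then show "(c k - (\<chi> j. D k)) $ j \<le> z $ j" "z $ j \<le> (c k + (\<chi> j. D k)) $ j"
        using close[OF k, of j] by (auto simp: abs_le_iff)
    qed (use z in \<open>auto simp: memt\<close>)
    then have "z \<in> T k" using k by (auto simp: T_def)
    then show "z \<in> (\<Union>k. T k)" by blast
  qed
  then have "emeasure lborel (thick l u) \<le> emeasure lborel (\<Union>k. T k)"
    using Tm by (intro emeasure_mono) auto
  also have "\<dots> \<le> (\<Sum>k. emeasure lborel (T k))"
    using Tm by (intro emeasure_subadditive_countably) auto
  also have "\<dots> \<le> (\<Sum>k. ennreal (2 ^ d) * ennreal (diameter (U k) powr real d))"
  proof (intro suminf_le)
    fix k
    have "emeasure lborel (T k) \<le> ennreal ((2 * D k) ^ d)"
    proof (cases "U k = {}")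
      case False
      then have "emeasure lborel (T k) = ennreal (\<Prod>j\<in>-{i}. 2 * D k)"
        unfolding T_def using D0[of k] by (simp add: thick algebra_simps) 
      then show ?thesis using d by (simp add: cardc)
    qed (simp add: T_def)
    also have "(2 * D k) ^ d = 2 ^ d * D k powr real d"
    proof (cases "D k = 0")
      case False
      then show ?thesis using D0[of k] by (simp add: powr_realpow power_mult_distrib)
    qed (use d in auto)
    finally show "emeasure lborel (T k) \<le> ennreal (2 ^ d) * ennreal (diameter (U k) powr real d)"
      by (simp add: ennreal_mult D_def)
  qed auto
  also have "\<dots> = ennreal (2 ^ d) * (\<Sum>k. ennreal (diameter (U k) powr real d))"
    by simp
  finally have "ennreal (\<Prod>j\<in>-{i}. u $ j - l $ j) \<le> ennreal (2 ^ d) * (\<Sum>k. ennreal (diameter (U k) powr real d))"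
    using thick[of l u] less by (simp add: less_imp_le)
  then have "ennreal (1 / 2 ^ d) * ennreal (\<Prod>j\<in>-{i}. u $ j - l $ j)
      \<le> ennreal (1 / 2 ^ d) * (ennreal (2 ^ d) * (\<Sum>k. ennreal (diameter (U k) powr real d)))"
    by (rule mult_left_mono) simp
  also have "\<dots> = (\<Sum>k. ennreal (diameter (U k) powr real d))"
    by (simp add: mult.assoc[symmetric] ennreal_mult[symmetric] del: ennreal_suminf_cmult)
  finally show "ennreal ((\<Prod>j\<in>-{i}. u $ j - l $ j) / 2 ^ d) \<le> (\<Sum>k. ennreal (diameter (U k) powr real d))"
    by (subst (asm) ennreal_mult[symmetric]) (use prod_pos[of "-{i}" "\<lambda>j. u $ j - l $ j"] less in auto)
qed

text \<open>For covering sets of diameter at most \<open>\<delta>\<close> passing from exponent \<open>t\<close> to \<open>s\<close> gains the factor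
  \<open>\<delta> powr (s - t)\<close>, which is unbounded as \<open>\<delta>\<close> tends to \<open>0\<close>.\<close>
lemma hausdorff_measure_lower_exponent_infinite:
  fixes A :: "'a::metric_space set"
  assumes "0 < m" and m: "\<And>\<delta>. \<delta> > 0 \<Longrightarrow> ennreal m \<le> hausdorff_content t \<delta> A" and "s < t"
  shows "hausdorff_measure s A = \<infinity>"
proof -
  have key: "ennreal (\<delta> powr (s - t) * m) \<le> hausdorff_measure s A" if \<delta>: "\<delta> > 0" for \<delta>
  proof -
    have "ennreal (\<delta> powr (s - t) * m) \<le> hausdorff_content s \<delta> A"
      unfolding hausdorff_content_def
    proof (rule INF_greatest, clarify)
      fix U :: "nat \<Rightarrow> 'a set"
      assume U: "A \<subseteq> (\<Union>i. U i)" "\<forall>i. bounded (U i) \<and> diameter (U i) \<le> \<delta>"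
      have "ennreal (\<delta> powr (s - t)) * ennreal (diameter (U i) powr t) \<le> ennreal (diameter (U i) powr s)" for i
      proof (cases "diameter (U i) = 0")
        case False
        then have D: "0 < diameter (U i)" "diameter (U i) \<le> \<delta>"
          using U(2) diameter_ge_0[of "U i"] by (auto simp: less_le)
        have "\<delta> powr (s - t) * diameter (U i) powr t \<le> diameter (U i) powr (s - t) * diameter (U i) powr t"
          using D assms(3) by (intro mult_right_mono powr_mono2') auto
        also have "\<dots> = diameter (U i) powr s" using D by (simp add: powr_add[symmetric])
        finally show ?thesis by (simp add: ennreal_mult[symmetric] ennreal_leI)
      qed simp
      then have "(\<Sum>i. ennreal (\<delta> powr (s - t)) * ennreal (diameter (U i) powr t))
          \<le> (\<Sum>i. ennreal (diameter (U i) powr s))"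
        by (intro suminf_le) auto
      moreover have "ennreal m \<le> (\<Sum>i. ennreal (diameter (U i) powr t))"
        using m[OF \<delta>] U unfolding hausdorff_content_def le_INF_iff by blast
      then have "ennreal (\<delta> powr (s - t)) * ennreal m \<le> ennreal (\<delta> powr (s - t)) * (\<Sum>i. ennreal (diameter (U i) powr t))"
        by (rule mult_left_mono) simp
      ultimately show "ennreal (\<delta> powr (s - t) * m) \<le> (\<Sum>i. ennreal (diameter (U i) powr s))"
        using assms(1) by (simp add: ennreal_mult)
    qed
    then show ?thesis using hausdorff_content_le_measure[OF \<delta>] order_trans by blast
  qed
  have "ennreal (real n) \<le> hausdorff_measure s A" if n: "n > 0" for n :: nat
  proof -
    define \<delta> where "\<delta> = (real n / m) powr (1 / (s - t))"
    have "\<delta> powr (s - t) * m = real n"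
      using n assms unfolding \<delta>_def powr_powr by simp
    moreover have "\<delta> > 0" using n assms(1) by (simp add: \<delta>_def)
    ultimately show ?thesis using key by fastforce
  qed
  then have "\<And>n::nat. of_nat n \<le> hausdorff_measure s A"
    by (metis ennreal_of_nat_eq_real_of_nat gr0I of_nat_0 zero_le)
  then have "hausdorff_measure s A = top"
    using ennreal_Ex_less_of_nat[of "hausdorff_measure s A"] by (meson not_le top.not_eq_extremum)
  then show ?thesis by simp
qed

section \<open>Escape paths and uniform domains\<close>

lemma path_length_lipschitz:
  assumes lip: "L-lipschitz_on {0..1} g"
  shows "path_length g \<le> ennreal L"
  unfolding path_length_def
proof (intro SUP_least, clarify)
  fix n and t :: "nat \<Rightarrow> real"
  assume t: "mono t" "range t \<subseteq> {0..1}"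
  have L: "L \<ge> 0" using lip by (rule lipschitz_on_nonneg)
  have t01: "t i \<in> {0..1}" for i using t(2) by blast
  have "(\<Sum>i<n. ennreal (dist (g (t i)) (g (t (Suc i))))) = ennreal (\<Sum>i<n. dist (g (t i)) (g (t (Suc i))))"
    by (rule sum_ennreal) simp
  also have "\<dots> \<le> ennreal (\<Sum>i<n. L * (t (Suc i) - t i))"
  proof (intro ennreal_leI sum_mono)
    fix i
    have "t i \<le> t (Suc i)" using t(1) by (simp add: monoD)
    then show "dist (g (t i)) (g (t (Suc i))) \<le> L * (t (Suc i) - t i)"
      using lipschitz_onD[OF lip t01[of i] t01[of "Suc i"]] by (simp add: dist_real_def)
  qed
  also have "(\<Sum>i<n. L * (t (Suc i) - t i)) = L * (t n - t 0)"
    by (simp add: sum_distrib_left[symmetric] sum_lessThan_telescope)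
  also have "ennreal \<dots> \<le> ennreal (L * 1)"
    using L t01[of n] t01[of 0] by (intro ennreal_leI mult_left_mono) auto
  finally show "(\<Sum>i<n. ennreal (dist (g (t i)) (g (t (Suc i))))) \<le> ennreal L" by simp
qed

text \<open>One end of a path as the uniformity condition wants it. The parameter \<open>s\<close> is a substitute for arc
  length: \<open>\<gamma> s\<close> has distance at most \<open>K s\<close> from the starting point \<open>x\<close> and at least \<open>c s\<close> from the
  complement, so that \<open>x\<close> itself may be a boundary point. Keeping the length \<open>l\<close> of the parameter interval
  explicit lets pieces be concatenated without losing constants.\<close>
definition escape :: "'a::real_normed_vector set \<Rightarrow> real \<Rightarrow> real \<Rightarrow> real \<Rightarrow> 'a \<Rightarrow> 'a \<Rightarrow> bool" where
  "escape \<Omega> c K l x z \<longleftrightarrow> 0 \<le> l \<and> (\<exists>\<gamma>. \<gamma> 0 = x \<and> \<gamma> l = z \<and> K-lipschitz_on {0..l} \<gamma> \<and>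
     (\<forall>s\<in>{0..l}. \<forall>w. w \<notin> \<Omega> \<longrightarrow> c * s \<le> dist (\<gamma> s) w))"

lemma escape_refl:
  assumes "K \<ge> 0" shows "escape \<Omega> c K 0 x x"
  unfolding escape_def by (auto intro!: exI[of _ "\<lambda>_. x"] lipschitz_on_leI simp: assms)

lemma escape_mono:
  assumes "escape \<Omega> c K l x z" "c' \<le> c" "K \<le> K'"
  shows "escape \<Omega> c' K' l x z"
proof -
  obtain \<gamma> where \<gamma>: "0 \<le> l" "\<gamma> 0 = x" "\<gamma> l = z" "K-lipschitz_on {0..l} \<gamma>"
     "\<And>s w. s \<in> {0..l} \<Longrightarrow> w \<notin> \<Omega> \<Longrightarrow> c * s \<le> dist (\<gamma> s) w"
    using assms(1) unfolding escape_def by blast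
  have "c' * s \<le> dist (\<gamma> s) w" if "s \<in> {0..l}" "w \<notin> \<Omega>" for s w
  proof -
    have "c' * s \<le> c * s" using assms(2) that(1) by (intro mult_right_mono) auto
    then show ?thesis using \<gamma>(5)[OF that] by linarith
  qed
  moreover have "K'-lipschitz_on {0..l} \<gamma>" using \<gamma>(4) assms(3) lipschitz_on_mono by blast
  ultimately show ?thesis unfolding escape_def using \<gamma> by blast
qed

lemma escape_dist:
  assumes "escape \<Omega> c K l x z"
  shows "dist x z \<le> K * l"
proof -
  obtain \<gamma> where "0 \<le> l" "\<gamma> 0 = x" "\<gamma> l = z" "K-lipschitz_on {0..l} \<gamma>"
    using assms unfolding escape_def by blast
  then show ?thesis using lipschitz_onD[of K "{0..l}" \<gamma> 0 l] by (auto simp: dist_real_def)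
qed

lemma escape_concat:
  assumes "escape \<Omega> c K l x z"
    and \<beta>: "0 \<le> l2" "\<beta> 0 = z" "\<beta> l2 = z'" "K-lipschitz_on {0..l2} \<beta>"
    and d2: "\<And>s w. 0 \<le> s \<Longrightarrow> s \<le> l2 \<Longrightarrow> w \<notin> \<Omega> \<Longrightarrow> c * (l + s) \<le> dist (\<beta> s) w"
  shows "escape \<Omega> c K (l + l2) x z'"
proof -
  obtain \<gamma> where \<gamma>: "0 \<le> l" "\<gamma> 0 = x" "\<gamma> l = z" "K-lipschitz_on {0..l} \<gamma>"
     "\<And>s w. 0 \<le> s \<Longrightarrow> s \<le> l \<Longrightarrow> w \<notin> \<Omega> \<Longrightarrow> c * s \<le> dist (\<gamma> s) w"
    using assms(1) unfolding escape_def by auto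
  define h where "h s = (if s \<le> l then \<gamma> s else \<beta> (s - l))" for s
  have "K-lipschitz_on {0..l + l2} h"
    unfolding h_def
  proof (rule lipschitz_on_concat[OF \<gamma>(4)])
    show "K-lipschitz_on {l..l + l2} (\<lambda>s. \<beta> (s - l))"
    proof (rule lipschitz_onI)
      fix s t assume "s \<in> {l..l + l2}" "t \<in> {l..l + l2}"
      then show "dist (\<beta> (s - l)) (\<beta> (t - l)) \<le> K * dist s t"
        using lipschitz_onD[OF \<beta>(4), of "s - l" "t - l"] by (simp add: dist_real_def)
    qed (use \<gamma>(4) lipschitz_on_nonneg in blast)
  qed (use \<gamma> \<beta> in simp)
  moreover have "h 0 = x" "h (l + l2) = z'"
    using \<gamma> \<beta> by (auto simp: h_def)
  moreover have "c * s \<le> dist (h s) w" if "s \<in> {0..l + l2}" "w \<notin> \<Omega>" for s w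
    using that \<gamma>(5)[of s w] d2[of "s - l" w] by (auto simp: h_def)
  ultimately show ?thesis unfolding escape_def using \<gamma>(1) \<beta>(1) by auto
qed

lemma segment_lipschitz:
  fixes x z :: "'a::real_normed_vector"
  assumes "dist x z \<le> K * l" "0 < l"
  shows "K-lipschitz_on {0..l} (\<lambda>s. x + (s / l) *\<^sub>R (z - x))"
proof (rule lipschitz_onI)
  fix s t
  have "dist (x + (s / l) *\<^sub>R (z - x)) (x + (t / l) *\<^sub>R (z - x)) = norm ((s / l - t / l) *\<^sub>R (z - x))"
    by (simp add: dist_norm algebra_simps)
  also have "\<dots> = \<bar>s - t\<bar> / l * dist x z"
    using assms(2) by (simp add: dist_norm norm_minus_commute diff_divide_distrib[symmetric])
  also have "\<dots> \<le> \<bar>s - t\<bar> / l * (K * l)"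
    using assms by (intro mult_left_mono) auto
  finally show "dist (x + (s / l) *\<^sub>R (z - x)) (x + (t / l) *\<^sub>R (z - x)) \<le> K * dist s t"
    using assms(2) by (simp add: dist_real_def mult.commute)
next
  have "0 \<le> K * l" using assms(1) zero_le_dist order_trans by blast
  then show "0 \<le> K" using assms(2) by (simp add: zero_le_mult_iff)
qed

lemma escape_segment:
  fixes x z :: "'a::real_normed_vector"
  assumes "escape \<Omega> c K l x z" "0 < l2" "dist z z' \<le> K * l2"
    and d2: "\<And>s w. 0 \<le> s \<Longrightarrow> s \<le> 1 \<Longrightarrow> w \<notin> \<Omega> \<Longrightarrow> c * (l + s * l2) \<le> dist (z + s *\<^sub>R (z' - z)) w"
  shows "escape \<Omega> c K (l + l2) x z'"
proof (rule escape_concat[OF assms(1), where \<beta> = "\<lambda>s. z + (s / l2) *\<^sub>R (z' - z)"])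
  show "c * (l + s) \<le> dist (z + (s / l2) *\<^sub>R (z' - z)) w" if "0 \<le> s" "s \<le> l2" "w \<notin> \<Omega>" for s w
    using d2[of "s / l2" w] that assms(2) by simp
qed (use assms segment_lipschitz in auto)

text \<open>Two escape paths with a common end point, the second one run backwards, form the required path:
  at parameter \<open>s\<close> of either half the nearer of \<open>x\<close> and \<open>y\<close> is within \<open>K s\<close>, and the complement is at
  least \<open>c s\<close> away. Connectedness comes for free.\<close>
lemma uniform_domain_if_escape:
  fixes \<Omega> :: "'a::real_normed_vector set"
  assumes op: "open \<Omega>" and ne: "\<Omega> \<noteq> {}" and c: "c > 0" and K: "K > 0"
    and esc: "\<And>x y. x \<in> closure \<Omega> \<Longrightarrow> y \<in> closure \<Omega> \<Longrightarrow> x \<noteq> y \<Longrightarrow>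
      \<exists>z l l'. l \<le> K * dist x y \<and> l' \<le> K * dist x y \<and> escape \<Omega> c K l x z \<and> escape \<Omega> c K l' y z"
  shows "uniform_domain \<Omega>"
proof -
  \<comment> \<open>The first term bounds the length, the second one the distance to the end points.\<close>
  define C where "C = max (2 * K * K) (K / c)"
  have C: "C > 0" using c K by (simp add: C_def less_max_iff_disj)
  have main: "\<exists>\<gamma>. path \<gamma> \<and> pathstart \<gamma> = x \<and> pathfinish \<gamma> = y \<and> path_image \<gamma> \<subseteq> \<Omega> \<union> {x, y} \<and>
        path_length \<gamma> \<le> ennreal (C * dist x y) \<and>
        (\<forall>z\<in>path_image \<gamma>. \<forall>w\<in>frontier \<Omega>. dist z w \<ge> infdist z {x, y} / C)"
    if x: "x \<in> closure \<Omega>" and y: "y \<in> closure \<Omega>" for x y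
  proof (cases "x = y")
    case True
    have "path_length (\<lambda>_. x) \<le> ennreal 0"
      by (rule path_length_lipschitz) (auto intro: lipschitz_on_leI)
    then show ?thesis using True
      by (intro exI[of _ "\<lambda>_. x"]) (auto simp: path_def pathstart_def pathfinish_def path_image_def)
  next
    case False
    obtain z l l' where l: "l \<le> K * dist x y" "l' \<le> K * dist x y"
        and e: "escape \<Omega> c K l x z" "escape \<Omega> c K l' y z"
      using esc[OF x y False] by blast
    obtain g where g: "0 \<le> l" "g 0 = x" "g l = z" "K-lipschitz_on {0..l} g"
       "\<And>s w. 0 \<le> s \<Longrightarrow> s \<le> l \<Longrightarrow> w \<notin> \<Omega> \<Longrightarrow> c * s \<le> dist (g s) w"
      using e(1) unfolding escape_def by auto
    obtain h where h: "0 \<le> l'" "h 0 = y" "h l' = z" "K-lipschitz_on {0..l'} h"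
       "\<And>s w. 0 \<le> s \<Longrightarrow> s \<le> l' \<Longrightarrow> w \<notin> \<Omega> \<Longrightarrow> c * s \<le> dist (h s) w"
      using e(2) unfolding escape_def by auto
    define r where "r = dist x y"
    define f where "f t = (if t \<le> 1/2 then g (2 * l * t) else h (2 * l' * (1 - t)))" for t
    have r: "r > 0" using False by (simp add: r_def)
    have scal: "K * (2 * m) * \<bar>u\<bar> \<le> C * r * \<bar>u\<bar>" if "m \<le> K * r" "0 \<le> m" for m u
    proof -
      have "K * (2 * m) \<le> K * (2 * (K * r))" using K that by (intro mult_left_mono) auto
      also have "\<dots> = (2 * K * K) * r" by simp
      also have "\<dots> \<le> C * r" using r by (intro mult_right_mono) (auto simp: C_def)
      finally show ?thesis by (rule mult_right_mono) simp
    qed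
    have lip: "(C * r)-lipschitz_on {0..1} f"
      unfolding f_def
    proof (rule lipschitz_on_concat)
      show "(C * r)-lipschitz_on {0..1/2} (\<lambda>t. g (2 * l * t))"
      proof (rule lipschitz_onI)
        fix s t :: real assume st: "s \<in> {0..1/2}" "t \<in> {0..1/2}"
        have "dist (g (2 * l * s)) (g (2 * l * t)) \<le> K * dist (2 * l * s) (2 * l * t)"
          using st g(1) mult_left_mono[of "2 * s" 1 l] mult_left_mono[of "2 * t" 1 l]
          by (intro lipschitz_onD[OF g(4)]) (auto simp: mult_ac)
        also have "\<dots> = K * (2 * l) * \<bar>s - t\<bar>"
          using g(1) by (simp add: dist_real_def right_diff_distrib[symmetric] abs_mult)
        also have "\<dots> \<le> C * r * \<bar>s - t\<bar>" using scal l g(1) by (simp add: r_def)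
        finally show "dist (g (2 * l * s)) (g (2 * l * t)) \<le> C * r * dist s t" by (simp add: dist_real_def)
      qed (use C r in simp)
      show "(C * r)-lipschitz_on {1/2..1} (\<lambda>t. h (2 * l' * (1 - t)))"
      proof (rule lipschitz_onI)
        fix s t :: real assume st: "s \<in> {1/2..1}" "t \<in> {1/2..1}"
        have "dist (h (2 * l' * (1 - s))) (h (2 * l' * (1 - t))) \<le> K * dist (2 * l' * (1 - s)) (2 * l' * (1 - t))"
          using st h(1) mult_left_mono[of "2 * (1 - s)" 1 l'] mult_left_mono[of "2 * (1 - t)" 1 l']
          by (intro lipschitz_onD[OF h(4)]) (auto simp: mult_ac)
        also have "\<dots> = K * (2 * l') * \<bar>s - t\<bar>"
        proof -
          have "2 * l' * (1 - s) - 2 * l' * (1 - t) = 2 * l' * (t - s)" by (simp add: algebra_simps)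
          then show ?thesis using h(1) by (simp add: dist_real_def abs_mult abs_minus_commute)
        qed
        also have "\<dots> \<le> C * r * \<bar>s - t\<bar>" using scal l h(1) by (simp add: r_def)
        finally show "dist (h (2 * l' * (1 - s))) (h (2 * l' * (1 - t))) \<le> C * r * dist s t" by (simp add: dist_real_def)
      qed (use C r in simp)
    qed (use g h in simp)
    have near: "infdist (f t) {x, y} / C \<le> dist (f t) w \<and> (f t \<in> \<Omega> \<or> f t \<in> {x, y})"
      if t: "t \<in> {0..1}" and w: "w \<notin> \<Omega>" for t w
    proof -
      have one: "infdist q {x, y} / C \<le> dist q w \<and> (q \<in> \<Omega> \<or> q \<in> {x, y})"
        if "s \<ge> 0" "p \<in> {x, y}" "dist q p \<le> K * s" "\<And>w. w \<notin> \<Omega> \<Longrightarrow> c * s \<le> dist q w" for q p s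
      proof -
        have "infdist q {x, y} \<le> dist q p" using that(2) by (rule infdist_le)
        also have "\<dots> \<le> (K / c) * (c * s)" using that(3) c by simp
        also have "\<dots> \<le> (K / c) * dist q w" using that(4)[OF w] K c by (intro mult_left_mono) auto
        also have "\<dots> \<le> C * dist q w" by (intro mult_right_mono) (auto simp: C_def)
        finally have "infdist q {x, y} / C \<le> dist q w" using C by (simp add: field_simps)
        moreover have "q \<in> \<Omega> \<or> q \<in> {x, y}"
        proof (rule ccontr)
          assume *: "\<not> (q \<in> \<Omega> \<or> q \<in> {x, y})"
          then have "c * s \<le> 0" using that(4)[of q] by simp
          then have "s = 0" using c that(1) by (simp add: mult_le_0_iff)
          then have "q = p" using that(3) by simp
          then show False using * that(2) by blast
        qed
        ultimately show ?thesis by blast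
      qed
      show ?thesis
      proof (cases "t \<le> 1/2")
        case True
        have s: "0 \<le> 2 * l * t" "2 * l * t \<le> l"
          using t True g(1) mult_left_mono[of "2 * t" 1 l] by (auto simp: mult_ac)
        show ?thesis
          using True one[of "2 * l * t" x "f t"] s g lipschitz_onD[OF g(4), of "2 * l * t" 0]
          by (simp add: f_def dist_real_def)
      next
        case False
        have s: "0 \<le> 2 * l' * (1 - t)" "2 * l' * (1 - t) \<le> l'"
          using t False h(1) mult_left_mono[of "2 * (1 - t)" 1 l'] by (auto simp: mult_ac)
        show ?thesis
          using False one[of "2 * l' * (1 - t)" y "f t"] s h lipschitz_onD[OF h(4), of "2 * l' * (1 - t)" 0]
          by (simp add: f_def dist_real_def)
      qed
    qed
    show ?thesis
    proof (intro exI[of _ f] conjI ballI)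
      show "path f" unfolding path_def using lip by (rule lipschitz_on_continuous_on)
      show "pathstart f = x" "pathfinish f = y" using g h by (auto simp: pathstart_def pathfinish_def f_def)
      show "path_length f \<le> ennreal (C * dist x y)" using path_length_lipschitz[OF lip] by (simp add: r_def)
      show "path_image f \<subseteq> \<Omega> \<union> {x, y}"
      proof (cases "\<Omega> = UNIV")
        case False
        then obtain w where "w \<notin> \<Omega>" by blast
        then show ?thesis using near by (fastforce simp: path_image_def)
      qed simp
      fix z w assume "z \<in> path_image f" "w \<in> frontier \<Omega>"
      moreover have "w \<notin> \<Omega>" using \<open>w \<in> frontier \<Omega>\<close> op by (auto simp: frontier_def interior_open)
      ultimately show "infdist z {x, y} / C \<le> dist z w" using near by (auto simp: path_image_def)
    qed
  qed
  have "path_connected \<Omega>"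
    unfolding path_connected_def
  proof (intro ballI)
    fix x y assume xy: "x \<in> \<Omega>" "y \<in> \<Omega>"
    then have "x \<in> closure \<Omega>" "y \<in> closure \<Omega>" using closure_subset by auto
    from main[OF this] obtain g where "path g" "pathstart g = x" "pathfinish g = y" "path_image g \<subseteq> \<Omega> \<union> {x, y}"
      by blast
    then show "\<exists>g. path g \<and> path_image g \<subseteq> \<Omega> \<and> pathstart g = x \<and> pathfinish g = y"
      using xy by (intro exI[of _ g]) auto
  qed
  then have "connected \<Omega>" by (rule path_connected_imp_connected)
  then show ?thesis
    unfolding uniform_domain_def domain_def using op ne C main by blast
qed

section \<open>The perforated half-space\<close>

text \<open>Generation \<open>k\<close> consists of the Whitney squares of side \<open>2 powi (-k)\<close> between the heights \<open>side k\<close> and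
  \<open>2 * side k\<close>. All integers \<open>k\<close> occur, so that these squares fill the half-plane.\<close>
definition side :: "int \<Rightarrow> real" where "side k = 2 powi (-k)"

text \<open>Half the side of the obstacle in a square of generation \<open>k\<close>. For \<open>k \<ge> 0\<close> its relative size
  \<open>2 ^ -k / 8\<close> is summable over \<open>k\<close>, which keeps the boundary locally finite, but the logarithm of the
  relative size grows only linearly, so that its reciprocals are not summable; the latter makes the
  obstacles shield the hyperplane. For \<open>k < 0\<close> the truncation by \<^const>\<open>nat\<close> makes the relative size \<open>1/8\<close>.\<close>
definition rad :: "int \<Rightarrow> real" where "rad k = side k / 8 / 2 ^ nat k"

lemma side_pos [simp]: "side k > 0" by (simp add: side_def)

lemma side_sign [simp]: "\<not> side k \<le> 0" "side k \<ge> 0" "side k \<noteq> 0" using side_pos[of k] by linarith+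

lemma side_Suc: "side (k + 1) = side k / 2"
  by (simp add: side_def power_int_diff)

lemma side_add: "side (k + int n) = side k / 2 ^ n"
proof (induction n)
  case (Suc n)
  have "side (k + int (Suc n)) = side (k + int n + 1)" by (simp add: add_ac)
  also have "\<dots> = side k / 2 ^ n / 2" using Suc by (simp only: side_Suc)
  finally show ?case by (simp add: mult.commute)
qed simp

lemma side_half: "k < k' \<Longrightarrow> side k' \<le> side k / 2"
proof -
  assume "k < k'"
  then have "k' = k + int (Suc (nat (k' - k - 1)))" by simp
  then have "side k' = side k / 2 ^ Suc (nat (k' - k - 1))" using side_add by metis
  also have "\<dots> \<le> side k / 2" by (simp add: field_simps)
  finally show ?thesis .
qed

lemma side_nat: "side (int n) = 1 / 2 ^ n"
  using side_add[of 0 n] by (simp add: side_def)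

lemma side_slab: assumes "t > 0" obtains k where "side k \<le> t" "t < 2 * side k"
proof
  define k where "k = - \<lfloor>log 2 t\<rfloor>"
  have "side k = 2 powr \<lfloor>log 2 t\<rfloor>" by (simp add: side_def k_def powr_real_of_int')
  moreover have "2 powr real_of_int \<lfloor>log 2 t\<rfloor> \<le> 2 powr (log 2 t)" by (intro powr_mono) auto
  moreover have "2 powr (log 2 t) < 2 powr (real_of_int \<lfloor>log 2 t\<rfloor> + 1)"
    by (intro powr_less_mono) linarith+
  ultimately show "side k \<le> t" "t < 2 * side k" using assms by (auto simp: powr_add)
qed

lemma side_slab_unique:
  assumes "side k \<le> t" "t < 2 * side k" "side k' \<le> t" "t < 2 * side k'"
  shows "k = k'"
  using side_half[of k k'] side_half[of k' k] assms by (cases k k' rule: linorder_cases) auto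

lemma rad_pos [simp]: "rad k > 0" by (simp add: rad_def)

lemma rad_nonzero [simp]: "rad k \<noteq> 0" "rad k \<ge> 0"
  by (simp_all add: rad_def)

lemma rad_le: "rad k \<le> side k / 8"
  using divide_left_mono[of 1 "2 ^ nat k" "side k / 8"] by (simp add: rad_def)

text \<open>The obstacles depend on two coordinates only: \<open>b\<close> is the height, \<open>a\<close> the horizontal coordinate.\<close>
locale two_axes =
  fixes a b :: "'n::finite"
  assumes ab: "a \<noteq> b"
begin

text \<open>Distance in the maximum norm of the \<open>(a, b)\<close>-plane from the centre of the \<open>m\<close>-th square of generation \<open>k\<close>.\<close>
definition offset :: "int \<Rightarrow> int \<Rightarrow> (real, 'n) vec \<Rightarrow> real" where
  "offset k m z = max \<bar>z $ a - (m + 1/2) * side k\<bar> \<bar>z $ b - 3/2 * side k\<bar>"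

definition Dom :: "(real, 'n) vec set" where
  "Dom = {z. 0 < z $ b \<and> (\<forall>k m. rad k < offset k m z)}"

lemma coord_dist: "\<bar>z $ j - w $ j\<bar> \<le> dist z w" for z w :: "(real, 'n) vec"
  using component_le_norm_cart[of "z - w" j] by (simp add: dist_norm)

lemma offset_diff: "\<bar>offset k m z - offset k m w\<bar> \<le> dist z w"
  using coord_dist[of z a w] coord_dist[of z b w] unfolding offset_def by linarith

lemma cell_ex:
  assumes "z $ b > 0"
  obtains k m where "side k \<le> z $ b" "z $ b < 2 * side k" "offset k m z \<le> side k / 2"
proof -
  obtain k where k: "side k \<le> z $ b" "z $ b < 2 * side k" using side_slab[OF assms] by blast
  define m where "m = \<lfloor>z $ a / side k\<rfloor>"
  have "real_of_int m \<le> z $ a / side k" "z $ a / side k < m + 1" by (auto simp: m_def)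
  then have "m * side k \<le> z $ a" "z $ a < (m + 1) * side k" using side_pos[of k] by (simp_all add: field_simps)
  then have "offset k m z \<le> side k / 2"
    unfolding offset_def max.bounded_iff abs_le_iff using k by (simp add: algebra_simps)
  then show ?thesis using k that by blast
qed

text \<open>Obstacles stay in the middle quarter of their squares, hence between the heights \<open>11/8\<close> and
  \<open>13/8\<close> times the side. The closest foreign ones belong to the next generation below; their tops are
  at \<open>13/16\<close> of the present side, \<open>3/16\<close> below the square.\<close>
lemma cell_sep:
  assumes z: "offset k m z \<le> side k / 2" and w: "offset k' m' w \<le> rad k'" and ne: "(k', m') \<noteq> (k, m)"
  shows "side k / 8 \<le> dist z w"
proof -
  have w': "\<bar>w $ a - (m' + 1/2) * side k'\<bar> \<le> side k' / 8" "\<bar>w $ b - 3/2 * side k'\<bar> \<le> side k' / 8"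
    using w rad_le[of k'] unfolding offset_def by linarith+
  have z': "\<bar>z $ a - (m + 1/2) * side k\<bar> \<le> side k / 2" "\<bar>z $ b - 3/2 * side k\<bar> \<le> side k / 2"
    using z unfolding offset_def by linarith+
  consider "k' < k" | "k < k'" | "k' = k" "m' \<noteq> m" using ne by fastforce
  then have "side k / 8 \<le> \<bar>z $ a - w $ a\<bar> \<or> side k / 8 \<le> \<bar>z $ b - w $ b\<bar>"
  proof cases
    case 3
    have "1 \<le> \<bar>real_of_int m - m'\<bar>" using 3 by linarith
    then have "1 * side k \<le> \<bar>real_of_int m - m'\<bar> * side k" by (intro mult_right_mono) auto
    also have "\<dots> = \<bar>(m + 1/2) * side k - (m' + 1/2) * side k\<bar>"
      by (simp add: left_diff_distrib[symmetric] abs_mult)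
    finally have "side k \<le> \<bar>(m + 1/2) * side k - (m' + 1/2) * side k\<bar>" by simp
    then show ?thesis using w' z' side_pos[of k] unfolding 3 by linarith
  next
    case 1 then show ?thesis using w' z' side_half[OF 1] side_pos[of k] by linarith
  next
    case 2 then show ?thesis using w' z' side_half[OF 2] side_pos[of k] by linarith
  qed
  then show ?thesis using coord_dist[of z a w] coord_dist[of z b w] by linarith
qed

text \<open>Seen from a point of a Whitney square, only the obstacle in that square can be closer than a fixed
  fraction of the side. All clearance estimates below reduce to this one.\<close>
lemma dist_compl:
  assumes z: "offset k m z \<le> side k / 2" and w: "w \<notin> Dom"
  shows "min (side k / 8) (offset k m z - rad k) \<le> dist z w"
proof (cases "0 < w $ b")
  case False
  have "\<bar>z $ b - 3/2 * side k\<bar> \<le> side k / 2" using z unfolding offset_def by linarith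
  then have "side k \<le> \<bar>z $ b - w $ b\<bar>" using False by linarith
  then show ?thesis using coord_dist[of z b w] side_pos[of k] by linarith
next
  case True
  then obtain k' m' where w': "offset k' m' w \<le> rad k'" using w by (auto simp: Dom_def not_less)
  show ?thesis
  proof (cases "(k', m') = (k, m)")
    case True
    then show ?thesis using w' offset_diff[of k m z w] by auto
  qed (use cell_sep[OF z w'] in auto)
qed

lemma open_Dom: "open Dom"
  unfolding open_contains_ball
proof
  fix z assume z: "z \<in> Dom"
  then have "z $ b > 0" by (simp add: Dom_def)
  then obtain k m where km: "offset k m z \<le> side k / 2" by (rule cell_ex)
  define e where "e = min (side k / 8) (offset k m z - rad k)"
  have "e > 0" using z by (auto simp: Dom_def e_def)
  moreover have "ball z e \<subseteq> Dom" using dist_compl[OF km] by (force simp: e_def)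
  ultimately show "\<exists>e>0. ball z e \<subseteq> Dom" by blast
qed

lemma continuous_offset: "continuous_on S (offset k m)"
  unfolding offset_def by (intro continuous_intros)

lemma closure_Dom:
  assumes "z \<in> closure Dom"
  shows "0 \<le> z $ b" "rad k \<le> offset k m z"
proof -
  have "closed {z. 0 \<le> z $ b \<and> rad k \<le> offset k m z}"
    by (intro closed_Collect_conj closed_Collect_le continuous_intros continuous_offset)
  then have "closure Dom \<subseteq> {z. 0 \<le> z $ b \<and> rad k \<le> offset k m z}"
    by (intro closure_minimal) (auto simp: Dom_def less_imp_le)
  then show "0 \<le> z $ b" "rad k \<le> offset k m z" using assms by auto
qed

definition planar :: "real \<Rightarrow> real \<Rightarrow> (real, 'n) vec" where
  "planar u v = u *\<^sub>R axis a 1 + v *\<^sub>R axis b 1"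

lemma planar_nth [simp]: "planar u v $ a = u" "planar u v $ b = v"
  using ab by (auto simp: planar_def axis_def)

lemma planar_nth_other: "j \<noteq> a \<Longrightarrow> j \<noteq> b \<Longrightarrow> planar u v $ j = 0"
  by (auto simp: planar_def axis_def)

lemma norm_planar: "norm (planar u v) \<le> \<bar>u\<bar> + \<bar>v\<bar>"
  unfolding planar_def by (rule order_trans[OF norm_triangle_ineq]) (simp add: norm_axis_1)

text \<open>The heights separating two generations are free of obstacles, so that one can travel along them.\<close>
lemma grid_height_dist:
  assumes "z $ b = side j" "w \<notin> Dom" shows "side j / 8 \<le> dist z w"
proof -
  obtain k m where km: "side k \<le> z $ b" "z $ b < 2 * side k" "offset k m z \<le> side k / 2"
    using cell_ex[of z] assms by auto
  have "k = j" using km assms side_slab_unique[of k "side j" j] side_pos[of j] by simp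
  then have "side j / 2 \<le> offset j m z" using assms by (simp add: offset_def)
  then show ?thesis using dist_compl[OF km(3) assms(2)] rad_le[of j] side_pos[of j] \<open>k = j\<close> by auto
qed

end

section \<open>Uniformity of the perforated half-space\<close>

text \<open>In units of the side, \<open>[1, 2]\<close> is the range of heights of a generation, and \<open>[5/4, 7/4]\<close>, where the
  value is \<open>1\<close>, contains the heights of its obstacles.\<close>
definition plateau :: "real \<Rightarrow> real" where
  "plateau u = min 1 (4 * min (u - 1) (2 - u))"

lemma plateau_lipschitz: "\<bar>plateau u - plateau v\<bar> \<le> 4 * \<bar>u - v\<bar>"
  unfolding plateau_def by (auto simp: min_def abs_if)

lemma plateau_eq_1: "5/4 \<le> u \<Longrightarrow> u \<le> 7/4 \<Longrightarrow> plateau u = 1"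
  unfolding plateau_def by (auto simp: min_def)

lemma plateau_bounds:
  "plateau u \<le> 4 * (u - 1)" "plateau u \<le> 4 * (2 - u)" "1 \<le> u \<Longrightarrow> u \<le> 2 \<Longrightarrow> 0 \<le> plateau u"
  unfolding plateau_def by (auto simp: min_def)

lemma clearance_along_segment:
  fixes l r D s :: real
  assumes "0 \<le> s" "s \<le> 1" "0 \<le> r" "l + r \<le> 32 * D"
  shows "1/32 * (l + s * r) \<le> D"
proof -
  have "l + s * r \<le> l + 1 * r" by (intro add_left_mono mult_right_mono assms)
  also have "\<dots> \<le> 32 * D" using assms by simp
  finally show ?thesis by simp
qed

context two_axes begin

text \<open>Dilation of the \<open>(a, b)\<close>-plane about the centre of a square, by the factor \<open>1 + \<theta>\<close>.\<close>
definition push :: "int \<Rightarrow> int \<Rightarrow> real \<Rightarrow> (real, 'n) vec \<Rightarrow> (real, 'n) vec" where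
  "push k m \<theta> x = x + planar (\<theta> * (x $ a - (m + 1/2) * side k)) (\<theta> * (x $ b - 3/2 * side k))"

lemma offset_push:
  assumes "\<theta> \<ge> 0" shows "offset k m (push k m \<theta> x) = (1 + \<theta>) * offset k m x"
proof -
  have "push k m \<theta> x $ a - (m + 1/2) * side k = (1 + \<theta>) * (x $ a - (m + 1/2) * side k)"
       "push k m \<theta> x $ b - 3/2 * side k = (1 + \<theta>) * (x $ b - 3/2 * side k)"
    by (simp_all add: push_def algebra_simps)
  then show ?thesis using assms unfolding offset_def
    by (simp add: abs_mult max_mult_distrib_left)
qed

lemma dist_push:
  assumes "\<theta> \<ge> 0" shows "dist x (push k m \<theta> x) \<le> 2 * \<theta> * offset k m x"
proof -
  have "dist x (push k m \<theta> x) \<le> \<bar>\<theta> * (x $ a - (m + 1/2) * side k)\<bar> + \<bar>\<theta> * (x $ b - 3/2 * side k)\<bar>"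
    unfolding push_def using norm_planar by (simp add: dist_norm)
  also have "\<dots> \<le> \<theta> * offset k m x + \<theta> * offset k m x"
    unfolding abs_mult using assms by (intro add_mono mult_mono) (auto simp: offset_def)
  finally show ?thesis by simp
qed

lemma planar_scale: "s *\<^sub>R planar u v = planar (s * u) (s * v)"
  by (simp add: planar_def algebra_simps)

lemma push_segment: "x + s *\<^sub>R (push k m \<theta> x - x) = push k m (s * \<theta>) x"
  by (simp add: push_def planar_scale mult.assoc)

text \<open>The offset grows linearly along a dilation. Whatever clearance there is at the start, the clearance
  along the way is therefore at least proportional to the final one, and the start may lie on the obstacle.\<close>
lemma escape_push:
  assumes x: "rad k \<le> offset k m x" and \<theta>: "0 \<le> \<theta>" and cell: "(1 + \<theta>) * offset k m x \<le> side k / 2"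
    and l: "0 < l" "2 * \<theta> * offset k m x \<le> K * l"
    and c: "c * l \<le> side k / 8" "c * l \<le> (1 + \<theta>) * offset k m x - rad k" "0 \<le> c"
  shows "escape Dom c K l x (push k m \<theta> x)"
proof -
  have o0: "0 \<le> offset k m x" using x rad_pos[of k] by linarith
  then have "0 \<le> K * l" using l \<theta> by (smt (verit) mult_nonneg_nonneg)
  then have K: "0 \<le> K" using l by (simp add: zero_le_mult_iff)
  have "escape Dom c K (0 + l) x (push k m \<theta> x)"
  proof (rule escape_segment[OF escape_refl[OF K] l(1)])
    show "dist x (push k m \<theta> x) \<le> K * l" using dist_push[OF \<theta>, of x k m] l(2) by linarith
    fix s w assume s: "0 \<le> s" "s \<le> (1::real)" and w: "w \<notin> Dom"
    have o: "offset k m (push k m (s * \<theta>) x) = (1 + s * \<theta>) * offset k m x"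
      using s \<theta> by (intro offset_push) auto
    have "s * \<theta> \<le> \<theta>" using s \<theta> by (simp add: mult_left_le_one_le)
    then have "(1 + s * \<theta>) * offset k m x \<le> (1 + \<theta>) * offset k m x"
      using o0 by (intro mult_right_mono) auto
    then have "offset k m (push k m (s * \<theta>) x) \<le> side k / 2" using cell o by simp
    from dist_compl[OF this w]
    have d: "min (side k / 8) ((1 + s * \<theta>) * offset k m x - rad k) \<le> dist (push k m (s * \<theta>) x) w"
      using o by simp
    have "s * (c * l) \<le> 1 * (side k / 8)" using s c l by (intro mult_mono) auto
    moreover have "s * (c * l) \<le> s * ((1 + \<theta>) * offset k m x - rad k) + (1 - s) * (offset k m x - rad k)"
    proof -
      have "0 \<le> (1 - s) * (offset k m x - rad k)" using s x by (intro mult_nonneg_nonneg) auto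
      then show ?thesis using mult_left_mono[OF c(2) s(1)] by linarith
    qed
    moreover have "s * ((1 + \<theta>) * offset k m x - rad k) + (1 - s) * (offset k m x - rad k)
        = (1 + s * \<theta>) * offset k m x - rad k"
      by (simp add: algebra_simps)
    ultimately have "s * (c * l) \<le> dist (push k m (s * \<theta>) x) w"
      using d by linarith
    then show "c * (0 + s * l) \<le> dist (x + s *\<^sub>R (push k m \<theta> x - x)) w"
      unfolding push_segment by (simp add: mult.left_commute)
  qed
  then show ?thesis by simp
qed

definition level :: "real \<Rightarrow> int" where "level t = (THE k. side k \<le> t \<and> t < 2 * side k)"

lemma level_eq: "side k \<le> t \<Longrightarrow> t < 2 * side k \<Longrightarrow> level t = k"
  unfolding level_def using side_slab_unique by blast

text \<open>Horizontal displacement, at height \<open>t\<close>, of a path that climbs above \<open>\<xi>\<close>. At the heights of the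
  obstacles of a generation it leads to the nearest multiple of the side, which lies midway between two
  obstacles. At the heights separating generations it vanishes; hence the choices made in different
  generations, which are unrelated, fit together to a Lipschitz function.\<close>
definition sway :: "real \<Rightarrow> real \<Rightarrow> real" where
  "sway \<xi> t = (if t \<le> 0 then 0 else
     (side (level t) * round (\<xi> / side (level t)) - \<xi>) *
       plateau (t / side (level t)))"

lemma sway_eq:
  assumes "side k \<le> t" "t < 2 * side k"
  shows "sway \<xi> t = (side k * round (\<xi> / side k) - \<xi>) * plateau (t / side k)"
  using level_eq[OF assms] assms side_pos[of k] unfolding sway_def by auto

lemma round_scaled: "\<bar>side k * round (\<xi> / side k) - \<xi>\<bar> \<le> side k / 2"
proof -
  have "\<bar>side k * round (\<xi> / side k) - \<xi>\<bar> = side k * \<bar>round (\<xi> / side k) - \<xi> / side k\<bar>"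
    by (subst abs_of_pos[OF side_pos, symmetric], subst abs_mult[symmetric]) (simp add: algebra_simps)
  also have "\<dots> \<le> side k * (1/2)" by (intro mult_left_mono of_int_round_abs_le) auto
  finally show ?thesis by simp
qed

text \<open>The displacement is at most half a side, and it is reached within a quarter of the height range:
  slope \<open>2\<close> from either end of the range.\<close>
lemma sway_bound:
  assumes "side k \<le> t" "t < 2 * side k"
  shows "\<bar>sway \<xi> t\<bar> \<le> 2 * (t - side k)" "\<bar>sway \<xi> t\<bar> \<le> 2 * (2 * side k - t)"
proof -
  define h where "h = plateau (t / side k)"
  have q: "t / side k \<ge> 1" "t / side k \<le> 2" using assms by (auto simp: field_simps)
  have "\<bar>sway \<xi> t\<bar> = \<bar>side k * round (\<xi> / side k) - \<xi>\<bar> * h"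
    using sway_eq[OF assms] plateau_bounds(3)[OF q] by (simp add: h_def abs_mult)
  also have "\<dots> \<le> side k / 2 * h" by (intro mult_right_mono round_scaled) (use plateau_bounds(3)[OF q] in \<open>simp add: h_def\<close>)
  finally have 1: "\<bar>sway \<xi> t\<bar> \<le> side k / 2 * h" .
  have "h \<le> 4 * (t / side k - 1)" "h \<le> 4 * (2 - t / side k)" unfolding h_def by (rule plateau_bounds)+
  then have "side k / 2 * h \<le> side k / 2 * (4 * (t / side k - 1))" "side k / 2 * h \<le> side k / 2 * (4 * (2 - t / side k))"
    by (auto intro!: mult_left_mono)
  then show "\<bar>sway \<xi> t\<bar> \<le> 2 * (t - side k)" "\<bar>sway \<xi> t\<bar> \<le> 2 * (2 * side k - t)"
    using 1 by (auto simp: algebra_simps)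
qed

lemma sway_lipschitz_less:
  assumes "0 \<le> s" "s < t"
  shows "\<bar>sway \<xi> s - sway \<xi> t\<bar> \<le> 2 * (t - s)"
proof -
  obtain k where k: "side k \<le> t" "t < 2 * side k" using side_slab[of t] assms by auto
  show ?thesis
  proof (cases "s = 0")
    case True
    then have "sway \<xi> s = 0" by (simp add: sway_def)
    moreover have "\<bar>sway \<xi> t\<bar> \<le> 2 * t" using sway_bound(1)[OF k, of \<xi>] side_pos[of k] by argo
    ultimately show ?thesis using True by simp
  next
    case False
    then obtain k' where k': "side k' \<le> s" "s < 2 * side k'" using side_slab[of s] assms by auto
    show ?thesis
    proof (cases "k = k'")
      case True
      define h where "h u = plateau (u / side k)" for u
      have "\<bar>h s - h t\<bar> \<le> 4 * \<bar>s / side k - t / side k\<bar>" unfolding h_def by (rule plateau_lipschitz)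
      also have "\<dots> = 4 * ((t - s) / side k)" using assms by (simp add: diff_divide_distrib[symmetric])
      finally have h: "\<bar>h s - h t\<bar> \<le> 4 * ((t - s) / side k)" .
      have "sway \<xi> s - sway \<xi> t = (side k * round (\<xi> / side k) - \<xi>) * (h s - h t)"
        unfolding sway_eq[OF k] sway_eq[OF k'[folded True]] h_def by (simp add: algebra_simps)
      then have "\<bar>sway \<xi> s - sway \<xi> t\<bar> = \<bar>side k * round (\<xi> / side k) - \<xi>\<bar> * \<bar>h s - h t\<bar>"
        by (simp add: abs_mult)
      also have "\<dots> \<le> (side k / 2) * (4 * ((t - s) / side k))"
        by (intro mult_mono round_scaled h) auto
      finally show ?thesis by simp
    next
      case False
      have "k < k'"
      proof (rule ccontr)
        assume "\<not> k < k'"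
        then have "k' < k" using False by simp
        from side_half[OF this] show False using k k' assms by linarith
      qed
      from side_half[OF this] show ?thesis
        using sway_bound(2)[OF k', of \<xi>] sway_bound(1)[OF k, of \<xi>]
          abs_triangle_ineq4[of "sway \<xi> s" "sway \<xi> t"] by argo
    qed
  qed
qed

lemma sway_lipschitz:
  assumes "0 \<le> s" "0 \<le> t"
  shows "\<bar>sway \<xi> s - sway \<xi> t\<bar> \<le> 2 * \<bar>s - t\<bar>"
  using assms sway_lipschitz_less[of s t \<xi>] sway_lipschitz_less[of t s \<xi>]
  by (cases s t rule: linorder_cases) auto

definition climb :: "(real, 'n) vec \<Rightarrow> real \<Rightarrow> (real, 'n) vec" where
  "climb p t = p + planar (sway (p $ a) t) (t - p $ b)"

lemma climb_nth [simp]: "climb p t $ a = p $ a + sway (p $ a) t" "climb p t $ b = t"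
  by (simp_all add: climb_def)

lemma planar_diff: "planar u v - planar u' v' = planar (u - u') (v - v')"
  by (simp add: planar_def algebra_simps)

lemma climb_lipschitz:
  assumes "0 \<le> s" "0 \<le> t"
  shows "dist (climb p s) (climb p t) \<le> 3 * \<bar>s - t\<bar>"
proof -
  have "climb p s - climb p t = planar (sway (p $ a) s - sway (p $ a) t) (s - t)"
    by (simp add: climb_def planar_diff)
  then show ?thesis
    using norm_planar[of "sway (p $ a) s - sway (p $ a) t" "s - t"] sway_lipschitz[OF assms, of "p $ a"]
    by (simp add: dist_norm)
qed

text \<open>Either the height is none of the obstacles' heights, or the sway has brought the point midway
  between two obstacles; both give clearance \<open>side k / 8\<close> at heights below \<open>2 * side k\<close>.\<close>
lemma climb_dist:
  assumes t: "0 \<le> t" and w: "w \<notin> Dom"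
  shows "t / 16 \<le> dist (climb p t) w"
proof (cases "t = 0")
  case False
  define z where "z = climb p t"
  have zb: "z $ b = t" by (simp add: z_def)
  obtain k m where km: "side k \<le> z $ b" "z $ b < 2 * side k" "offset k m z \<le> side k / 2"
    using cell_ex[of z] t False zb by auto
  have "side k / 4 \<le> offset k m z"
  proof (cases "side k / 4 \<le> \<bar>t - 3/2 * side k\<bar>")
    case True then show ?thesis unfolding offset_def zb by linarith
  next
    case F: False
    have h1: "5/4 \<le> t / side k" "t / side k \<le> 7/4" using F by (simp_all add: abs_le_iff field_simps abs_if split: if_splits)
    have h: "plateau (t / side k) = 1" using h1 by (rule plateau_eq_1)
    define i where "i = round (p $ a / side k)"
    have za: "z $ a = side k * i"
      using sway_eq[of k t "p $ a"] km h zb by (simp add: z_def i_def)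
    have "i \<le> m \<or> m + 1 \<le> i" by linarith
    then have "real_of_int i \<le> m \<or> real_of_int m + 1 \<le> i" by (metis of_int_1 of_int_add of_int_le_iff)
    then have "1/2 \<le> \<bar>real_of_int i - (m + 1/2)\<bar>" by (auto simp: abs_if)
    then have "side k * (1/2) \<le> side k * \<bar>real_of_int i - (m + 1/2)\<bar>" by (intro mult_left_mono) auto
    also have "\<dots> = \<bar>z $ a - (m + 1/2) * side k\<bar>"
      unfolding za by (subst abs_of_pos[OF side_pos, symmetric], subst abs_mult[symmetric]) (simp add: algebra_simps)
    finally show ?thesis using side_pos[of k] unfolding offset_def by linarith
  qed
  then show ?thesis using dist_compl[OF km(3) w] rad_le[of k] km zb by (simp add: z_def)
qed simp

lemma escape_climb:
  assumes "escape Dom (1/16) 3 l p q" "l \<le> q $ b" "0 \<le> q $ b" "sway (q $ a) (q $ b) = 0" "q $ b \<le> T"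
  shows "escape Dom (1/16) 3 (l + (T - q $ b)) p (climb q T)"
proof (rule escape_concat[OF assms(1), where \<beta> = "\<lambda>s. climb q (q $ b + s)"])
  show "climb q (q $ b + 0) = q" using assms by (simp add: climb_def planar_def)
  show "3-lipschitz_on {0..T - q $ b} (\<lambda>s. climb q (q $ b + s))"
  proof (rule lipschitz_onI)
    fix s t assume "s \<in> {0..T - q $ b}" "t \<in> {0..T - q $ b}"
    then show "dist (climb q (q $ b + s)) (climb q (q $ b + t)) \<le> 3 * dist s t"
      using climb_lipschitz[of "q $ b + s" "q $ b + t" q] assms(3) by (simp add: dist_real_def)
  qed simp
  fix s w assume "0 \<le> s" "s \<le> T - q $ b" "w \<notin> Dom"
  then show "1 / 16 * (l + s) \<le> dist (climb q (q $ b + s)) w"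
    using climb_dist[of "q $ b + s" w q] assms by simp
qed (use assms in auto)

text \<open>On the boundary of a square a climb can start: horizontal edges separate generations, and vertical
  ones are already at a multiple of the side.\<close>
lemma cell_boundary_sway:
  assumes "offset k m q = side k / 2"
  shows "sway (q $ a) (q $ b) = 0" "side k \<le> q $ b" "q $ b \<le> 2 * side k"
proof -
  have q: "\<bar>q $ b - 3/2 * side k\<bar> \<le> side k / 2" using assms unfolding offset_def by linarith
  then show qb: "side k \<le> q $ b" "q $ b \<le> 2 * side k" by linarith+
  consider "q $ b = 2 * side k" | "q $ b = side k" | "q $ b < 2 * side k" "\<bar>q $ a - (m + 1/2) * side k\<bar> = side k / 2"
  proof -
    have "\<bar>q $ a - (m + 1/2) * side k\<bar> = side k / 2 \<or> \<bar>q $ b - 3/2 * side k\<bar> = side k / 2"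
      using assms unfolding offset_def by (auto simp: max_def split: if_splits)
    moreover have "q $ b = 2 * side k \<or> q $ b = side k" if "\<bar>q $ b - 3/2 * side k\<bar> = side k / 2"
      using that by (auto simp: abs_if split: if_splits)
    ultimately show thesis using that qb by fastforce
  qed
  then show "sway (q $ a) (q $ b) = 0"
  proof cases
    case 1
    have "side k = side (k - 1) / 2" using side_Suc[of "k - 1"] by simp
    then show ?thesis using sway_bound(1)[of "k - 1" "q $ b" "q $ a"] 1 side_pos[of k] by simp
  next
    case 2
    then show ?thesis using sway_bound(1)[of k "q $ b" "q $ a"] side_pos[of k] by simp
  next
    case 3
    have "q $ a = side k * m \<or> q $ a = side k * (m + 1)"
      using 3 by (auto simp: abs_if algebra_simps split: if_splits)
    then obtain i :: int where "q $ a = side k * i" by (metis of_int_1 of_int_add)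
    then show ?thesis using sway_eq[OF qb(1) 3(1)] by simp
  qed
qed

text \<open>From a point of a square, which may touch the obstacle, a dilation leads to the boundary of the
  square, and from there one climbs. Points of the hyperplane climb directly.\<close>
lemma escape_up:
  assumes x: "x \<in> closure Dom" and T: "2 * x $ b \<le> T" "0 < T"
  shows "\<exists>l z. l \<le> 2 * T \<and> escape Dom (1/16) 3 l x z \<and> z $ b = T"
proof (cases "x $ b = 0")
  case True
  have "escape Dom (1/16) 3 (0 + (T - x $ b)) x (climb x T)"
    by (rule escape_climb) (use True T in \<open>auto simp: sway_def intro: escape_refl\<close>)
  then show ?thesis using True T by (intro exI[of _ T] exI[of _ "climb x T"]) auto
next
  case False
  then have "0 < x $ b" using closure_Dom(1)[OF x] by simp
  then obtain k m where km: "side k \<le> x $ b" "x $ b < 2 * side k" "offset k m x \<le> side k / 2" by (rule cell_ex)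
  have rx: "rad k \<le> offset k m x" using closure_Dom(2)[OF x] .
  then have ox: "0 < offset k m x" using rad_pos[of k] by linarith
  define \<theta> where "\<theta> = side k / (2 * offset k m x) - 1"
  have \<theta>: "0 \<le> \<theta>" "(1 + \<theta>) * offset k m x = side k / 2" using km ox by (auto simp: \<theta>_def field_simps)
  define q where "q = push k m \<theta> x"
  have "escape Dom (1/16) 3 (side k) x q"
    unfolding q_def
  proof (rule escape_push[OF rx \<theta>(1)])
    have "\<theta> * offset k m x = side k / 2 - offset k m x" using \<theta>(2) by (simp add: algebra_simps)
    also have "\<dots> \<le> side k" using ox side_pos[of k] by linarith
    finally have "2 * (\<theta> * offset k m x) \<le> 3 * side k" using side_pos[of k] by linarith
    then show "2 * \<theta> * offset k m x \<le> 3 * side k" by (simp add: mult.assoc)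
    show "1/16 * side k \<le> (1 + \<theta>) * offset k m x - rad k"
      unfolding \<theta>(2) using rad_le[of k] side_pos[of k] by linarith
    show "(1 + \<theta>) * offset k m x \<le> side k / 2" using \<theta>(2) by simp
  qed auto
  moreover have oq: "offset k m q = side k / 2" using offset_push \<theta> by (simp add: q_def)
  moreover have "q $ b \<le> T" using cell_boundary_sway(3)[OF oq] km T by linarith
  ultimately have "escape Dom (1/16) 3 (side k + (T - q $ b)) x (climb q T)"
    using cell_boundary_sway[OF oq] side_pos[of k] by (intro escape_climb) auto
  moreover have "side k + (T - q $ b) \<le> 2 * T" using cell_boundary_sway(2)[OF oq] T by simp
  ultimately show ?thesis by (intro exI[of _ "side k + (T - q $ b)"] exI[of _ "climb q T"]) auto
qed

lemma escape_to_height: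
  assumes x: "x \<in> closure Dom" and T: "2 * x $ b \<le> T" "T = side j" and Z: "Z $ b = T" "dist x Z \<le> 2 * T"
  shows "\<exists>l. l \<le> 3 * T \<and> escape Dom (1/32) 8 l x Z"
proof -
  have T0: "0 < T" using T by simp
  obtain l z where lz: "l \<le> 2 * T" "escape Dom (1/16) 3 l x z" "z $ b = T"
    using escape_up[OF x T(1) T0] by blast
  have l0: "0 \<le> l" using lz(2) by (simp add: escape_def)
  have "escape Dom (1/32) 8 (l + T) x Z"
  proof (rule escape_segment)
    show "escape Dom (1/32) 8 l x z" by (rule escape_mono[OF lz(2)]) auto
    show "0 < T" by fact
    show "dist z Z \<le> 8 * T"
      using escape_dist[OF lz(2)] lz(1) Z(2) dist_triangle[of z Z x] by (simp add: dist_commute)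
    fix s w assume s: "0 \<le> s" "s \<le> (1::real)" and w: "w \<notin> Dom"
    have "(z + s *\<^sub>R (Z - z)) $ b = side j" using lz Z T by (simp add: algebra_simps)
    from grid_height_dist[OF this w] have "T / 8 \<le> dist (z + s *\<^sub>R (Z - z)) w" using T by simp
    then show "1/32 * (l + s * T) \<le> dist (z + s *\<^sub>R (Z - z)) w"
      using s lz(1) T0 by (intro clearance_along_segment) auto
  qed
  then show ?thesis using lz(1) by (intro exI[of _ "l + T"]) auto
qed

text \<open>If two vectors enclose no obtuse angle, the segment between them keeps the Euclidean distance
  \<open>R / sqrt 2\<close> from the origin, and passing to the maximum norm costs another \<open>sqrt 2\<close>.\<close>
lemma right_angle_segment:
  fixes p1 p2 q1 q2 R s :: real
  assumes "max \<bar>p1\<bar> \<bar>p2\<bar> = R" "max \<bar>q1\<bar> \<bar>q2\<bar> = R" "0 \<le> p1 * q1 + p2 * q2" "0 \<le> s" "s \<le> 1"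
  defines "m \<equiv> max \<bar>(1 - s) * p1 + s * q1\<bar> \<bar>(1 - s) * p2 + s * q2\<bar>"
  shows "R / 2 \<le> m" "m \<le> R"
proof -
  have R: "R \<ge> 0" using assms(1) by linarith
  have le: "\<bar>(1 - s) * u + s * v\<bar> \<le> R" if "\<bar>u\<bar> \<le> R" "\<bar>v\<bar> \<le> R" for u v
  proof -
    have "\<bar>(1 - s) * u + s * v\<bar> \<le> (1 - s) * \<bar>u\<bar> + s * \<bar>v\<bar>"
      using assms(4,5) abs_triangle_ineq[of "(1 - s) * u" "s * v"] by (simp add: abs_mult)
    also have "\<dots> \<le> (1 - s) * R + s * R" using assms(4,5) that by (intro add_mono mult_left_mono) auto
    finally show ?thesis by (simp add: algebra_simps)
  qed
  show "m \<le> R" unfolding m_def using assms(1,2) le by auto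
  have sq: "R\<^sup>2 \<le> u\<^sup>2 + v\<^sup>2" if "max \<bar>u\<bar> \<bar>v\<bar> = R" for u v :: real
    using that by (cases "\<bar>u\<bar> \<le> \<bar>v\<bar>") (auto simp: max_def split: if_splits)
  have m0: "m \<ge> 0" by (simp add: m_def)
  \<comment> \<open>The minimum over \<open>s\<close> is at the midpoint.\<close>
  have half: "1/2 \<le> (1 - s)\<^sup>2 + s\<^sup>2"
    using zero_le_power2[of "2 * s - 1"] by (simp add: power2_eq_square algebra_simps)
  have "R\<^sup>2 * (1/2) \<le> R\<^sup>2 * ((1 - s)\<^sup>2 + s\<^sup>2)" using half by (intro mult_left_mono) auto
  also have "\<dots> = (1 - s)\<^sup>2 * R\<^sup>2 + s\<^sup>2 * R\<^sup>2" by (simp add: algebra_simps)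
  also have "\<dots> \<le> (1 - s)\<^sup>2 * (p1\<^sup>2 + p2\<^sup>2) + s\<^sup>2 * (q1\<^sup>2 + q2\<^sup>2)"
    using sq assms(1,2) by (intro add_mono mult_left_mono) auto
  also have "\<dots> \<le> (1 - s)\<^sup>2 * (p1\<^sup>2 + p2\<^sup>2) + s\<^sup>2 * (q1\<^sup>2 + q2\<^sup>2) + 2 * ((1 - s) * s) * (p1 * q1 + p2 * q2)"
    using assms by auto
  also have "\<dots> = ((1 - s) * p1 + s * q1)\<^sup>2 + ((1 - s) * p2 + s * q2)\<^sup>2"
    by (simp add: power2_eq_square algebra_simps)
  also have "\<dots> \<le> m\<^sup>2 + m\<^sup>2"
    by (intro add_mono) (auto simp: m_def abs_le_square_iff[symmetric])
  finally have "R\<^sup>2 \<le> (2 * m)\<^sup>2" by (simp add: power_mult_distrib)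
  then have "R \<le> 2 * m" by (rule power2_le_imp_le) (use m0 in simp)
  then show "R / 2 \<le> m" by simp
qed

lemma turn_dist:
  fixes p q :: "(real, 'n) vec"
  assumes p: "offset k m p = 40 * r" and q: "offset k m q = 40 * r" and r: "0 < r" "256 * r < side k" "rad k < 8 * r"
    and acute: "0 \<le> (p $ a - (m + 1/2) * side k) * (q $ a - (m + 1/2) * side k)
      + (p $ b - 3/2 * side k) * (q $ b - 3/2 * side k)"
    and s: "0 \<le> s" "s \<le> 1" and w: "w \<notin> Dom"
  shows "12 * r \<le> dist (p + s *\<^sub>R (q - p)) w"
proof -
  let ?z = "p + s *\<^sub>R (q - p)"
  have lin: "u + s * (v - u) - c = (1 - s) * (u - c) + s * (v - c)" for u v c
    by (simp add: algebra_simps)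
  have "?z $ a - (m + 1/2) * side k = (1 - s) * (p $ a - (m + 1/2) * side k) + s * (q $ a - (m + 1/2) * side k)"
       "?z $ b - 3/2 * side k = (1 - s) * (p $ b - 3/2 * side k) + s * (q $ b - 3/2 * side k)"
    using lin[of "p $ a" "q $ a"] lin[of "p $ b" "q $ b"] by simp_all
  then have "20 * r \<le> offset k m ?z" "offset k m ?z \<le> 40 * r"
    using right_angle_segment[OF p[unfolded offset_def] q[unfolded offset_def] acute s] unfolding offset_def by simp_all
  then show ?thesis using dist_compl[of k m ?z w] w r by linarith
qed

text \<open>For points whose distance \<open>r\<close> is not small compared with the obstacle: after moving out to offset
  \<open>40 r\<close>, walk around the obstacle to the fixed corner \<open>Z\<close> in two steps, neither of which turns by more
  than a right angle.\<close>
lemma escape_around: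
  assumes x: "rad k \<le> offset k m x" "offset k m x \<le> 11 * r" and r: "0 < r" "256 * r < side k" "rad k < 8 * r"
    and Z: "Z $ a - (m + 1/2) * side k = 40 * r" "Z $ b - 3/2 * side k = 40 * r" "dist x Z \<le> 120 * r"
  shows "escape Dom (1/32) 400 (3 * r) x Z"
proof -
  have ox: "0 < offset k m x" using x rad_pos[of k] by linarith
  define \<theta> where "\<theta> = 40 * r / offset k m x - 1"
  have \<theta>: "0 \<le> \<theta>" "(1 + \<theta>) * offset k m x = 40 * r" using x ox r by (auto simp: \<theta>_def field_simps)
  define p where "p = push k m \<theta> x"
  have e1: "escape Dom (1/32) 400 r x p"
    unfolding p_def
  proof (rule escape_push[OF x(1) \<theta>(1)])
    have "\<theta> * offset k m x \<le> 40 * r" using \<theta>(2) ox by (simp add: algebra_simps)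
    then show "2 * \<theta> * offset k m x \<le> 400 * r" using r by (simp add: mult.assoc)
  qed (use \<theta> r in auto)
  have op: "offset k m p = 40 * r" using offset_push[OF \<theta>(1)] \<theta>(2) by (simp add: p_def)
  define P1 where "P1 = p $ a - (m + 1/2) * side k"
  define P2 where "P2 = p $ b - 3/2 * side k"
  have P: "\<bar>P1\<bar> \<le> 40 * r" "\<bar>P2\<bar> \<le> 40 * r" using op unfolding offset_def P1_def P2_def by linarith+
  \<comment> \<open>The corner \<open>W\<close> is orthogonal to \<open>Z\<close>; its sign is chosen against an obtuse angle with \<open>p\<close>.\<close>
  define e :: real where "e = (if P2 \<le> P1 then 1 else -1)"
  have e: "\<bar>e\<bar> = 1" by (simp add: e_def)
  define W where "W = p + planar (40 * r * e - P1) (- (40 * r * e) - P2)"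
  have W: "W $ a - (m + 1/2) * side k = 40 * r * e" "W $ b - 3/2 * side k = - (40 * r * e)"
    by (simp_all add: W_def P1_def P2_def)
  have oW: "offset k m W = 40 * r" unfolding offset_def W using e r by (simp add: abs_mult)
  have oZ: "offset k m Z = 40 * r" unfolding offset_def Z using r by simp
  have dW: "dist p W \<le> 160 * r"
  proof -
    have "dist p W \<le> \<bar>40 * r * e - P1\<bar> + \<bar>- (40 * r * e) - P2\<bar>"
      unfolding W_def using norm_planar by (simp add: dist_norm)
    moreover have "\<bar>40 * r * e\<bar> = 40 * r" using e r by (simp add: abs_mult)
    ultimately show ?thesis using P by linarith
  qed
  have "escape Dom (1/32) 400 (r + r) x W"
  proof (rule escape_segment[OF e1 r(1)])
    show "dist p W \<le> 400 * r" using dW r by simp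
    fix s w assume s: "0 \<le> s" "s \<le> (1::real)" and w: "w \<notin> Dom"
    have "12 * r \<le> dist (p + s *\<^sub>R (W - p)) w"
    proof (rule turn_dist[OF op oW r _ s w])
      have "P1 * (40 * r * e) + P2 * - (40 * r * e) = 40 * r * (e * (P1 - P2))" by (simp add: algebra_simps)
      also have "\<dots> \<ge> 0" using r by (simp add: e_def)
      finally show "0 \<le> (p $ a - (m + 1/2) * side k) * (W $ a - (m + 1/2) * side k)
         + (p $ b - 3/2 * side k) * (W $ b - 3/2 * side k)"
        unfolding W P1_def[symmetric] P2_def[symmetric] by simp
    qed
    then show "1 / 32 * (r + s * r) \<le> dist (p + s *\<^sub>R (W - p)) w"
      using s r by (intro clearance_along_segment) auto
  qed
  then have "escape Dom (1/32) 400 (r + r + r) x Z"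
  proof (rule escape_segment[OF _ r(1)])
    have "dist x p \<le> 80 * r"
      using dist_push[OF \<theta>(1), of x k m] \<theta>(2) ox unfolding p_def by (simp add: algebra_simps)
    then show "dist W Z \<le> 400 * r"
      using dW Z(3) dist_triangle[of W Z x] dist_triangle[of W x p] r by (simp add: dist_commute)
    fix s w assume s: "0 \<le> s" "s \<le> (1::real)" and w: "w \<notin> Dom"
    have "12 * r \<le> dist (W + s *\<^sub>R (Z - W)) w"
      by (rule turn_dist[OF oW oZ r _ s w], unfold W Z) simp
    then show "1 / 32 * (r + r + s * r) \<le> dist (W + s *\<^sub>R (Z - W)) w"
      using s r by (intro clearance_along_segment) auto
  qed
  then show ?thesis by simp
qed

text \<open>For points that are close to each other compared with the obstacle: the same dilation moves both away
  from it by at least \<open>8 r\<close> but at most doubles their distance, and then a segment joins them.\<close>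
lemma escape_parallel:
  assumes x: "rad k \<le> offset k m x" "offset k m x \<le> rad k + 3 * r" and y: "rad k \<le> offset k m y" "offset k m y \<le> rad k + 3 * r"
    and xy: "dist x y \<le> r" and r: "0 < r" "256 * r < side k" "8 * r \<le> rad k"
  defines "\<theta> \<equiv> 8 * r / rad k"
  shows "escape Dom (1/32) 400 r x (push k m \<theta> x)" "escape Dom (1/32) 400 (r + r) y (push k m \<theta> x)"
proof -
  have \<theta>: "0 \<le> \<theta>" "\<theta> \<le> 1" "\<theta> * rad k = 8 * r" using r rad_pos[of k] by (auto simp: \<theta>_def field_simps)
  have grow: "rad k + 8 * r \<le> (1 + \<theta>) * offset k m z \<and> (1 + \<theta>) * offset k m z \<le> rad k + 14 * r
     \<and> 2 * \<theta> * offset k m z \<le> 22 * r" if "rad k \<le> offset k m z" "offset k m z \<le> rad k + 3 * r" for z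
  proof -
    have "\<theta> * rad k \<le> \<theta> * offset k m z" using that \<theta> by (intro mult_left_mono) auto
    moreover have "\<theta> * offset k m z \<le> \<theta> * (rad k + 3 * r)" using that \<theta> by (intro mult_left_mono) auto
    moreover have "\<theta> * (3 * r) \<le> 1 * (3 * r)" using \<theta> r by (intro mult_right_mono) auto
    ultimately show ?thesis using that \<theta> by (simp add: algebra_simps)
  qed
  have esc: "escape Dom (1/32) 400 r z (push k m \<theta> z)" if z: "rad k \<le> offset k m z" "offset k m z \<le> rad k + 3 * r" for z
    by (rule escape_push[OF z(1) \<theta>(1)]) (use grow[OF z] rad_le[of k] r in auto)
  show "escape Dom (1/32) 400 r x (push k m \<theta> x)" by (rule esc[OF x])
  show "escape Dom (1/32) 400 (r + r) y (push k m \<theta> x)"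
  proof (rule escape_segment[OF esc[OF y] r(1)])
    let ?X = "push k m \<theta> x" and ?Y = "push k m \<theta> y"
    have "?X - ?Y = (x - y) + planar (\<theta> * (x $ a - y $ a)) (\<theta> * (x $ b - y $ b))"
      by (simp add: push_def planar_def algebra_simps)
    then have "norm (?X - ?Y) \<le> norm (x - y) + (\<bar>\<theta> * (x $ a - y $ a)\<bar> + \<bar>\<theta> * (x $ b - y $ b)\<bar>)"
      using norm_triangle_ineq[of "x - y" "planar (\<theta> * (x $ a - y $ a)) (\<theta> * (x $ b - y $ b))"]
        norm_planar[of "\<theta> * (x $ a - y $ a)" "\<theta> * (x $ b - y $ b)"] by simp
    also have "\<dots> \<le> r + (1 * r + 1 * r)"
      unfolding abs_mult using xy \<theta> coord_dist[of x _ y] r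
      by (intro add_mono mult_mono) (auto simp: dist_norm intro: order_trans)
    finally have XY: "dist ?Y ?X \<le> 3 * r" by (simp add: dist_norm norm_minus_commute)
    then show "dist ?Y ?X \<le> 400 * r" using r by simp
    fix s w assume s: "0 \<le> s" "s \<le> (1::real)" and w: "w \<notin> Dom"
    let ?z = "?Y + s *\<^sub>R (?X - ?Y)"
    have "dist ?Y ?z = s * dist ?Y ?X" using s by (simp add: dist_norm norm_minus_commute)
    also have "\<dots> \<le> 1 * (3 * r)" using s XY r by (intro mult_mono) auto
    finally have "\<bar>offset k m ?Y - offset k m ?z\<bar> \<le> 3 * r" using offset_diff[of k m ?Y ?z] by linarith
    then have "rad k + 5 * r \<le> offset k m ?z" "offset k m ?z \<le> rad k + 17 * r"
      using grow[OF y] offset_push[OF \<theta>(1), of k m y] by linarith+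
    then have "5 * r \<le> dist ?z w" using dist_compl[of k m ?z w] w r rad_le[of k] by linarith
    then show "1 / 32 * (r + s * r) \<le> dist ?z w"
      using s r by (intro clearance_along_segment) auto
  qed
qed

lemma Dom_nonempty: "Dom \<noteq> {}"
proof -
  have "0 < dist (planar 0 (side 0)) w" if "w \<notin> Dom" for w
    using grid_height_dist[of "planar 0 (side 0)" 0 w] that side_pos[of 0] by (auto simp del: zero_less_dist_iff)
  then have "planar 0 (side 0) \<in> Dom" by fastforce
  then show ?thesis by blast
qed

text \<open>Let \<open>r\<close> be the distance of \<open>x\<close> and \<open>y\<close>. If the height is at most comparable with \<open>r\<close>, both points climb to
  a common height and meet there. Otherwise \<open>r\<close> is small compared with the Whitney square of \<open>x\<close>. Then
  either \<open>x\<close> is far from the complement and a segment suffices, or there is exactly one obstacle nearby,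
  which may be much larger than \<open>r\<close> or not.\<close>
theorem uniform_Dom: "uniform_domain Dom"
proof (rule uniform_domain_if_escape[OF open_Dom Dom_nonempty, of "1/32" 10000])
  fix x y assume x: "x \<in> closure Dom" and y: "y \<in> closure Dom" and xy: "x \<noteq> y"
  define r where "r = dist x y"
  have r: "0 < r" using xy by (simp add: r_def)
  have x0: "0 \<le> x $ b" and y0: "0 \<le> y $ b" using closure_Dom(1) x y by auto
  have yb: "\<bar>x $ b - y $ b\<bar> \<le> r" using coord_dist by (simp add: r_def)
  have "\<exists>z l l'. l \<le> 10000 * r \<and> l' \<le> 10000 * r \<and> escape Dom (1/32) 400 l x z \<and> escape Dom (1/32) 400 l' y z"
  proof (cases "x $ b \<le> 512 * r")
    case True
    \<comment> \<open>The common height exceeds \<open>1026 r\<close>, twice the bounds \<open>512 r\<close> and \<open>513 r\<close> for the heights of \<open>x\<close> and \<open>y\<close>.\<close>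
    obtain j where j: "side j \<le> 2052 * r" "2052 * r < 2 * side j" using side_slab[of "2052 * r"] r by auto
    define T where "T = side j"
    define Z where "Z = y + planar 0 (T - y $ b)"
    have Zb: "Z $ b = T" by (simp add: Z_def)
    have dy: "dist y Z \<le> T"
      using norm_planar[of 0 "T - y $ b"] y0 True yb j by (simp add: Z_def dist_norm T_def)
    have "dist x Z \<le> 2 * T" using dist_triangle[of x Z y] dy j r by (simp add: r_def[symmetric] T_def)
    moreover have T2: "2 * x $ b \<le> T" "2 * y $ b \<le> T" using True j yb by (auto simp: T_def)
    ultimately obtain l where l: "l \<le> 3 * T" "escape Dom (1/32) 8 l x Z"
      using escape_to_height[OF x T2(1) T_def Zb] by blast
    have "dist y Z \<le> 2 * T" using dy zero_le_dist[of y Z] by linarith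
    then obtain l' where l': "l' \<le> 3 * T" "escape Dom (1/32) 8 l' y Z"
      using escape_to_height[OF y T2(2) T_def Zb] by blast
    have "escape Dom (1/32) 400 l x Z" "escape Dom (1/32) 400 l' y Z"
      using l l' by (auto elim: escape_mono)
    then show ?thesis using l(1) l'(1) j r by (intro exI[of _ Z] exI[of _ l] exI[of _ l']) (auto simp: T_def)
  next
    case far: False
    then have "0 < x $ b" using r by simp
    then obtain k m where km: "side k \<le> x $ b" "x $ b < 2 * side k" "offset k m x \<le> side k / 2" by (rule cell_ex)
    have rk: "256 * r < side k" using far km by simp
    have rx: "rad k \<le> offset k m x" and ry: "rad k \<le> offset k m y" using closure_Dom(2) x y by auto
    show ?thesis
    proof (cases "\<exists>w. w \<notin> Dom \<and> dist x w < 2 * r")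
      case False
      have "escape Dom (1/32) 400 (0 + r) y x"
      proof (rule escape_segment[OF escape_refl r])
        show "dist y x \<le> 400 * r" using r by (simp add: r_def dist_commute)
        fix s w assume s: "0 \<le> s" "s \<le> (1::real)" and w: "w \<notin> Dom"
        let ?z = "y + s *\<^sub>R (x - y)"
        have "x - ?z = (1 - s) *\<^sub>R (x - y)" by (simp add: algebra_simps)
        then have "dist x ?z = (1 - s) * r" using s by (simp add: dist_norm r_def)
        moreover have "2 * r \<le> dist x w" using False w by fastforce
        ultimately have "2 * r - (1 - s) * r \<le> dist ?z w" using dist_triangle[of x w ?z] by linarith
        moreover have "0 \<le> s * r" using s r by simp
        ultimately show "1/32 * (0 + s * r) \<le> dist ?z w" using r by (simp add: algebra_simps)
      qed simp
      then show ?thesis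
        using r escape_refl[of 400 Dom "1/32" x] by (intro exI[of _ x] exI[of _ 0] exI[of _ r]) auto
    next
      case True
      then obtain w where w: "w \<notin> Dom" "dist x w < 2 * r" by blast
      have ox: "offset k m x \<le> rad k + 2 * r" using dist_compl[OF km(3) w(1)] w(2) rk r by linarith
      have oy: "offset k m y \<le> rad k + 3 * r" using ox offset_diff[of k m x y] by (simp add: r_def)
      show ?thesis
      proof (cases "8 * r \<le> rad k")
        case True
        have "offset k m x \<le> rad k + 3 * r" using ox r by simp
        from escape_parallel[OF rx this ry oy _ r rk True] show ?thesis
          using r by (intro exI[of _ "push k m (8 * r / rad k) x"] exI[of _ r] exI[of _ "r + r"]) (auto simp: r_def)
      next
        case False
        define Y1 where "Y1 = y $ a - (m + 1/2) * side k"
        define Y2 where "Y2 = y $ b - 3/2 * side k"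
        have Y: "\<bar>Y1\<bar> \<le> 11 * r" "\<bar>Y2\<bar> \<le> 11 * r" using oy False unfolding offset_def Y1_def Y2_def by linarith+
        define Z where "Z = y + planar (40 * r - Y1) (40 * r - Y2)"
        have Z: "Z $ a - (m + 1/2) * side k = 40 * r" "Z $ b - 3/2 * side k = 40 * r"
          by (simp_all add: Z_def Y1_def Y2_def)
        have dy: "dist y Z \<le> 102 * r"
          using norm_planar[of "40 * r - Y1" "40 * r - Y2"] Y by (simp add: Z_def dist_norm)
        have dx: "dist x Z \<le> 120 * r" using dist_triangle[of x Z y] dy r by (simp add: r_def[symmetric])
        have F: "rad k < 8 * r" using False by simp
        have "escape Dom (1/32) 400 (3 * r) x Z"
          by (rule escape_around[OF rx _ r rk F Z dx]) (use ox F r in linarith)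
        moreover have "escape Dom (1/32) 400 (3 * r) y Z"
          by (rule escape_around[OF ry _ r rk F Z]) (use oy F dy r in linarith)+
        ultimately show ?thesis using r by (intro exI[of _ Z] exI[of _ "3 * r"]) auto
      qed
    qed
  qed
  then obtain z l l' where "l \<le> 10000 * r" "l' \<le> 10000 * r"
     "escape Dom (1/32) 400 l x z" "escape Dom (1/32) 400 l' y z" by blast
  then show "\<exists>z l l'. l \<le> 10000 * dist x y \<and> l' \<le> 10000 * dist x y \<and>
     escape Dom (1/32) 10000 l x z \<and> escape Dom (1/32) 10000 l' y z"
    by (intro exI[of _ z] exI[of _ l] exI[of _ l']) (auto simp: r_def intro: escape_mono)
qed auto

end

section \<open>Surface measure of the boundary\<close>

lemma hausdorff_content_pos_if_flat_box:
  fixes A :: "(real, 'n::finite) vec set"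
  assumes "flat_box i l u \<subseteq> A" "\<And>j. j \<noteq> i \<Longrightarrow> l $ j < u $ j" "CARD('n) = d + 1" "d > 0"
  shows "\<exists>m>0. \<forall>\<delta>. ennreal m \<le> hausdorff_content (real d) \<delta> A"
proof (intro exI conjI allI)
  let ?m = "(\<Prod>j\<in>-{i}. u $ j - l $ j) / 2 ^ d"
  have "0 < u $ j - l $ j" if "j \<in> -{i}" for j using assms(2)[of j] that by simp
  then show "?m > 0" by (intro divide_pos_pos prod_pos) auto
  show "ennreal ?m \<le> hausdorff_content (real d) \<delta> A" for \<delta>
    using hausdorff_content_flat_box_ge[OF assms(2-4)] hausdorff_content_mono[OF assms(1)] order_trans by blast
qed

lemma dist_le_if_coords:
  fixes z x :: "(real, 'n::finite) vec"
  assumes "\<And>j. \<bar>z $ j - x $ j\<bar> \<le> h"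
  shows "dist z x \<le> real CARD('n) * h"
proof -
  have "(\<Sum>j\<in>UNIV. \<bar>(z - x) $ j\<bar>) \<le> (\<Sum>j\<in>(UNIV::'n set). h)" using assms by (intro sum_mono) auto
  then show ?thesis using norm_le_l1_cart[of "z - x"] by (simp add: dist_norm)
qed

context two_axes begin

lemma Dom_if_clear:
  assumes "0 < e" "\<And>w. w \<notin> Dom \<Longrightarrow> e \<le> dist z w"
  shows "z \<in> Dom"
  using assms by force

lemma frontier_Dom_eq: "frontier Dom = closure Dom - Dom"
  by (simp add: frontier_def interior_open open_Dom)

lemma plane_frontier:
  assumes "z $ b = 0" shows "z \<in> frontier Dom"
proof -
  have "\<exists>y\<in>Dom. dist y z < e" if e: "e > 0" for e
  proof -
    obtain n where "(1/2) ^ n < e" using real_arch_pow_inv[OF e, of "1/2"] by auto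
    then have n: "side (int n) < e" by (simp add: side_nat power_one_over)
    let ?y = "z + planar 0 (side (int n))"
    have "?y \<in> Dom"
      by (rule Dom_if_clear[of "side (int n) / 8"]) (use grid_height_dist[of ?y] assms in auto)
    moreover have "dist ?y z < e" using norm_planar[of 0 "side (int n)"] n by (simp add: dist_norm)
    ultimately show ?thesis by blast
  qed
  then have "z \<in> closure Dom" by (simp add: closure_approachable)
  moreover have "z \<notin> Dom" using assms by (simp add: Dom_def)
  ultimately show ?thesis by (simp add: frontier_Dom_eq)
qed

lemma face_frontier:
  assumes "offset k m z = rad k" shows "z \<in> frontier Dom"
proof -
  have "\<exists>y\<in>Dom. dist y z < e" if e: "e > 0" for e
  proof -
    define \<theta> where "\<theta> = min 1 (e / (4 * rad k))"
    have \<theta>: "0 < \<theta>" "\<theta> \<le> 1" "\<theta> \<le> e / (4 * rad k)" using e by (auto simp: \<theta>_def)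
    let ?y = "push k m \<theta> z"
    have o: "offset k m ?y = (1 + \<theta>) * rad k" using offset_push[of \<theta> k m z] \<theta> assms by simp
    have "(1 + \<theta>) * rad k \<le> 2 * rad k" using \<theta> by (intro mult_right_mono) (auto simp: less_imp_le)
    then have c: "offset k m ?y \<le> side k / 2" using o rad_le[of k] side_pos[of k] by linarith
    have "?y \<in> Dom"
    proof (rule Dom_if_clear[of "min (side k / 8) (\<theta> * rad k)"])
      show "0 < min (side k / 8) (\<theta> * rad k)" using \<theta> by simp
      show "min (side k / 8) (\<theta> * rad k) \<le> dist ?y w" if "w \<notin> Dom" for w
        using dist_compl[OF c that] o by (simp add: algebra_simps)
    qed
    moreover have "dist ?y z < e"
    proof -
      have "dist ?y z \<le> 2 * \<theta> * rad k" using dist_push[of \<theta> z k m] \<theta> assms by (simp add: dist_commute)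
      also have "\<dots> \<le> 2 * (e / (4 * rad k)) * rad k" using \<theta>
        by (intro mult_right_mono mult_left_mono) (auto simp: less_imp_le)
      also have "\<dots> = e / 2" using rad_pos[of k] by (simp add: field_simps)
      finally show ?thesis using e by simp
    qed
    ultimately show ?thesis by blast
  qed
  then have "z \<in> closure Dom" by (simp add: closure_approachable)
  moreover have "z \<notin> Dom"
  proof -
    have "\<not> rad k < offset k m z" using assms by simp
    then show ?thesis unfolding Dom_def by blast
  qed
  ultimately show ?thesis by (simp add: frontier_Dom_eq)
qed

lemma frontier_cases:
  assumes "z \<in> frontier Dom"
  obtains "z $ b = 0" | k m where "offset k m z = rad k"
proof (cases "z $ b = 0")
  case False
  have z: "z \<in> closure Dom" "z \<notin> Dom" using assms by (auto simp: frontier_Dom_eq)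
  then have "0 < z $ b" using closure_Dom(1)[OF z(1)] False by simp
  then obtain k m where "offset k m z \<le> rad k" using z(2) by (auto simp: Dom_def not_less)
  then have "offset k m z = rad k" using closure_Dom(2)[OF z(1), of k m] by simp
  then show ?thesis using that by blast
qed (use that in blast)

text \<open>Every point of the frontier lies on the hyperplane or on a face of an obstacle, and in the second case
  the box is cut off at the edges of that face.\<close>
lemma flat_box_in_frontier:
  assumes x: "x \<in> frontier Dom" and r: "r > 0"
  shows "\<exists>i l u. flat_box i l u \<subseteq> ball x r \<inter> frontier Dom \<and> (\<forall>j. j \<noteq> i \<longrightarrow> l $ j < u $ j)"
proof -
  define h where "h = r / (2 * real CARD('n))"
  have h: "h > 0" "real CARD('n) * h < r" using r by (auto simp: h_def)
  have near: "z \<in> ball x r" if "\<And>j. \<bar>z $ j - x $ j\<bar> \<le> h" for z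
    using dist_le_if_coords[of z x h] that h by (simp add: dist_commute)
  have face: ?thesis
    if i: "i \<noteq> i'" and p: "p - \<rho> \<le> x $ i'" "x $ i' \<le> p + \<rho>" "0 < \<rho>"
      and F: "\<And>z. z $ i = x $ i \<Longrightarrow> p - \<rho> \<le> z $ i' \<Longrightarrow> z $ i' \<le> p + \<rho> \<Longrightarrow> z \<in> frontier Dom" for i i' p \<rho>
  proof -
    define l where "l = (\<chi> j. if j = i then x $ i else if j = i' then max (x $ i' - h) (p - \<rho>) else x $ j - h)"
    define u where "u = (\<chi> j. if j = i' then min (x $ i' + h) (p + \<rho>) else x $ j + h)"
    have "z \<in> ball x r \<inter> frontier Dom" if z: "z \<in> flat_box i l u" for z
    proof
      have zi: "z $ i = x $ i" using z by (simp add: flat_box_def l_def)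
      have zi': "l $ i' \<le> z $ i'" "z $ i' \<le> u $ i'" using z i by (auto simp: flat_box_def)
      show "z \<in> frontier Dom" using F[OF zi] zi' i by (simp add: l_def u_def)
      show "z \<in> ball x r"
      proof (rule near)
        fix j
        have "j \<noteq> i \<Longrightarrow> l $ j \<le> z $ j \<and> z $ j \<le> u $ j" using z by (auto simp: flat_box_def)
        then show "\<bar>z $ j - x $ j\<bar> \<le> h"
          using zi h i by (cases "j = i"; cases "j = i'") (auto simp: l_def u_def abs_le_iff)
      qed
    qed
    moreover have "l $ j < u $ j" if "j \<noteq> i" for j
      using that h p by (auto simp: l_def u_def)
    ultimately show ?thesis by blast
  qed
  from x show ?thesis
  proof (cases rule: frontier_cases)
    case 1
    show ?thesis
      by (rule face[of b a "x $ a" 1]) (use 1 ab plane_frontier in auto)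
  next
    case (2 k m)
    have B: "\<bar>x $ a - (m + 1/2) * side k\<bar> \<le> rad k" "\<bar>x $ b - 3/2 * side k\<bar> \<le> rad k"
      using 2 unfolding offset_def by linarith+
    have "\<bar>x $ a - (m + 1/2) * side k\<bar> = rad k \<or> \<bar>x $ b - 3/2 * side k\<bar> = rad k"
      using 2 unfolding offset_def by (auto simp: max_def split: if_splits)
    then show ?thesis
    proof
      assume e: "\<bar>x $ a - (m + 1/2) * side k\<bar> = rad k"
      show ?thesis
      proof (rule face[of a b "3/2 * side k" "rad k"])
        fix z :: "(real, 'n) vec" assume "z $ a = x $ a" "3/2 * side k - rad k \<le> z $ b" "z $ b \<le> 3/2 * side k + rad k"
        then have "offset k m z = rad k" using e unfolding offset_def by (intro max_absorb1[THEN trans]) (auto simp: abs_le_iff)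
        then show "z \<in> frontier Dom" by (rule face_frontier)
      qed (use B ab in \<open>auto simp: abs_le_iff\<close>)
    next
      assume e: "\<bar>x $ b - 3/2 * side k\<bar> = rad k"
      show ?thesis
      proof (rule face[of b a "(m + 1/2) * side k" "rad k"])
        fix z :: "(real, 'n) vec" assume "z $ b = x $ b" "(m + 1/2) * side k - rad k \<le> z $ a" "z $ a \<le> (m + 1/2) * side k + rad k"
        then have "offset k m z = rad k" using e unfolding offset_def by (intro max_absorb2[THEN trans]) (auto simp: abs_le_iff)
        then show "z \<in> frontier Dom" by (rule face_frontier)
      qed (use B ab in \<open>auto simp: abs_le_iff\<close>)
    qed
  qed
qed

text \<open>Every ball around a boundary point contains a flat \<open>d\<close>-dimensional piece of the boundary, which has
  infinite measure in dimension \<open>s < d\<close>.\<close>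
lemma lower_AD_regular_frontier:
  assumes "CARD('n) = d + 1" "d > 0" "s < real d"
  shows "lower_AD_regular s (frontier Dom)"
proof -
  have "hausdorff_measure s (ball x r \<inter> frontier Dom) = \<infinity>" if xr: "x \<in> frontier Dom" "r > 0" for x r
  proof -
    obtain i l u where "flat_box i l u \<subseteq> ball x r \<inter> frontier Dom" "\<And>j. j \<noteq> i \<Longrightarrow> l $ j < u $ j"
      using flat_box_in_frontier[OF xr] by metis
    then obtain m where "m > 0" "\<And>\<delta>. ennreal m \<le> hausdorff_content (real d) \<delta> (ball x r \<inter> frontier Dom)"
      using hausdorff_content_pos_if_flat_box assms(1,2) by blast
    then show ?thesis using assms(3) by (intro hausdorff_measure_lower_exponent_infinite)
  qed
  then show ?thesis unfolding lower_AD_regular_def by (intro exI[of _ 1]) auto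
qed

lemma hausdorff_measure_plane_pos:
  assumes "CARD('n) = d + 1" "d > 0"
  shows "hausdorff_measure (real d) {z :: (real, 'n) vec. z $ b = 0} > 0"
proof -
  have sub: "flat_box b 0 (\<chi> j. 1) \<subseteq> {z :: (real, 'n) vec. z $ b = 0}" by (auto simp: flat_box_def)
  have less: "\<And>j. j \<noteq> b \<Longrightarrow> (0 :: (real, 'n) vec) $ j < (\<chi> j. 1) $ j" by simp
  have "\<exists>m>0. \<forall>\<delta>. ennreal m \<le> hausdorff_content (real d) \<delta> {z :: (real, 'n) vec. z $ b = 0}"
    by (rule hausdorff_content_pos_if_flat_box[OF sub less assms])
  then obtain m where m: "m > 0" "\<forall>\<delta>. ennreal m \<le> hausdorff_content (real d) \<delta> {z :: (real, 'n) vec. z $ b = 0}"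
    by (elim exE conjE)
  have "0 < ennreal m" using m(1) by simp
  also have "\<dots> \<le> hausdorff_measure (real d) {z :: (real, 'n) vec. z $ b = 0}"
    using order_trans[OF spec[OF m(2), of 1] hausdorff_content_le_measure[of 1]] by simp
  finally show ?thesis .
qed

lemma hausdorff_measure_strip_le:
  fixes i i' :: 'n
  assumes "CARD('n) = d + 1" "i \<noteq> i'" "0 < \<rho>" "0 < R"
  shows "hausdorff_measure (real d) (flat_box i (\<chi> j. if j = i then c else if j = i' then p - \<rho> else - R)
      (\<chi> j. if j = i' then p + \<rho> else R))
    \<le> ennreal ((2 * real (d + 1)) ^ d * (2 * (2 * R) ^ (d - 1)) * \<rho>)"
proof -
  let ?l = "\<chi> j. if j = i then c else if j = i' then p - \<rho> else - R"
  let ?u = "\<chi> j. if j = i' then p + \<rho> else R"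
  have "hausdorff_measure (real d) (flat_box i ?l ?u)
     \<le> ennreal ((2 * real (d + 1)) ^ d * (\<Prod>j\<in>-{i}. ?u $ j - ?l $ j))"
    by (rule hausdorff_measure_flat_box_le) (use assms in auto)
  also have "(\<Prod>j\<in>-{i}. ?u $ j - ?l $ j) = (?u $ i' - ?l $ i') * (\<Prod>j\<in>-{i} - {i'}. ?u $ j - ?l $ j)"
    using assms by (intro prod.remove) auto
  also have "(\<Prod>j\<in>-{i} - {i'}. ?u $ j - ?l $ j) = (\<Prod>j\<in>-{i} - {i'}. 2 * R)"
    by (intro prod.cong) auto
  also have "\<dots> = (2 * R) ^ (d - 1)"
  proof -
    have "card (-{i} - {i'}) = d - 1" using assms by (simp add: Compl_eq_Diff_UNIV)
    then show ?thesis by simp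
  qed
  also have "?u $ i' - ?l $ i' = 2 * \<rho>" using assms by simp
  finally show ?thesis by (simp add: mult_ac)
qed

text \<open>In a cube of size \<open>R\<close> there are about \<open>R / side k\<close> obstacles of generation \<open>k\<close>, each with faces of measure
  comparable with \<open>rad k * R ^ (d - 1)\<close>. The quotient \<open>rad k / side k\<close> is summable over the generations from
  some \<open>k0\<close> on, and earlier generations are too high to meet the cube.\<close>
lemma locally_finite_frontier:
  assumes d: "CARD('n) = d + 1"
  shows "locally_finite_hausdorff (real d) (frontier Dom)"
  unfolding locally_finite_hausdorff_def
proof (intro allI impI)
  fix K :: "(real, 'n) vec set" assume "compact K"
  then have "bounded K" by (rule compact_imp_bounded)
  then obtain R' where R': "\<And>z. z \<in> K \<Longrightarrow> norm z \<le> R'"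
    unfolding bounded_iff by blast
  define R where "R = max 1 R'"
  have R: "0 < R" "\<And>z j. z \<in> K \<Longrightarrow> \<bar>z $ j\<bar> \<le> R"
    using order_trans[OF component_le_norm_cart R'] by (auto simp: R_def le_max_iff_disj)
  define B where "B = (2 * real (d + 1)) ^ d * (2 * (2 * R) ^ (d - 1))"
  have B: "0 \<le> B" using R by (simp add: B_def)
  obtain k0 where k0: "side k0 \<le> R" "R < 2 * side k0" using side_slab[OF R(1)] by blast
  define P where "P i i' c p \<rho> = flat_box i (\<chi> j. if j = i then c else if j = i' then p - \<rho> else - R)
      (\<chi> j. if j = i' then p + \<rho> else R)" for i i' :: 'n and c p \<rho>
  have P: "hausdorff_measure (real d) (P i i' c p \<rho>) \<le> ennreal (B * \<rho>)" if "i \<noteq> i'" "0 < \<rho>" for i i' c p \<rho>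
    unfolding P_def B_def using hausdorff_measure_strip_le[OF d that R(1)] .
  have inP: "z \<in> P i i' (z $ i) p \<rho>" if "z \<in> K" "\<bar>z $ i' - p\<bar> \<le> \<rho>" for z i i' p \<rho>
    using that R(2)[OF that(1)] by (auto simp: P_def flat_box_def abs_le_iff minus_le_iff)
  define F where "F k m = P a b ((m + 1/2) * side k - rad k) (3/2 * side k) (rad k) \<union>
      P a b ((m + 1/2) * side k + rad k) (3/2 * side k) (rad k) \<union>
      (P b a (3/2 * side k - rad k) ((m + 1/2) * side k) (rad k) \<union>
      P b a (3/2 * side k + rad k) ((m + 1/2) * side k) (rad k))" for k m :: int
  have F: "hausdorff_measure (real d) (F k m) \<le> ennreal (4 * B * rad k)" for k m
  proof -
    have nn: "0 \<le> B * rad k" using B by (simp add: less_imp_le)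
    have "hausdorff_measure (real d) (F k m) \<le>
      (ennreal (B * rad k) + ennreal (B * rad k)) + (ennreal (B * rad k) + ennreal (B * rad k))"
      unfolding F_def using ab
      by (intro order_trans[OF hausdorff_measure_Un] add_mono P) auto
    also have "\<dots> = ennreal (4 * B * rad k)"
      using nn by (simp add: ennreal_plus[symmetric] del: ennreal_plus)
    finally show ?thesis .
  qed
  \<comment> \<open>The indices of the squares of generation \<open>k\<close> that can meet \<open>K\<close>.\<close>
  define M where "M k = {- \<lceil>R / side k + 2\<rceil>..\<lceil>R / side k + 2\<rceil>}" for k
  have cover: "frontier Dom \<inter> K \<subseteq> P b a 0 0 R \<union> (\<Union>n. \<Union>m\<in>M (k0 + int n). F (k0 + int n) m)"
  proof
    fix z assume z: "z \<in> frontier Dom \<inter> K"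
    then have zK: "z \<in> K" and "z \<in> frontier Dom" by auto
    from this(2) show "z \<in> P b a 0 0 R \<union> (\<Union>n. \<Union>m\<in>M (k0 + int n). F (k0 + int n) m)"
    proof (cases rule: frontier_cases)
      case 1
      then show ?thesis using inP[OF zK, of a 0 R b] R(2)[OF zK] by simp
    next
      case (2 k m)
      have A: "\<bar>z $ a - (m + 1/2) * side k\<bar> \<le> rad k" "\<bar>z $ b - 3/2 * side k\<bar> \<le> rad k"
        using 2 unfolding offset_def by linarith+
      have zF: "z \<in> F k m"
      proof -
        have "\<bar>z $ a - (m + 1/2) * side k\<bar> = rad k \<or> \<bar>z $ b - 3/2 * side k\<bar> = rad k"
          using 2 unfolding offset_def by (auto simp: max_def split: if_splits)
        then consider "z $ a = (m + 1/2) * side k - rad k" | "z $ a = (m + 1/2) * side k + rad k"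
           | "z $ b = 3/2 * side k - rad k" | "z $ b = 3/2 * side k + rad k"
          by (auto simp: abs_if split: if_splits)
        then show ?thesis
          by cases (use inP[OF zK A(1), of b] inP[OF zK A(2), of a] in \<open>auto simp: F_def\<close>)
      qed
      have "side k \<le> R" using A(2) R(2)[OF zK, of b] rad_le[of k] side_pos[of k] by (auto simp: abs_le_iff)
      then have "k0 \<le> k" using side_half[of k k0] k0 by force
      moreover have "m \<in> M k"
      proof -
        have "\<bar>(m + 1/2) * side k\<bar> \<le> R + side k"
          using A(1) R(2)[OF zK, of a] rad_le[of k] side_pos[of k] by linarith
        moreover have "\<bar>(m + 1/2) * side k\<bar> = \<bar>real_of_int m + 1/2\<bar> * side k"
          by (simp only: abs_mult abs_of_pos[OF side_pos])
        moreover have "(R / side k + 1) * side k = R + side k" by (simp add: distrib_right)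
        ultimately have "\<bar>real_of_int m + 1/2\<bar> * side k \<le> (R / side k + 1) * side k" by simp
        then have "\<bar>real_of_int m + 1/2\<bar> \<le> R / side k + 1" using side_pos[of k] mult_le_cancel_right_pos by blast
        then have "real_of_int m \<le> R / side k + 2" "- real_of_int m \<le> R / side k + 2" by linarith+
        then show ?thesis unfolding M_def by (simp add: le_ceiling_iff) linarith
      qed
      ultimately have "z \<in> (\<Union>m\<in>M (k0 + int (nat (k - k0))). F (k0 + int (nat (k - k0))) m)" using zF by auto
      then show ?thesis by blast
    qed
  qed
  define Q where "Q = 44 * B * R / 8 * 2 ^ nat \<bar>k0\<bar>"
  have Q: "0 \<le> Q" using B R by (simp add: Q_def)
  have level: "hausdorff_measure (real d) (\<Union>m\<in>M (k0 + int n). F (k0 + int n) m) \<le> ennreal (Q * (1/2) ^ n)" for n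
  proof -
    let ?k = "k0 + int n"
    have sR: "side ?k \<le> R"
    proof -
      have "side ?k = side k0 / 2 ^ n" by (rule side_add)
      also have "\<dots> \<le> side k0" by (simp add: divide_le_eq)
      finally show ?thesis using k0 by simp
    qed
    then have q: "1 \<le> R / side ?k" by simp
    have cM: "real (card (M ?k)) \<le> 11 * (R / side ?k)"
    proof -
      have "0 \<le> \<lceil>R / side ?k + 2\<rceil>" using q by linarith
      then have "real (card (M ?k)) = 2 * real_of_int \<lceil>R / side ?k + 2\<rceil> + 1"
        unfolding M_def card_atLeastAtMost_int by (subst of_nat_nat) auto
      also have "\<dots> \<le> 2 * (R / side ?k + 3) + 1"
        using of_int_ceiling_le_add_one[of "R / side ?k + 2"] by argo
      finally show ?thesis using q by argo
    qed
    have "hausdorff_measure (real d) (\<Union>m\<in>M ?k. F ?k m) \<le> (\<Sum>m\<in>M ?k. hausdorff_measure (real d) (F ?k m))"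
      by (rule hausdorff_measure_finite_UN) (simp add: M_def)
    also have "\<dots> \<le> (\<Sum>m\<in>M ?k. ennreal (4 * B * rad ?k))" by (intro sum_mono F)
    also have "\<dots> = ennreal (real (card (M ?k)) * (4 * B * rad ?k))"
      using B by (simp add: ennreal_mult ennreal_of_nat_eq_real_of_nat less_imp_le)
    also have "\<dots> \<le> ennreal (Q * (1/2) ^ n)"
    proof (rule ennreal_leI)
      have "real (card (M ?k)) * (4 * B * rad ?k) \<le> 11 * (R / side ?k) * (4 * B * rad ?k)"
        using B by (intro mult_right_mono cM) (auto simp: less_imp_le)
      also have "\<dots> = 44 * B * R / 8 * (1 / 2 ^ nat ?k)" using side_pos[of ?k] by (simp add: rad_def)
      also have "1 / 2 ^ nat ?k \<le> 2 ^ nat \<bar>k0\<bar> * (1/2::real) ^ n"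
      proof -
        have "n \<le> nat \<bar>k0\<bar> + nat ?k" by linarith
        then have "(2::real) ^ n \<le> 2 ^ (nat \<bar>k0\<bar> + nat ?k)" by (intro power_increasing) auto
        then show ?thesis by (simp add: field_simps power_add power_one_over)
      qed
      then have "44 * B * R / 8 * (1 / 2 ^ nat ?k) \<le> 44 * B * R / 8 * (2 ^ nat \<bar>k0\<bar> * (1/2::real) ^ n)"
        using B R by (intro mult_left_mono) auto
      finally show "real (card (M ?k)) * (4 * B * rad ?k) \<le> Q * (1/2) ^ n" by (simp add: Q_def mult_ac)
    qed
    finally show ?thesis .
  qed
  have "hausdorff_measure (real d) (frontier Dom \<inter> K) \<le>
     hausdorff_measure (real d) (P b a 0 0 R \<union> (\<Union>n. \<Union>m\<in>M (k0 + int n). F (k0 + int n) m))"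
    by (rule hausdorff_measure_mono[OF cover])
  also have "\<dots> \<le> hausdorff_measure (real d) (P b a 0 0 R)
      + hausdorff_measure (real d) (\<Union>n. \<Union>m\<in>M (k0 + int n). F (k0 + int n) m)"
    by (rule hausdorff_measure_Un)
  also have "\<dots> \<le> ennreal (B * R) + (\<Sum>n. ennreal (Q * (1/2) ^ n))"
    by (intro add_mono P order_trans[OF hausdorff_measure_countably_subadditive] suminf_le level)
      (use ab R in auto)
  also have "(\<Sum>n. ennreal (Q * (1/2) ^ n)) = ennreal (Q * 2)"
    by (rule suminf_ennreal_eq) (use Q sums_mult[OF geometric_sums[of "1/2::real"], of Q] in auto)
  finally show "hausdorff_measure (real d) (frontier Dom \<inter> K) < \<infinity>"
    by (simp add: ennreal_plus[symmetric] less_top[symmetric] top_unique del: ennreal_plus)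
     (metis ennreal_add_eq_top ennreal_neq_top neq_top_trans)
qed

end

section \<open>The potential of a row of poles\<close>

text \<open>The squared modulus of the complex cosine at \<open>\<pi> (X + \<i> (t - \<sigma>))\<close>.\<close>
definition cos_sq :: "real \<Rightarrow> real \<Rightarrow> real \<Rightarrow> real" where
  "cos_sq \<sigma> X t = (cos (pi * X))\<^sup>2 + (sinh (pi * (t - \<sigma>)))\<^sup>2"

text \<open>With \<open>\<zeta> = X + \<i> t\<close> this is \<open>ln \<bar>cos (\<pi> (\<zeta> + 3\<i>/2)) / cos (\<pi> (\<zeta> - 3\<i>/2))\<bar>\<close>, the sum of the Green
  functions of the upper half-plane with poles at \<open>m + 1/2 + 3\<i>/2\<close> for all integers \<open>m\<close>. These are the
  centres of generation \<open>0\<close>; the other generations are rescaled copies.\<close>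
definition green :: "real \<Rightarrow> real \<Rightarrow> real" where
  "green X t = (ln (cos_sq (-3/2) X t) - ln (cos_sq (3/2) X t)) / 2"

lemma sinh_ge_self: "0 \<le> y \<Longrightarrow> y \<le> sinh (y::real)"
  using real_le_abs_sinh[of y] sinh_real_nonneg_iff[of y] by (simp add: sinh_field_def exp_minus)

text \<open>Since \<open>1 - y \<le> exp (- y)\<close>, both \<open>exp y - 1\<close> and \<open>1 - exp (- y)\<close> are at most \<open>y * exp c\<close>.\<close>
lemma sinh_le: assumes "0 \<le> y" "y \<le> c" shows "sinh (y::real) \<le> y * exp c"
proof -
  have "1 - y \<le> exp (- y)" using exp_ge_add_one_self[of "- y"] by simp
  then have 1: "1 - exp (- y) \<le> y" by simp
  then have "exp y * (1 - exp (- y)) \<le> exp y * y" by (intro mult_left_mono) auto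
  then have "exp y - 1 \<le> exp y * y" by (simp add: algebra_simps exp_minus)
  then have "exp y - exp (- y) \<le> exp y * y + y" using 1 by linarith
  also have "\<dots> \<le> exp c * y + exp c * y"
    using assms by (intro add_mono mult_right_mono) (auto intro: order_trans[of _ "exp c * y"] simp: mult_le_cancel_right1)
  finally show ?thesis by (simp add: sinh_field_def mult.commute)
qed

lemma sinh_sq_diff: "(sinh A)\<^sup>2 - (sinh B)\<^sup>2 = sinh (A + B) * sinh (A - B)" for A B :: real
proof -
  have c: "(cosh A)\<^sup>2 = (sinh A)\<^sup>2 + 1" "(cosh B)\<^sup>2 = (sinh B)\<^sup>2 + 1" by (simp_all add: cosh_square_eq)
  have "sinh (A + B) * sinh (A - B) = (sinh A)\<^sup>2 * (cosh B)\<^sup>2 - (cosh A)\<^sup>2 * (sinh B)\<^sup>2"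
    by (simp add: sinh_add sinh_diff power2_eq_square algebra_simps)
  then show ?thesis unfolding c by (simp add: algebra_simps)
qed

text \<open>The difference does not depend on \<open>X\<close>; in particular it is nonnegative above the real axis.\<close>
lemma cos_sq_diff: "cos_sq (-3/2) X t - cos_sq (3/2) X t = sinh (2 * pi * t) * sinh (3 * pi)"
proof -
  have "cos_sq (-3/2) X t - cos_sq (3/2) X t = (sinh (pi * (t + 3/2)))\<^sup>2 - (sinh (pi * (t - 3/2)))\<^sup>2"
    by (simp add: cos_sq_def)
  also have "\<dots> = sinh (pi * (t + 3/2) + pi * (t - 3/2)) * sinh (pi * (t + 3/2) - pi * (t - 3/2))"
    by (rule sinh_sq_diff)
  also have "pi * (t + 3/2) + pi * (t - 3/2) = 2 * pi * t" by (simp add: algebra_simps)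
  also have "pi * (t + 3/2) - pi * (t - 3/2) = 3 * pi" by (simp add: algebra_simps)
  finally show ?thesis .
qed

lemma cos_sq_le: "0 \<le> t \<Longrightarrow> cos_sq (3/2) X t \<le> cos_sq (-3/2) X t"
proof -
  assume "0 \<le> t"
  then have "0 \<le> sinh (2 * pi * t) * sinh (3 * pi)" by simp
  then show ?thesis using cos_sq_diff[of X t] by linarith
qed

lemma sinh_sq_ge: "y\<^sup>2 \<le> (sinh (y::real))\<^sup>2"
proof -
  have "\<bar>y\<bar> \<le> \<bar>sinh y\<bar>" using sinh_ge_self[of "\<bar>y\<bar>"] by (cases "y \<ge> 0") auto
  then show ?thesis by (simp add: abs_le_square_iff)
qed

lemma cos_sq_minus_pos: "0 \<le> t \<Longrightarrow> 0 < cos_sq (-3/2) X t"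
  unfolding cos_sq_def by (intro add_nonneg_pos) (auto simp: zero_less_power2 add_nonneg_pos)

lemma green_nonneg:
  assumes "0 \<le> t" "0 < cos_sq (3/2) X t" shows "0 \<le> green X t"
  using cos_sq_le[OF assms(1), of X] assms(2) cos_sq_minus_pos[OF assms(1), of X] by (simp add: green_def)

lemma ln_diff_le: "0 < v \<Longrightarrow> 0 < u \<Longrightarrow> ln u - ln v \<le> (u - v) / (v::real)"
  using ln_le_minus_one[of "u / v"] by (simp add: ln_div diff_divide_distrib)

lemma green_zero: "green X 0 = 0"
  using cos_sq_diff[of X 0] by (simp add: green_def)

lemma green_le_low:
  "\<exists>C\<ge>0. \<forall>X t. 0 \<le> t \<longrightarrow> t \<le> 1 \<longrightarrow> green X t \<le> C * t"
proof -
  define D where "D = (sinh (pi / 2))\<^sup>2"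
  have D: "0 < D" by (simp add: D_def)
  define C where "C = 2 * pi * exp (2 * pi) * sinh (3 * pi) / D"
  have C: "0 \<le> C" using D by (simp add: C_def)
  have "green X t \<le> C * t" if t: "0 \<le> t" "t \<le> 1" for X t
  proof -
    have "sinh (pi / 2) \<le> sinh (pi * (3/2 - t))" using t by simp
    then have "D \<le> (sinh (pi * (3/2 - t)))\<^sup>2" unfolding D_def by (intro power_mono) auto
    also have "sinh (pi * (3/2 - t)) = - sinh (pi * (t - 3/2))"
      by (metis minus_diff_eq mult_minus_right sinh_minus)
    finally have DL: "D \<le> cos_sq (3/2) X t" by (simp add: cos_sq_def add_increasing)
    have s: "sinh (2 * pi * t) \<le> 2 * pi * t * exp (2 * pi)"
      using t by (intro sinh_le) (auto simp: mult_left_le)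
    have "0 \<le> sinh (2 * pi * t) * sinh (3 * pi)" using t by simp
    then have "ln (cos_sq (-3/2) X t) - ln (cos_sq (3/2) X t) \<le> sinh (2 * pi * t) * sinh (3 * pi) / cos_sq (3/2) X t"
      using ln_diff_le[of "cos_sq (3/2) X t" "cos_sq (-3/2) X t"] DL D cos_sq_minus_pos[OF t(1), of X] cos_sq_diff[of X t] by simp
    also have "\<dots> \<le> sinh (2 * pi * t) * sinh (3 * pi) / D"
      using DL D t by (intro divide_left_mono) auto
    also have "\<dots> \<le> 2 * pi * t * exp (2 * pi) * sinh (3 * pi) / D"
      using s D by (intro divide_right_mono mult_right_mono) auto
    also have "\<dots> = C * t" by (simp add: C_def)
    finally have "2 * green X t \<le> C * t" by (simp add: green_def)
    then show ?thesis using C t mult_nonneg_nonneg[of C t] by linarith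
  qed
  then show ?thesis using C by blast
qed

lemma sinh_sq_exp: "(sinh y)\<^sup>2 = (exp (2 * y) + exp (- (2 * y)) - 2) / (4::real)"
proof -
  have "exp (2 * y) = (exp y)\<^sup>2" "exp (- (2 * y)) = (exp (- y))\<^sup>2" "exp y * exp (- y) = 1"
    using exp_double[of y] exp_double[of "- y"] by (simp_all add: exp_minus)
  then show ?thesis by (simp add: sinh_field_def power_divide power2_diff)
qed

text \<open>Far above the poles the row of poles acts like a uniformly charged line, whose potential is the
  constant \<open>3 pi\<close>. An error of order \<open>1 / t\<close> is summable over dyadic \<open>t\<close>.\<close>
lemma green_high:
  "\<exists>C\<ge>0. \<forall>X t. 2 \<le> t \<longrightarrow> \<bar>green X t - 3 * pi\<bar> \<le> C / t"
proof -
  define q where "q = exp (3 * pi)"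
  have q: "1 \<le> q" by (simp add: q_def)
  have "\<bar>green X t - 3 * pi\<bar> \<le> 3 * q ^ 3 / t" if t: "2 \<le> t" for X t
  proof -
    define E where "E = exp (2 * pi * t)"
    have E: "1 \<le> E" using t by (simp add: E_def)
    define c where "c = (cos (pi * X))\<^sup>2"
    have c: "0 \<le> c" "c \<le> 1" by (auto simp: c_def power_le_one_iff abs_square_le_1)
    have e1: "2 * (pi * (t - - 3 / 2)) = 2 * pi * t + 3 * pi" "2 * (pi * (t - 3 / 2)) = 2 * pi * t - 3 * pi"
      by (simp_all add: algebra_simps)
    have N: "cos_sq (-3/2) X t = c + (q * E + 1 / (q * E) - 2) / 4"
      unfolding cos_sq_def c_def[symmetric] sinh_sq_exp e1
      by (simp add: q_def E_def exp_add exp_diff exp_minus inverse_eq_divide mult.commute)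
    have D: "cos_sq (3/2) X t = c + (E / q + q / E - 2) / 4"
      unfolding cos_sq_def c_def[symmetric] sinh_sq_exp e1
      by (simp add: q_def E_def exp_diff exp_minus)
    let ?N = "cos_sq (-3/2) X t" and ?D = "cos_sq (3/2) X t"
    have "t \<le> (pi * (t - 3/2))\<^sup>2"
    proof -
      have "t / 4 \<le> t - 3/2" using t by simp
      then have "3 * (t / 4) \<le> pi * (t - 3/2)" using t pi_gt3 by (intro mult_mono) auto
      then have "(3 * (t / 4))\<^sup>2 \<le> (pi * (t - 3/2))\<^sup>2" using t by (intro power_mono) auto
      moreover have "t \<le> (3 * (t / 4))\<^sup>2"
        using mult_mono[of 2 t t t] t by (simp add: power2_eq_square)
      ultimately show ?thesis by linarith
    qed
    also have "\<dots> \<le> (sinh (pi * (t - 3/2)))\<^sup>2" by (rule sinh_sq_ge)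
    also have "\<dots> \<le> ?D" by (simp add: cos_sq_def)
    finally have tD: "t \<le> ?D" .
    have DN: "?D \<le> ?N" using t by (intro cos_sq_le) auto
    have diff: "?N - q\<^sup>2 * ?D = c * (1 - q\<^sup>2) + (1 / (q * E) - 2 - q ^ 3 / E + 2 * q\<^sup>2) / 4"
      unfolding N D using q E by (simp add: field_simps power2_eq_square power3_eq_cube)
    have pw: "1 \<le> q ^ 3" "q\<^sup>2 \<le> q ^ 3" "1 \<le> q\<^sup>2" using q by (auto intro: power_increasing)
    have b1: "0 \<le> 1 / (q * E)" "1 / (q * E) \<le> 1"
      using q E mult_mono[of 1 q 1 E] by (auto simp: divide_le_eq)
    have b2: "0 \<le> q ^ 3 / E" "q ^ 3 / E \<le> q ^ 3" using q E by (auto simp: divide_le_eq mult_le_cancel_left1)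
    have b3: "c * (1 - q\<^sup>2) \<le> 0" "- q\<^sup>2 \<le> c * (1 - q\<^sup>2)"
    proof -
      show "c * (1 - q\<^sup>2) \<le> 0" using c pw by (intro mult_nonneg_nonpos) auto
      have "c * (q\<^sup>2 - 1) \<le> 1 * (q\<^sup>2 - 1)" using c pw by (intro mult_right_mono) auto
      then show "- q\<^sup>2 \<le> c * (1 - q\<^sup>2)" by (simp add: algebra_simps)
    qed
    have d: "\<bar>?N - q\<^sup>2 * ?D\<bar> \<le> 3 * q ^ 3"
      unfolding diff using pw b1 b2 b3 by (intro abs_leI) argo+
    have pos: "0 < ?D" "0 < ?N" "0 < q\<^sup>2 * ?D" "t \<le> q\<^sup>2 * ?D" "t \<le> ?N"
      using tD DN t pw q mult_mono[of 1 "q\<^sup>2" t ?D] by auto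
    have l: "ln (q\<^sup>2 * ?D) = 6 * pi + ln ?D"
      using pos q by (simp add: ln_mult ln_realpow q_def)
    have "ln ?N - ln (q\<^sup>2 * ?D) \<le> 3 * q ^ 3 / t"
    proof -
      have "ln ?N - ln (q\<^sup>2 * ?D) \<le> (?N - q\<^sup>2 * ?D) / (q\<^sup>2 * ?D)" using pos by (intro ln_diff_le)
      also have "\<dots> \<le> 3 * q ^ 3 / (q\<^sup>2 * ?D)" using d pos by (intro divide_right_mono) auto
      also have "\<dots> \<le> 3 * q ^ 3 / t" using pos t pw q by (intro divide_left_mono mult_pos_pos) auto
      finally show ?thesis .
    qed
    moreover have "ln (q\<^sup>2 * ?D) - ln ?N \<le> 3 * q ^ 3 / t"
    proof -
      have "ln (q\<^sup>2 * ?D) - ln ?N \<le> (q\<^sup>2 * ?D - ?N) / ?N" using pos by (intro ln_diff_le)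
      also have "\<dots> \<le> 3 * q ^ 3 / ?N" using d pos by (intro divide_right_mono) auto
      also have "\<dots> \<le> 3 * q ^ 3 / t" using pos t pw q by (intro divide_left_mono mult_pos_pos) auto
      finally show ?thesis .
    qed
    moreover have "2 * (green X t - 3 * pi) = ln ?N - ln (q\<^sup>2 * ?D)" unfolding l by (simp add: green_def)
    ultimately have "\<bar>2 * (green X t - 3 * pi)\<bar> \<le> 3 * q ^ 3 / t" by (simp add: abs_le_iff)
    then have "2 * \<bar>green X t - 3 * pi\<bar> \<le> 3 * q ^ 3 / t" by (simp only: abs_mult abs_numeral)
    then show ?thesis using abs_ge_zero[of "green X t - 3 * pi"] by argo
  qed
  then show ?thesis using q by (intro exI[of _ "3 * q ^ 3"]) auto
qed

text \<open>The logarithmic singularity: outside squares of half-side \<open>\<epsilon>\<close> around the poles the potential is at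
  most \<open>ln (1 / \<epsilon>)\<close> up to a constant.\<close>
lemma green_le_mid:
  "\<exists>C\<ge>0. \<forall>X t \<epsilon>. 1 \<le> t \<longrightarrow> t \<le> 2 \<longrightarrow> 0 < \<epsilon> \<longrightarrow> 4 * \<epsilon>\<^sup>2 \<le> cos_sq (3/2) X t \<longrightarrow> green X t \<le> C - ln (2 * \<epsilon>)"
proof -
  define B where "B = 1 + (sinh (pi * (7/2)))\<^sup>2"
  have "green X t \<le> ln B / 2 - ln (2 * \<epsilon>)"
    if t: "1 \<le> t" "t \<le> 2" and e: "0 < \<epsilon>" "4 * \<epsilon>\<^sup>2 \<le> cos_sq (3/2) X t" for X t \<epsilon>
  proof -
    have "sinh (pi * (t - -3/2)) \<le> sinh (pi * (7/2))" using t by simp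
    then have "(sinh (pi * (t - -3/2)))\<^sup>2 \<le> (sinh (pi * (7/2)))\<^sup>2" using t by (intro power_mono) auto
    moreover have "(cos (pi * X))\<^sup>2 \<le> 1" by (simp add: abs_square_le_1)
    ultimately have "cos_sq (-3/2) X t \<le> B" by (simp add: cos_sq_def B_def)
    then have "ln (cos_sq (-3/2) X t) \<le> ln B" using cos_sq_minus_pos[of t X] t by (intro ln_mono) auto
    moreover have "ln (4 * \<epsilon>\<^sup>2) \<le> ln (cos_sq (3/2) X t)" using e by (intro ln_mono) auto
    moreover have "ln (4 * \<epsilon>\<^sup>2) = 2 * ln (2 * \<epsilon>)"
    proof -
      have "4 * \<epsilon>\<^sup>2 = (2 * \<epsilon>)\<^sup>2" by (simp add: power_mult_distrib)
      then show ?thesis using e by (simp only: ln_realpow)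
    qed
    ultimately show ?thesis unfolding green_def by argo
  qed
  moreover have "0 \<le> ln B / 2" by (simp add: B_def)
  ultimately show ?thesis by blast
qed

lemma abs_sin_pi_ge: assumes "\<bar>w\<bar> \<le> 1/2" shows "2 * \<bar>w\<bar> \<le> \<bar>sin (pi * w)\<bar>"
proof -
  have "2 * w \<le> sin (pi * w)" if w: "0 \<le> w" "w \<le> 1/2" for w
  proof -
    have "concave_on {0..pi/2} sin"
    proof (rule f''_le0_imp_concave[where f' = cos and f'' = "\<lambda>x. - sin x"])
      show "- sin x \<le> 0" if "x \<in> {0..pi/2}" for x using that sin_ge_zero[of x] by auto
    qed (auto intro!: derivative_eq_intros)
    from concave_onD[OF this, of "2 * w" 0 "pi/2"] show ?thesis
      using w by (simp add: mult.commute)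
  qed
  from this[of "\<bar>w\<bar>"] show ?thesis using assms by (cases "w \<ge> 0") auto
qed

lemma cos_sq_ge:
  assumes "\<epsilon> > 0" "\<epsilon> < max \<bar>X - (real_of_int m + 1/2)\<bar> \<bar>t - 3/2\<bar>" "\<bar>X - (real_of_int m + 1/2)\<bar> \<le> 1/2"
  shows "4 * \<epsilon>\<^sup>2 \<le> cos_sq (3/2) X t"
proof -
  define w where "w = X - (real_of_int m + 1/2)"
  have "cos (pi * X) = cos (pi * w + pi / 2 + pi * m)" by (simp add: w_def algebra_simps)
  also have "\<dots> = - sin (pi * w) * cos (pi * m)" by (simp add: cos_add sin_add)
  finally have "(cos (pi * X))\<^sup>2 = (sin (pi * w))\<^sup>2"
    by (simp add: power_mult_distrib cos_int_times_real power2_eq_square) 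
  also have "\<dots> \<ge> (2 * \<bar>w\<bar>)\<^sup>2"
    using power_mono[OF abs_sin_pi_ge[of w], of 2] assms(3) by (simp add: w_def)
  finally have c: "4 * w\<^sup>2 \<le> (cos (pi * X))\<^sup>2" by (simp add: power_mult_distrib)
  have "(2 * (t - 3/2))\<^sup>2 \<le> (pi * (t - 3/2))\<^sup>2"
    unfolding power_mult_distrib using pi_gt3 by (intro mult_right_mono power_mono) auto
  also have "\<dots> \<le> (sinh (pi * (t - 3/2)))\<^sup>2" by (rule sinh_sq_ge)
  finally have "(2 * (t - 3/2))\<^sup>2 \<le> (sinh (pi * (t - 3/2)))\<^sup>2" .
  then have s: "4 * (t - 3/2)\<^sup>2 \<le> (sinh (pi * (t - 3/2)))\<^sup>2" unfolding power_mult_distrib by simp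
  consider "\<epsilon> \<le> \<bar>w\<bar>" | "\<epsilon> \<le> \<bar>t - 3/2\<bar>" using assms(2) by (fastforce simp: w_def)
  then have "\<epsilon>\<^sup>2 \<le> w\<^sup>2 \<or> \<epsilon>\<^sup>2 \<le> (t - 3/2)\<^sup>2"
    by cases (use assms(1) in \<open>auto simp: abs_le_square_iff[symmetric]\<close>)
  then show ?thesis using c s zero_le_power2[of w] zero_le_power2[of "t - 3/2"] unfolding cos_sq_def by argo
qed

section \<open>Mean values of harmonic functions of two coordinates\<close>

text \<open>By Vitali's covering theorem an open set is, up to a null set, a disjoint union of balls, and the
  volume of a ball depends on its radius only.\<close>
lemma emeasure_le_isometry_image:
  fixes f :: "'a::euclidean_space \<Rightarrow> 'a"
  assumes iso: "\<And>u v. dist (f u) (f v) = dist u v" and surj: "surj f" and S: "open S" and fS: "open (f ` S)"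
  shows "emeasure lborel S \<le> emeasure lborel (f ` S)"
proof -
  have inj: "inj f" using iso by (metis dist_eq_0_iff injI)
  have ball: "f ` ball c r = ball (f c) r" for c r
  proof
    show "ball (f c) r \<subseteq> f ` ball c r"
    proof
      fix y assume "y \<in> ball (f c) r"
      moreover obtain u where "y = f u" using surj by (metis surjD)
      ultimately show "y \<in> f ` ball c r" using iso by auto
    qed
  qed (use iso in auto)
  define K where "K = {p :: 'a \<times> real. 0 < snd p \<and> ball (fst p) (snd p) \<subseteq> S}"
  have "\<exists>i. i \<in> K \<and> x \<in> ball (fst i) (snd i) \<and> snd i < d" if xd: "x \<in> S" "0 < d" for x d
  proof -
    obtain e where e: "e > 0" "ball x e \<subseteq> S" using openE[OF S xd(1)] by blast
    have "ball x (min e (d / 2)) \<subseteq> S" using e(2) by auto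
    then show ?thesis using e(1) xd(2) by (intro exI[of _ "(x, min e (d / 2))"]) (auto simp: K_def)
  qed
  then obtain C where C: "countable C" "C \<subseteq> K"
     "pairwise (\<lambda>i j. disjnt (ball (fst i) (snd i)) (ball (fst j) (snd j))) C"
     "negligible (S - (\<Union>i\<in>C. ball (fst i) (snd i)))"
    by (rule Vitali_covering_theorem_balls[of S K fst snd]) 
  define B where "B i = ball (fst i) (snd i)" for i :: "'a \<times> real"
  have disj: "disjoint_family_on B C"
    using C(3) by (auto simp: disjoint_family_on_def pairwise_def disjnt_def B_def)
  have disj': "disjoint_family_on (\<lambda>i. f ` B i) C"
    using disj by (simp add: disjoint_family_on_def image_Int[OF inj, symmetric])
  have om: "f ` B i \<in> sets lborel" "B i \<in> sets lborel" for i by (simp_all add: B_def ball)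
  have U: "(\<Union>i\<in>C. B i) \<in> sets lborel" using C(1) om by (intro sets.countable_UN') auto
  have "S - (\<Union>i\<in>C. B i) \<in> null_sets lborel"
    using C(4) U S unfolding negligible_iff_null_sets B_def[symmetric]
    by (subst (asm) null_sets_completion_iff) auto
  then have "emeasure lborel ((\<Union>i\<in>C. B i) \<union> (S - (\<Union>i\<in>C. B i))) = emeasure lborel (\<Union>i\<in>C. B i)"
    by (rule emeasure_Un_null_set[OF U])
  moreover have "(\<Union>i\<in>C. B i) \<union> (S - (\<Union>i\<in>C. B i)) = S" using C(2) by (auto simp: K_def B_def)
  ultimately have "emeasure lborel S = emeasure lborel (\<Union>i\<in>C. B i)" by simp
  also have "\<dots> = (\<integral>\<^sup>+i. emeasure lborel (B i) \<partial>count_space C)"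
    by (rule emeasure_UN_countable[OF om(2) C(1) disj])
  also have "\<dots> = (\<integral>\<^sup>+i. emeasure lborel (f ` B i) \<partial>count_space C)"
  proof (rule nn_integral_cong)
    fix i assume "i \<in> space (count_space C)"
    then have "0 \<le> snd i" using C(2) by (auto simp: K_def)
    then show "emeasure lborel (B i) = emeasure lborel (f ` B i)" unfolding B_def ball by (simp add: emeasure_ball)
  qed
  also have "\<dots> = emeasure lborel (\<Union>i\<in>C. f ` B i)"
    by (rule emeasure_UN_countable[OF om(1) C(1) disj', symmetric])
  also have "\<dots> \<le> emeasure lborel (f ` S)"
    using C(2) fS by (intro emeasure_mono) (auto simp: K_def B_def)
  finally show ?thesis .
qed

lemma lborel_distr_isometry:
  fixes f :: "'a::euclidean_space \<Rightarrow> 'a"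
  assumes iso: "\<And>u v. dist (f u) (f v) = dist u v" and surj: "surj f"
  shows "distr lborel borel f = lborel"
proof (rule lborel_eqI[symmetric])
  fix l u :: 'a assume lu: "\<And>b. b \<in> Basis \<Longrightarrow> l \<bullet> b \<le> u \<bullet> b"
  have inj: "inj f" using iso by (metis dist_eq_0_iff injI)
  have bij: "bij f" using inj surj by (rule bijI)
  define g where "g = inv f"
  have fg: "f (g y) = y" "g (f x) = x" for x y using bij by (simp_all add: g_def surj_f_inv_f surj inv_f_f inj)
  have giso: "dist (g x) (g y) = dist x y" for x y using iso[of "g x" "g y"] by (simp add: fg)
  have gsurj: "surj g" using fg(2) by (metis surjI)
  have cont: "continuous_on UNIV f"
    using iso by (intro lipschitz_on_continuous_on[of 1] lipschitz_onI) auto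
  have gcont: "continuous_on UNIV g"
    using giso by (intro lipschitz_on_continuous_on[of 1] lipschitz_onI) auto
  have img: "g ` S = f -` S" for S
    unfolding g_def by (rule bij_vimage_eq_inv_image[OF bij, symmetric])
  have o: "open (g ` box l u)" unfolding img by (rule open_vimage[OF open_box cont])
  have "emeasure (distr lborel borel f) (box l u) = emeasure lborel (g ` box l u)"
    using cont unfolding img by (subst emeasure_distr) (auto simp: borel_measurable_continuous_onI)
  also have "\<dots> = emeasure lborel (box l u)"
  proof (rule antisym)
    have fgb: "f ` g ` box l u = box l u" by (simp add: image_image fg)
    show "emeasure lborel (g ` box l u) \<le> emeasure lborel (box l u)"
      using emeasure_le_isometry_image[OF iso surj o] by (simp add: fgb open_box)
    show "emeasure lborel (box l u) \<le> emeasure lborel (g ` box l u)"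
      by (rule emeasure_le_isometry_image[OF giso gsurj open_box o])
  qed
  also have "\<dots> = ennreal (\<Prod>b\<in>Basis. (u - l) \<bullet> b)" using lu by (simp add: emeasure_lborel_box)
  finally show "emeasure (distr lborel borel f) (box l u) = ennreal (\<Prod>b\<in>Basis. (u - l) \<bullet> b)" .
qed simp

context two_axes begin

definition proj :: "(real, 'n) vec \<Rightarrow> complex" where "proj y = Complex (y $ a) (y $ b)"

lemma proj_diff: "proj (u - v) = proj u - proj v"
  by (simp add: proj_def complex_eq_iff)

lemma continuous_on_proj [continuous_intros]: "continuous_on S proj"
  unfolding proj_def by (intro continuous_on_Complex continuous_intros)

lemma norm_proj_le: "cmod (proj v) \<le> norm v"
proof -
  have "(cmod (proj v))\<^sup>2 = (\<Sum>j\<in>{a, b}. (v $ j)\<^sup>2)" using ab by (simp add: proj_def cmod_def)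
  also have "\<dots> \<le> (\<Sum>j\<in>UNIV. (v $ j)\<^sup>2)" by (intro sum_mono2) auto
  also have "\<dots> = (norm v)\<^sup>2" by (simp add: norm_vec_def L2_set_def sum_nonneg)
  finally show ?thesis by (rule power2_le_imp_le) simp
qed

text \<open>Rotation of the \<open>(a, b)\<close>-coordinates about \<open>x\<close>, the plane being read as the complex numbers; \<open>w\<close> is
  meant to be unimodular.\<close>
definition rot :: "(real, 'n) vec \<Rightarrow> complex \<Rightarrow> (real, 'n) vec \<Rightarrow> (real, 'n) vec" where
  "rot x w y = y + planar (Re ((w - 1) * proj (y - x))) (Im ((w - 1) * proj (y - x)))"

lemma proj_planar: "proj (planar u v) = Complex u v" by (simp add: proj_def)

lemma proj_add: "proj (u + v) = proj u + proj v"
  by (simp add: proj_def complex_eq_iff)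

lemma proj_rot: "proj (rot x w y - x) = w * proj (y - x)"
proof -
  have "rot x w y - x = (y - x) + planar (Re ((w - 1) * proj (y - x))) (Im ((w - 1) * proj (y - x)))"
    by (simp add: rot_def)
  then have "proj (rot x w y - x) = proj (y - x) + (w - 1) * proj (y - x)"
    by (simp only: proj_add proj_planar complex_surj)
  then show ?thesis by (simp add: algebra_simps)
qed

lemma norm_rotate: "norm (v + planar (Re ((w - 1) * proj v)) (Im ((w - 1) * proj v))) = norm v" if "cmod w = 1"
proof -
  let ?u = "v + planar (Re ((w - 1) * proj v)) (Im ((w - 1) * proj v))"
  have split: "(norm z)\<^sup>2 = (cmod (proj z))\<^sup>2 + (\<Sum>j\<in>-{a, b}. (z $ j)\<^sup>2)" for z :: "(real, 'n) vec"
  proof -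
    have "(norm z)\<^sup>2 = (\<Sum>j\<in>UNIV. (z $ j)\<^sup>2)" by (simp add: norm_vec_def L2_set_def sum_nonneg)
    also have "\<dots> = (\<Sum>j\<in>{a, b}. (z $ j)\<^sup>2) + (\<Sum>j\<in>-{a, b}. (z $ j)\<^sup>2)"
      by (simp add: sum.subset_diff[of "{a, b}" UNIV] Compl_eq_Diff_UNIV)
    finally show ?thesis using ab by (simp add: proj_def cmod_def)
  qed
  have "proj ?u = proj v + (w - 1) * proj v" by (simp only: proj_add proj_planar complex_surj)
  then have "proj ?u = w * proj v" by (simp add: algebra_simps)
  then have "cmod (proj ?u) = cmod (proj v)" using that by (simp add: norm_mult)
  moreover have "(\<Sum>j\<in>-{a, b}. (?u $ j)\<^sup>2) = (\<Sum>j\<in>-{a, b}. (v $ j)\<^sup>2)"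
    by (intro sum.cong) (auto simp: planar_nth_other)
  ultimately have "(norm ?u)\<^sup>2 = (norm v)\<^sup>2" using split by metis
  then show ?thesis by simp
qed

lemma rot_iso: assumes "cmod w = 1" shows "dist (rot x w y) (rot x w y') = dist y y'"
proof -
  have p: "proj (y - x) = proj (y - y') + proj (y' - x)" by (simp add: proj_diff)
  have "rot x w y - rot x w y' = (y - y') + planar (Re ((w - 1) * proj (y - y'))) (Im ((w - 1) * proj (y - y')))"
    unfolding rot_def p by (simp add: planar_def algebra_simps)
  then show ?thesis using norm_rotate[OF assms, of "y - y'"] by (simp add: dist_norm)
qed

lemma rot_rot: "rot x w' (rot x w y) = rot x (w' * w) y"
proof -
  have "rot x w' (rot x w y) = rot x w y + planar (Re ((w' - 1) * (w * proj (y - x)))) (Im ((w' - 1) * (w * proj (y - x))))"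
    by (simp only: rot_def[of x w' "rot x w y"] proj_rot)
  also have "\<dots> = rot x (w' * w) y" by (simp add: rot_def planar_def algebra_simps)
  finally show ?thesis .
qed

lemma rot_surj: assumes "cmod w = 1" shows "surj (rot x w)"
proof (rule surjI)
  have "w \<noteq> 0" using assms by auto
  then show "rot x w (rot x (inverse w) y) = y" for y
    unfolding rot_rot by (simp add: rot_def planar_def)
qed

lemma rot_center: "rot x w x = x" by (simp add: rot_def proj_def planar_def)

text \<open>A rotation of the ball by the angle \<open>\<pi> / n\<close> changes the sign of the integrand.\<close>
lemma integral_power_zero:
  fixes x :: "(real, 'n) vec" and r :: real
  assumes "n \<ge> 1"
  shows "(LINT y|lborel. indicator (cball x r) y *\<^sub>R (proj (y - x)) ^ n) = 0"
proof -
  define w where "w = cis (pi / n)"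
  have "w ^ n = cis (real n * (pi / n))" unfolding w_def by (rule Complex.DeMoivre)
  then have w: "cmod w = 1" "w ^ n = -1" using assms by (simp_all add: w_def)
  let ?F = "\<lambda>y. indicator (cball x r) y *\<^sub>R (proj (y - x)) ^ n"
  have cont: "continuous_on UNIV (rot x w)"
    using rot_iso[OF w(1)] by (intro lipschitz_on_continuous_on[of 1] lipschitz_onI) auto
  have meas: "?F \<in> borel_measurable borel"
    by (intro borel_measurable_scaleR borel_measurable_indicator borel_measurable_continuous_onI continuous_intros
        continuous_on_compose2[OF continuous_on_proj[of UNIV]]) auto
  have "(LINT y|lborel. ?F y) = (LINT y|distr lborel borel (rot x w). ?F y)"
    using lborel_distr_isometry[OF rot_iso[OF w(1)] rot_surj[OF w(1)]] by simp
  also have "\<dots> = (LINT y|lborel. ?F (rot x w y))"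
    using cont meas by (intro integral_distr) (auto simp: borel_measurable_continuous_onI)
  also have "\<dots> = (LINT y|lborel. - ?F y)"
  proof (rule Bochner_Integration.integral_cong)
    fix y
    have "dist x (rot x w y) = dist x y" using rot_iso[OF w(1), of x x y] by (simp add: rot_center)
    then have "indicator (cball x r) (rot x w y) = (indicator (cball x r) y :: real)" by (simp add: indicator_def)
    then show "?F (rot x w y) = - ?F y" by (simp add: proj_rot power_mult_distrib w(2))
  qed simp
  also have "\<dots> = - (LINT y|lborel. ?F y)" by simp
  finally show ?thesis by simp
qed

text \<open>The real part of a holomorphic function of two of the coordinates has the mean value property on
  balls of the whole space: in the power series about the centre only the constant term contributes.\<close>
lemma integral_holomorphic_ball:
  fixes x :: "(real, 'n) vec"
  assumes h: "h holomorphic_on ball (proj x) R" and r: "0 < r" "r < R"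
  shows "(LINT y:cball x r|lborel. Re (h (proj y))) = measure lborel (cball x r) * Re (h (proj x))"
proof -
  define c where "c n = (deriv ^^ n) h (proj x) / fact n" for n
  define F where "F n y = indicator (cball x r) y *\<^sub>R (c n * proj (y - x) ^ n)" for n y
  have ser: "(\<lambda>n. c n * u ^ n) sums h (proj x + u)" if "cmod u < R" for u
    using holomorphic_power_series[OF h, of "proj x + u"] that by (simp add: c_def dist_norm)
  \<comment> \<open>Convergence at \<open>q\<close> gives absolute convergence at the smaller radius \<open>r\<close>.\<close>
  define q where "q = (r + R) / 2"
  have q: "r < q" "q < R" using r by (simp_all add: q_def)
  have "summable (\<lambda>n. c n * of_real q ^ n)"
    using ser[of "of_real q"] q r by (auto intro: sums_summable)
  then have abs: "summable (\<lambda>n. norm (c n * of_real r ^ n))"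
    using q r by (intro powser_insidea[where x = "of_real q"]) auto
  have bnd: "norm (F n y) \<le> indicator (cball x r) y * norm (c n * of_real r ^ n)" for n y
  proof (cases "y \<in> cball x r")
    case True
    then have "cmod (proj (y - x)) \<le> r" using norm_proj_le[of "y - x"] by (simp add: dist_norm norm_minus_commute)
    then have "cmod (proj (y - x)) ^ n \<le> r ^ n" by (intro power_mono) auto
    then show ?thesis using True r by (simp add: F_def norm_mult norm_power mult_left_mono)
  qed (simp add: F_def)
  have fin: "emeasure lborel (cball x r) < \<infinity>" by (rule emeasure_lborel_cball_finite)
  have meas: "F n \<in> borel_measurable lborel" for n
  proof -
    have "continuous_on UNIV (\<lambda>y. c n * proj (y - x) ^ n)"
      by (intro continuous_intros continuous_on_compose2[OF continuous_on_proj[of UNIV]]) auto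
    then have [measurable]: "(\<lambda>y. c n * proj (y - x) ^ n) \<in> borel_measurable borel"
      by (rule borel_measurable_continuous_onI)
    show ?thesis unfolding F_def measurable_lborel1 by (intro borel_measurable_scaleR borel_measurable_indicator) auto
  qed
  have ind: "integrable lborel (\<lambda>y. indicator (cball x r) y * m)" for m :: real
    using fin by (intro integrable_mult_left integrable_real_indicator) auto
  have int: "integrable lborel (F n)" for n
    by (rule Bochner_Integration.integrable_bound[OF ind[of "norm (c n * of_real r ^ n)"] meas], rule AE_I2,
        unfold real_norm_def, rule order_trans[OF bnd abs_ge_self])
  have "(\<lambda>n. LINT y|lborel. F n y) sums (LINT y|lborel. (\<Sum>n. F n y))"
  proof (rule sums_integral[OF int])
    have "summable (\<lambda>n. norm (F n y))" for y
      by (rule summable_comparison_test'[where N = 0, OF summable_mult[OF abs, of "indicator (cball x r) y"]])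
        (use bnd in auto)
    then show "AE y in lborel. summable (\<lambda>n. norm (F n y))" by simp
    show "summable (\<lambda>n. LINT y|lborel. norm (F n y))"
    proof (rule summable_comparison_test'[where N = 0, OF summable_mult[OF abs, of "measure lborel (cball x r)"]])
      fix n
      have "(LINT y|lborel. norm (F n y)) \<le> (LINT y|lborel. indicator (cball x r) y * norm (c n * of_real r ^ n))"
        by (intro integral_mono ind integrable_norm int bnd)
      then show "norm (LINT y|lborel. norm (F n y)) \<le> measure lborel (cball x r) * norm (c n * of_real r ^ n)"
        by simp
    qed
  qed
  moreover have "(LINT y|lborel. F n y) = (if n = 0 then measure lborel (cball x r) *\<^sub>R c 0 else 0)" for n
  proof (cases "n = 0")
    case True
    have "(LINT y|lborel. F 0 y) = (LINT y|lborel. indicator (cball x r) y *\<^sub>R c 0)" by (simp add: F_def)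
    also have "\<dots> = measure lborel (cball x r) *\<^sub>R c 0" 
      using fin by (intro has_bochner_integral_integral_eq has_bochner_integral_indicator) auto
    finally show ?thesis using True by simp
  next
    case False
    have "(LINT y|lborel. F n y) = (LINT y|lborel. c n * (indicator (cball x r) y *\<^sub>R proj (y - x) ^ n))"
      unfolding F_def by (simp only: mult_scaleR_right)
    also have "\<dots> = c n * (LINT y|lborel. indicator (cball x r) y *\<^sub>R proj (y - x) ^ n)"
      by (rule integral_mult_right_zero)
    finally show ?thesis using integral_power_zero[of n x r] False by simp
  qed
  ultimately have "(\<lambda>n. if n = 0 then measure lborel (cball x r) *\<^sub>R c 0 else 0) sums (LINT y|lborel. (\<Sum>n. F n y))"
    by simp
  then have tot: "(LINT y|lborel. (\<Sum>n. F n y)) = measure lborel (cball x r) *\<^sub>R c 0"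
    using sums_unique2[OF _ sums_single[of 0 "\<lambda>n. measure lborel (cball x r) *\<^sub>R c 0"]] by fastforce
  have sumF: "(\<Sum>n. F n y) = indicator (cball x r) y *\<^sub>R h (proj y)" for y
  proof (cases "y \<in> cball x r")
    case True
    then have "cmod (proj (y - x)) < R" using norm_proj_le[of "y - x"] r by (simp add: dist_norm norm_minus_commute)
    from ser[OF this] have "(\<lambda>n. c n * proj (y - x) ^ n) sums h (proj y)" by (simp add: proj_diff)
    then show ?thesis using True by (simp add: F_def sums_iff)
  qed (simp add: F_def)
  have "integrable lborel (\<lambda>y. indicator (cball x r) y *\<^sub>R h (proj y))"
  proof -
    have "continuous_on (cball x r) (\<lambda>y. h (proj y))"
    proof (rule continuous_on_compose2[OF holomorphic_on_imp_continuous_on[OF h] continuous_on_proj])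
      show "proj ` cball x r \<subseteq> ball (proj x) R"
      proof clarify
        fix y assume "y \<in> cball x r"
        then show "proj y \<in> ball (proj x) R"
          using norm_proj_le[of "x - y"] r by (simp add: dist_norm proj_diff)
      qed
    qed
    then show ?thesis using borel_integrable_compact[of "cball x r"] by auto
  qed
  then have "Re (LINT y|lborel. indicator (cball x r) y *\<^sub>R h (proj y)) = (LINT y|lborel. Re (indicator (cball x r) y *\<^sub>R h (proj y)))"
    by (rule integral_Re[symmetric])
  also have "\<dots> = (LINT y:cball x r|lborel. Re (h (proj y)))" by (simp add: set_lebesgue_integral_def)
  finally show ?thesis using tot unfolding sumF by (simp add: c_def)
qed

text \<open>Harmonicity, in the form in which it is stable under linear combinations.\<close>
definition mean_value_on :: "((real, 'n) vec \<Rightarrow> real) \<Rightarrow> (real, 'n) vec set \<Rightarrow> bool" where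
  "mean_value_on u S \<longleftrightarrow> continuous_on S u \<and>
    (\<forall>x r. 0 < r \<and> cball x r \<subseteq> S \<longrightarrow> (LINT y:cball x r|lborel. u y) = measure lborel (cball x r) * u x)"

lemma continuous_on_cball_integrable:
  fixes u :: "(real, 'n) vec \<Rightarrow> real"
  assumes "continuous_on S u" "cball x r \<subseteq> S"
  shows "set_integrable lborel (cball x r) u"
  unfolding set_integrable_def using assms by (intro borel_integrable_compact) (auto intro: continuous_on_subset)

lemma mean_value_on_const: "mean_value_on (\<lambda>_. c) S"
proof -
  have "(LINT y:cball x r|lborel. c) = measure lborel (cball x r) * c" for x :: "(real, 'n) vec" and r
    using has_bochner_integral_integral_eq[OF has_bochner_integral_indicator[of "cball x r" lborel c]]
    by (simp add: set_lebesgue_integral_def emeasure_lborel_cball_finite)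
  then show ?thesis by (simp add: mean_value_on_def)
qed

lemma mean_value_on_add:
  assumes "mean_value_on u S" "mean_value_on v S"
  shows "mean_value_on (\<lambda>x. u x + v x) S"
  unfolding mean_value_on_def
proof (intro conjI allI impI)
  show "continuous_on S (\<lambda>x. u x + v x)" using assms by (auto simp: mean_value_on_def intro: continuous_on_add)
  fix x r assume r: "0 < r \<and> cball x r \<subseteq> S"
  then have "(LINT y:cball x r|lborel. u y + v y) = (LINT y:cball x r|lborel. u y) + (LINT y:cball x r|lborel. v y)"
    using assms continuous_on_cball_integrable by (intro set_integral_add) (auto simp: mean_value_on_def)
  then show "(LINT y:cball x r|lborel. u y + v y) = measure lborel (cball x r) * (u x + v x)"
    using assms r by (simp add: mean_value_on_def algebra_simps)
qed

lemma mean_value_on_cmult: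
  assumes "mean_value_on u S" shows "mean_value_on (\<lambda>x. c * u x) S"
  using assms by (auto simp: mean_value_on_def intro!: continuous_intros)

lemma mean_value_on_sum:
  assumes "\<And>i. i \<in> I \<Longrightarrow> mean_value_on (u i) S"
  shows "mean_value_on (\<lambda>x. \<Sum>i\<in>I. u i x) S"
  using assms by (induction I rule: infinite_finite_induct) (auto intro: mean_value_on_const mean_value_on_add)

lemma mean_value_imp_superharmonic:
  assumes "mean_value_on u S" "open S" shows "superharmonic_on u S"
  unfolding superharmonic_on_def
proof (intro conjI ballI allI impI)
  have c: "continuous_on S u" using assms by (simp add: mean_value_on_def)
  fix x t assume "x \<in> S" "t < u x"
  then show "\<forall>\<^sub>F y in at x within S. t < u y"
    using c by (auto simp: continuous_on_def intro: order_tendstoD)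
next
  fix x r assume r: "0 < r \<and> cball x r \<subseteq> S"
  show "set_integrable lborel (cball x r) u"
    using assms r continuous_on_cball_integrable by (auto simp: mean_value_on_def)
  have "measure lborel (cball x r) \<noteq> 0" using r content_cball_pos[of r x] by simp
  then show "(LINT y:cball x r|lborel. u y) / measure lborel (cball x r) \<le> u x"
    using assms r by (simp add: mean_value_on_def)
qed

end

section \<open>Minimum principle and Perron solutions\<close>

lemma le_Liminf_ereal_iff:
  "ereal c \<le> Liminf F (\<lambda>x. ereal (u x)) \<longleftrightarrow> (\<forall>t<c. \<forall>\<^sub>F x in F. t < u x)"
proof
  assume L: "ereal c \<le> Liminf F (\<lambda>x. ereal (u x))"
  show "\<forall>t<c. \<forall>\<^sub>F x in F. t < u x"
  proof (intro allI impI)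
    fix t assume "t < c"
    then have "ereal t < Liminf F (\<lambda>x. ereal (u x))" using L by (metis ereal_less_eq(3) less_ereal.simps(1) order_less_le_trans)
    from less_LiminfD[OF this] show "\<forall>\<^sub>F x in F. t < u x" by simp
  qed
next
  assume R: "\<forall>t<c. \<forall>\<^sub>F x in F. t < u x"
  show "ereal c \<le> Liminf F (\<lambda>x. ereal (u x))"
    unfolding le_Liminf_iff
  proof (intro allI impI)
    fix y :: ereal assume y: "y < ereal c"
    then obtain t where t: "y < ereal t" "ereal t < ereal c" using ereal_dense2 by blast
    then have "\<forall>\<^sub>F x in F. t < u x" using R by simp
    then show "\<forall>\<^sub>F x in F. y < ereal (u x)"
      by (rule eventually_mono) (use t(1) in \<open>auto intro: order.strict_trans\<close>)
  qed
qed

lemma upper_class_iff: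
  "u \<in> upper_class \<Omega> f \<longleftrightarrow> superharmonic_on u \<Omega> \<and> bdd_below (u ` \<Omega>) \<and>
     (\<forall>\<zeta>\<in>frontier \<Omega>. \<forall>t<f \<zeta>. \<forall>\<^sub>F x in at \<zeta> within \<Omega>. t < u x) \<and>
     (\<forall>t<0. \<forall>\<^sub>F x in inf at_infinity (principal \<Omega>). t < u x)"
  unfolding upper_class_def mem_Collect_eq le_Liminf_ereal_iff[symmetric] zero_ereal_def[symmetric] by simp

lemma upper_class_mono:
  assumes "u \<in> upper_class \<Omega> f" "\<And>x. g x \<le> f x"
  shows "u \<in> upper_class \<Omega> g"
  using assms unfolding upper_class_iff by (meson order_less_le_trans)

lemma superharmonic_on_add:
  assumes u: "superharmonic_on u \<Omega>" and v: "superharmonic_on v \<Omega>"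
  shows "superharmonic_on (\<lambda>x. u x + v x) \<Omega>"
  unfolding superharmonic_on_def
proof (intro conjI ballI allI impI)
  fix x c assume x: "x \<in> \<Omega>" and c: "c < u x + v x"
  define e where "e = (u x + v x - c) / 2"
  have e: "e > 0" using c by (simp add: e_def)
  have "\<forall>\<^sub>F y in at x within \<Omega>. u x - e < u y" "\<forall>\<^sub>F y in at x within \<Omega>. v x - e < v y"
    using u v x e unfolding superharmonic_on_def by auto
  then show "\<forall>\<^sub>F y in at x within \<Omega>. c < u y + v y"
    by eventually_elim (simp add: e_def field_simps)
next
  fix x r assume r: "0 < r \<and> cball x r \<subseteq> \<Omega>"
  have U: "set_integrable lborel (cball x r) u" "(LINT y:cball x r|lborel. u y) / measure lborel (cball x r) \<le> u x"
   and V: "set_integrable lborel (cball x r) v" "(LINT y:cball x r|lborel. v y) / measure lborel (cball x r) \<le> v x"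
    using u v r unfolding superharmonic_on_def by blast+
  show "set_integrable lborel (cball x r) (\<lambda>x. u x + v x)" using U(1) V(1) by (rule set_integral_add)
  show "(LINT y:cball x r|lborel. u y + v y) / measure lborel (cball x r) \<le> u x + v x"
    using U V by (simp add: set_integral_add add_divide_distrib)
qed

lemma superharmonic_on_zero: "superharmonic_on (\<lambda>_. 0) \<Omega>"
  unfolding superharmonic_on_def by (auto simp: set_integrable_def set_lebesgue_integral_def)

text \<open>A negative infimum \<open>m\<close> is attained, because the boundary conditions make the sublevel sets compact in
  \<open>\<Omega>\<close>. Among the minimisers choose the one farthest in some direction \<open>e\<close>. By the mean value inequality the
  function equals \<open>m\<close> almost everywhere in a ball about it, hence also at points farther out.\<close>
lemma minimum_principle:
  fixes w :: "'a::euclidean_space \<Rightarrow> real"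
  assumes op: "open \<Omega>" and w: "w \<in> upper_class \<Omega> (\<lambda>_. 0)" and p: "p \<in> \<Omega>"
  shows "0 \<le> w p"
proof (rule ccontr)
  assume neg: "\<not> 0 \<le> w p"
  have sh: "superharmonic_on w \<Omega>" and bd: "bdd_below (w ` \<Omega>)"
    and fr: "\<And>\<zeta> t. \<zeta> \<in> frontier \<Omega> \<Longrightarrow> t < 0 \<Longrightarrow> \<forall>\<^sub>F x in at \<zeta> within \<Omega>. t < w x"
    and inf: "\<And>t. t < 0 \<Longrightarrow> \<forall>\<^sub>F x in inf at_infinity (principal \<Omega>). t < w x"
    using w unfolding upper_class_iff by auto
  define m where "m = Inf (w ` \<Omega>)"
  have mle: "m \<le> w x" if "x \<in> \<Omega>" for x using bd that by (simp add: m_def cInf_lower)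
  have m0: "m < 0" using mle[OF p] neg by simp
  define S where "S t = {x \<in> \<Omega>. w x \<le> t}" for t
  have comp: "compact (S t)" if t: "t < 0" for t
  proof -
    have cl: "closure (S t) \<subseteq> S t"
    proof
      fix z assume z: "z \<in> closure (S t)"
      have near: "\<exists>x\<in>S t. dist x z < e" if "e > 0" for e using z that by (simp add: closure_approachable)
      have contra: False if ev: "\<forall>\<^sub>F x in at z within \<Omega>. t < w x" and nS: "z \<notin> S t"
      proof -
        obtain d where d: "d > 0" "\<And>x. x \<in> \<Omega> \<Longrightarrow> x \<noteq> z \<Longrightarrow> dist x z < d \<Longrightarrow> t < w x"
          using ev unfolding eventually_at by blast
        obtain x where "x \<in> S t" "dist x z < d" using near[OF d(1)] by blast
        then show False using d(2)[of x] nS by (auto simp: S_def)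
      qed
      have z\<Omega>: "z \<in> \<Omega>"
      proof (rule ccontr)
        assume "z \<notin> \<Omega>"
        moreover have "z \<in> closure \<Omega>" using z closure_mono[of "S t" \<Omega>] by (auto simp: S_def)
        ultimately have "z \<in> frontier \<Omega>" using op by (simp add: frontier_def interior_open)
        from contra[OF fr[OF this t]] \<open>z \<notin> \<Omega>\<close> show False by (simp add: S_def)
      qed
      show "z \<in> S t"
      proof (rule ccontr)
        assume zS: "z \<notin> S t"
        then have "t < w z" using z\<Omega> by (simp add: S_def)
        then have "\<forall>\<^sub>F x in at z within \<Omega>. t < w x" using sh z\<Omega> unfolding superharmonic_on_def by blast
        from contra[OF this zS] show False .
      qed
    qed
    then have "closed (S t)" using closure_subset_eq by blast
    moreover have "bounded (S t)"
    proof -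
      obtain R where R: "\<And>x. R \<le> norm x \<Longrightarrow> x \<in> \<Omega> \<Longrightarrow> t < w x"
        using inf[OF t] unfolding eventually_inf_principal eventually_at_infinity by blast
      have "norm x \<le> R" if "x \<in> S t" for x
      proof (rule ccontr)
        assume "\<not> norm x \<le> R"
        then show False using R[of x] that by (simp add: S_def)
      qed
      then show ?thesis unfolding bounded_iff by blast
    qed
    ultimately show ?thesis by (simp add: compact_eq_bounded_closed)
  qed
  \<comment> \<open>Sublevel sets shrinking to level \<open>m\<close>; their levels stay negative, so they are compact.\<close>
  define F where "F n = S (m + (- m / 2) / real (Suc n))" for n
  have lt0: "m + (- m / 2) / real (Suc n) < 0" for n
  proof -
    have "(- m / 2) / real (Suc n) \<le> (- m / 2) / 1" using m0 by (intro divide_left_mono) auto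
    then show ?thesis using m0 by linarith
  qed
  have "\<Inter> (range F) \<noteq> {}"
  proof (rule compact_nest)
    show "compact (F n)" for n unfolding F_def by (rule comp[OF lt0])
    show "F n \<noteq> {}" for n
    proof -
      have "m < m + (- m / 2) / real (Suc n)" using m0 by (simp add: divide_neg_pos)
      then obtain y where "y \<in> w ` \<Omega>" "y < m + (- m / 2) / real (Suc n)"
        using cInf_lessD[of "w ` \<Omega>"] p unfolding m_def by blast
      then show ?thesis unfolding F_def S_def by (auto intro: less_imp_le)
    qed
    show "F n \<subseteq> F k" if "k \<le> n" for k n
    proof -
      have "(- m / 2) / real (Suc n) \<le> (- m / 2) / real (Suc k)" using m0 that by (intro divide_left_mono) auto
      then show ?thesis by (auto simp: F_def S_def)
    qed
  qed
  then obtain x0 where x0: "\<And>n. x0 \<in> F n" by blast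
  have "w x0 \<le> m"
  proof (rule field_le_epsilon)
    fix e :: real assume e: "e > 0"
    obtain n where "(- m / 2) / e < real n" using reals_Archimedean2 by blast
    then have "(- m / 2) / e \<le> real (Suc n)" by simp
    then have "(- m / 2) / real (Suc n) \<le> e" using e by (simp add: field_simps)
    then show "w x0 \<le> m + e" using x0[of n] by (simp add: F_def S_def)
  qed
  then have "x0 \<in> S m" using x0[of 0] by (simp add: F_def S_def)
  then have ne: "S m \<noteq> {}" by blast
  obtain e :: 'a where e: "e \<in> Basis" using nonempty_Basis by blast
  have "continuous_on (S m) (\<lambda>x. x \<bullet> e)" by (intro continuous_intros)
  from continuous_attains_sup[OF comp[OF m0] ne this]
  obtain x where x: "x \<in> S m" "\<And>y. y \<in> S m \<Longrightarrow> y \<bullet> e \<le> x \<bullet> e" by blast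
  have x\<Omega>: "x \<in> \<Omega>" and wx: "w x = m" using x(1) mle by (auto simp: S_def intro: antisym)
  obtain r where r: "r > 0" "cball x r \<subseteq> \<Omega>" using op x\<Omega> open_contains_cball by blast
  have int: "set_integrable lborel (cball x r) w"
    and mean: "(LINT y:cball x r|lborel. w y) / measure lborel (cball x r) \<le> m"
    using sh r wx unfolding superharmonic_on_def by blast+
  have fin: "emeasure lborel (cball x r) < \<infinity>" by (rule emeasure_lborel_cball_finite)
  have intm: "set_integrable lborel (cball x r) (\<lambda>_. m)"
    unfolding set_integrable_def using fin by (intro integrable_scaleR_left integrable_real_indicator) auto
  have V: "0 < measure lborel (cball x r)" using r by (simp add: content_cball_pos)
  have "(LINT y:cball x r|lborel. m) = measure lborel (cball x r) * m"
    using has_bochner_integral_integral_eq[OF has_bochner_integral_indicator[of "cball x r" lborel m]] fin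
    by (simp add: set_lebesgue_integral_def)
  then have "(LINT y:cball x r|lborel. w y - m) \<le> 0"
    using mean V int intm by (simp add: set_integral_diff divide_le_eq mult.commute)
  moreover have nn: "0 \<le> indicator (cball x r) y *\<^sub>R (w y - m)" for y
    using mle r(2) by (cases "y \<in> cball x r") auto
  ultimately have "(LINT y|lborel. indicator (cball x r) y *\<^sub>R (w y - m)) = 0"
    unfolding set_lebesgue_integral_def using Bochner_Integration.integral_nonneg[OF nn] by (intro antisym) auto
  then have ae: "AE y in lborel. indicator (cball x r) y *\<^sub>R (w y - m) = 0"
    using integral_nonneg_eq_0_iff_AE[of lborel "\<lambda>y. indicator (cball x r) y *\<^sub>R (w y - m)"] nn
      set_integral_diff(1)[OF int intm] by (simp add: set_integrable_def)
  \<comment> \<open>The half of the ball about \<open>x\<close> on the side of \<open>e\<close> contains this ball.\<close>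
  define B where "B = ball (x + (r / 2) *\<^sub>R e) (r / 2)"
  have B: "y \<in> cball x r \<and> x \<bullet> e < y \<bullet> e" if y: "y \<in> B" for y
  proof
    have d: "norm (x + (r / 2) *\<^sub>R e - y) < r / 2" using y by (simp add: B_def dist_norm)
    have "norm (x - y) \<le> norm (x + (r / 2) *\<^sub>R e - y) + norm ((r / 2) *\<^sub>R e)"
      using norm_triangle_ineq4[of "x + (r / 2) *\<^sub>R e - y" "(r / 2) *\<^sub>R e"] by (simp add: algebra_simps)
    then show "y \<in> cball x r" using d r e by (simp add: dist_norm)
    have "\<bar>(x + (r / 2) *\<^sub>R e - y) \<bullet> e\<bar> < r / 2" using Basis_le_norm[OF e] d by (rule order.strict_trans1)
    then have "\<bar>x \<bullet> e + r / 2 - y \<bullet> e\<bar> < r / 2" using e by (simp add: algebra_simps inner_Basis)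
    then show "x \<bullet> e < y \<bullet> e" unfolding abs_less_iff by argo
  qed
  have "y \<notin> B" if "indicator (cball x r) y *\<^sub>R (w y - m) = 0" for y
  proof
    assume "y \<in> B"
    from B[OF this] have yc: "y \<in> cball x r" "x \<bullet> e < y \<bullet> e" by auto
    then have "w y = m" using that by simp
    then have "y \<in> S m" using yc(1) r(2) by (auto simp: S_def)
    from x(2)[OF this] yc(2) show False by simp
  qed
  then have "AE y in lborel. y \<notin> B" using ae by (auto elim: eventually_mono)
  then have "emeasure lborel {y \<in> space lborel. y \<in> B} = 0" by (rule emeasure_eq_0_AE)
  then have "measure lborel B = 0" by (simp add: measure_def)
  then show False using content_ball_pos[of "r / 2" "x + (r / 2) *\<^sub>R e"] r by (simp add: B_def)
qed

text \<open>The minimum principle makes the upper solution of the indicator nonnegative, and barriers make it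
  vanish. For the lower solution, a member \<open>v\<close> of the upper class of the negative indicator plus a barrier
  \<open>u\<close> belongs to the upper class of \<open>0\<close>, so that \<open>v p \<ge> - u p\<close>.\<close>
lemma harmonic_null_if_barriers:
  fixes \<Omega> :: "'a::euclidean_space set"
  assumes op: "open \<Omega>"
    and bar: "\<And>p \<epsilon>. p \<in> \<Omega> \<Longrightarrow> 0 < \<epsilon> \<Longrightarrow> \<exists>u\<in>upper_class \<Omega> (indicator E). u p < \<epsilon>"
  shows "harmonic_measurable \<Omega> E" "\<And>p. p \<in> \<Omega> \<Longrightarrow> harmonic_measure \<Omega> p E = 0"
proof -
  have up: "upper_perron \<Omega> (indicator E) p = 0" if p: "p \<in> \<Omega>" for p
  proof (rule antisym)
    show "0 \<le> upper_perron \<Omega> (indicator E) p"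
      unfolding upper_perron_def
    proof (rule INF_greatest)
      fix u assume "u \<in> upper_class \<Omega> (indicator E)"
      then have "u \<in> upper_class \<Omega> (\<lambda>_. 0)" by (rule upper_class_mono) simp
      from minimum_principle[OF op this p] show "0 \<le> ereal (u p)" by simp
    qed
    show "upper_perron \<Omega> (indicator E) p \<le> 0"
    proof (rule ereal_le_epsilon2)
      fix \<epsilon> :: real assume "0 < \<epsilon>"
      then obtain u where "u \<in> upper_class \<Omega> (indicator E)" "u p < \<epsilon>" using bar[OF p] by blast
      then show "upper_perron \<Omega> (indicator E) p \<le> 0 + ereal \<epsilon>"
        unfolding upper_perron_def by (intro INF_lower2[of u]) (auto intro: less_imp_le)
    qed
  qed
  have low: "upper_perron \<Omega> (\<lambda>x. - indicator E x) p = 0" if p: "p \<in> \<Omega>" for p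
  proof (rule antisym)
    have "(\<lambda>_. 0) \<in> upper_class \<Omega> (\<lambda>x. - indicator E x)"
      unfolding upper_class_iff using superharmonic_on_zero
      by (auto simp: indicator_def split: if_splits)
    then show "upper_perron \<Omega> (\<lambda>x. - indicator E x) p \<le> 0"
      unfolding upper_perron_def by (intro INF_lower2[of "\<lambda>_. 0"]) auto
    show "0 \<le> upper_perron \<Omega> (\<lambda>x. - indicator E x) p"
      unfolding upper_perron_def
    proof (rule INF_greatest)
      fix v assume v: "v \<in> upper_class \<Omega> (\<lambda>x. - indicator E x)"
      have "0 \<le> v p + \<epsilon>" if \<epsilon>: "0 < \<epsilon>" for \<epsilon>
      proof -
        obtain u where u: "u \<in> upper_class \<Omega> (indicator E)" "u p < \<epsilon>" using bar[OF p \<epsilon>] by blast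
        have "(\<lambda>x. v x + u x) \<in> upper_class \<Omega> (\<lambda>_. 0)"
          unfolding upper_class_iff
        proof (intro conjI ballI allI impI)
          show "superharmonic_on (\<lambda>x. v x + u x) \<Omega>"
            using u v by (intro superharmonic_on_add) (auto simp: upper_class_iff)
          obtain A B where "\<And>x. x \<in> \<Omega> \<Longrightarrow> A \<le> v x" "\<And>x. x \<in> \<Omega> \<Longrightarrow> B \<le> u x"
            using u(1) v unfolding upper_class_iff bdd_below_def by (metis imageI)
          then show "bdd_below ((\<lambda>x. v x + u x) ` \<Omega>)" by (intro bdd_belowI2[of _ "A + B"]) (simp add: add_mono)
        next
          fix \<zeta> t assume "\<zeta> \<in> frontier \<Omega>" "t < (0::real)"
          then have "\<forall>\<^sub>F x in at \<zeta> within \<Omega>. - indicator E \<zeta> + t / 2 < v x"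
            "\<forall>\<^sub>F x in at \<zeta> within \<Omega>. indicator E \<zeta> + t / 2 < u x"
            using u(1) v unfolding upper_class_iff by auto
          then show "\<forall>\<^sub>F x in at \<zeta> within \<Omega>. t < v x + u x" by eventually_elim simp
        next
          fix t :: real assume "t < 0"
          then have "t / 2 < 0" by simp
          then have "\<forall>\<^sub>F x in inf at_infinity (principal \<Omega>). t / 2 < v x"
            "\<forall>\<^sub>F x in inf at_infinity (principal \<Omega>). t / 2 < u x"
            using u(1) v unfolding upper_class_iff by blast+
          then show "\<forall>\<^sub>F x in inf at_infinity (principal \<Omega>). t < v x + u x" by eventually_elim simp
        qed
        from minimum_principle[OF op this p] show ?thesis using u(2) by simp
      qed
      then have "0 \<le> v p" by (rule field_le_epsilon)
      then show "0 \<le> ereal (v p)" by simp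
    qed
  qed
  show "harmonic_measurable \<Omega> E" using up low by (simp add: harmonic_measurable_def lower_perron_def)
  show "harmonic_measure \<Omega> p E = 0" if "p \<in> \<Omega>" for p using up[OF that] by (simp add: harmonic_measure_def)
qed

section \<open>The barrier\<close>

context two_axes begin

definition potential :: "nat \<Rightarrow> (real, 'n) vec \<Rightarrow> real" where
  "potential k z = green (2 ^ k * z $ a) (2 ^ k * z $ b)"

text \<open>Outside the obstacles the rescaled point keeps the distance \<open>1 / 8 / 2 ^ k\<close>, the relative half-side of the
  obstacles of generation \<open>k\<close>, from the poles.\<close>
lemma cos_sq_Dom:
  assumes z: "z \<in> Dom"
  shows "4 * (1 / 8 / 2 ^ k)\<^sup>2 \<le> cos_sq (3/2) (2 ^ k * z $ a) (2 ^ k * z $ b)"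
proof -
  define m where "m = \<lfloor>2 ^ k * z $ a\<rfloor>"
  have s: "side (int k) = 1 / 2 ^ k" by (rule side_nat)
  have scale: "\<bar>2 ^ k * u - v\<bar> = 2 ^ k * \<bar>u - v * side (int k)\<bar>" for u v :: real
  proof -
    have "2 ^ k * u - v = 2 ^ k * (u - v * side (int k))" by (simp add: s algebra_simps)
    then show ?thesis by (simp add: abs_mult)
  qed
  have "rad (int k) < offset (int k) m z" using z by (simp add: Dom_def)
  then have "2 ^ k * rad (int k) < 2 ^ k * offset (int k) m z" by simp
  also have "\<dots> = max \<bar>2 ^ k * z $ a - (real_of_int m + 1/2)\<bar> \<bar>2 ^ k * z $ b - 3/2\<bar>"
    unfolding offset_def scale by (simp add: max_mult_distrib_left)
  finally have "1 / 8 / 2 ^ k < max \<bar>2 ^ k * z $ a - (real_of_int m + 1/2)\<bar> \<bar>2 ^ k * z $ b - 3/2\<bar>"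
    by (simp add: rad_def s)
  moreover have "\<bar>2 ^ k * z $ a - (real_of_int m + 1/2)\<bar> \<le> 1/2"
    unfolding m_def by linarith
  ultimately show ?thesis by (intro cos_sq_ge) auto
qed

lemma cos_sq_Dom_pos:
  assumes "z \<in> Dom" shows "0 < cos_sq (3/2) (2 ^ k * z $ a) (2 ^ k * z $ b)"
proof -
  have "0 < 4 * (1 / 8 / 2 ^ k :: real)\<^sup>2" by simp
  then show ?thesis using cos_sq_Dom[OF assms, of k] by linarith
qed

lemma continuous_on_potential:
  assumes "\<And>z. z \<in> S \<Longrightarrow> 0 \<le> z $ b" "\<And>z. z \<in> S \<Longrightarrow> 0 < cos_sq (3/2) (2 ^ k * z $ a) (2 ^ k * z $ b)"
  shows "continuous_on S (potential k)"
proof -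
  have "continuous_on S (\<lambda>z. cos_sq \<sigma> (2 ^ k * z $ a) (2 ^ k * z $ b))" for \<sigma>
    unfolding cos_sq_def by (intro continuous_intros)
  moreover have "cos_sq (-3/2) (2 ^ k * z $ a) (2 ^ k * z $ b) \<noteq> 0" if "z \<in> S" for z
    using cos_sq_minus_pos[of "2 ^ k * z $ b" "2 ^ k * z $ a"] assms(1)[OF that] by simp
  moreover have "cos_sq (3/2) (2 ^ k * z $ a) (2 ^ k * z $ b) \<noteq> 0" if "z \<in> S" for z
    using assms(2)[OF that] by simp
  ultimately show ?thesis unfolding potential_def green_def by (intro continuous_intros) auto
qed

lemma norm_planar_eq: "norm (planar u v) = cmod (Complex u v)"
proof -
  have "planar u v \<bullet> planar u v = u\<^sup>2 + v\<^sup>2"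
    using ab by (simp add: planar_def inner_add_left inner_add_right inner_axis_axis power2_eq_square)
  then show ?thesis using norm_eq_sqrt_inner[of "planar u v"] by (simp add: cmod_def)
qed

lemma cmod_cos_cos_sq:
  "(cmod (cos (of_real pi * (2 ^ k * \<zeta> - \<i> * of_real \<sigma>))))\<^sup>2 = cos_sq \<sigma> (2 ^ k * Re \<zeta>) (2 ^ k * Im \<zeta>)"
proof -
  have p: "2 ^ k * \<zeta> = of_real (2 ^ k) * \<zeta>" by simp
  have "Re (of_real pi * (2 ^ k * \<zeta> - \<i> * of_real \<sigma>)) = pi * (2 ^ k * Re \<zeta>)"
       "Im (of_real pi * (2 ^ k * \<zeta> - \<i> * of_real \<sigma>)) = pi * (2 ^ k * Im \<zeta> - \<sigma>)"
    unfolding p by simp_all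
  then show ?thesis
    by (simp add: norm_cos_squared cos_sq_def sinh_field_def exp_minus power_divide)
qed

text \<open>On the projection of a ball in the domain the quotient of the two cosines is holomorphic without
  zeros; it has a holomorphic logarithm there, and the potential is the real part of that logarithm.\<close>
lemma mean_value_potential: "mean_value_on (potential k) Dom"
  unfolding mean_value_on_def
proof (intro conjI allI impI)
  show "continuous_on Dom (potential k)"
    by (rule continuous_on_potential) (auto simp: cos_sq_Dom_pos Dom_def intro: less_imp_le)
  fix x r assume r: "0 < r \<and> cball x r \<subseteq> Dom"
  obtain e where e: "e > 0" "(\<Union>y\<in>cball x r. ball y e) \<subseteq> Dom"
    using compact_subset_open_imp_ball_epsilon_subset[of "cball x r" Dom] r open_Dom by auto
  define R where "R = r + e"
  \<comment> \<open>The projection of the ball has a neighbourhood in the projection of the domain.\<close>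
  have lift: "\<exists>z\<in>Dom. proj z = \<zeta>" if \<zeta>: "\<zeta> \<in> ball (proj x) R" for \<zeta>
  proof -
    define v where "v = planar (Re (\<zeta> - proj x)) (Im (\<zeta> - proj x))"
    have nv: "norm v < R" 
      using \<zeta> unfolding v_def norm_planar_eq complex_surj by (simp add: dist_norm norm_minus_commute)
    have "proj (x + v) = \<zeta>" unfolding proj_add v_def proj_planar complex_surj by simp
    moreover have "x + v \<in> (\<Union>y\<in>cball x r. ball y e)"
    proof (cases "norm v \<le> r")
      case True
      then show ?thesis using e(1) by (intro UN_I[of "x + v"]) (auto simp: dist_norm)
    next
      case False
      define y where "y = x + (r / norm v) *\<^sub>R v"
      have v0: "norm v > 0" using False r by auto
      have "dist x y = r" using r v0 by (simp add: y_def dist_norm)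
      moreover have "dist y (x + v) < e"
      proof -
        have "y - (x + v) = (r / norm v - 1) *\<^sub>R v" by (simp add: y_def algebra_simps)
        then have "dist y (x + v) = \<bar>r / norm v - 1\<bar> * norm v" by (simp add: dist_norm)
        also have "\<dots> = norm v - r"
        proof -
          have "r / norm v \<le> 1" using False v0 by simp
          then have eq: "\<bar>r / norm v - 1\<bar> = 1 - r / norm v" by simp
          show ?thesis unfolding eq using v0 by (simp add: left_diff_distrib)
        qed
        finally show ?thesis using nv by (simp add: R_def)
      qed
      ultimately show ?thesis by (intro UN_I[of y]) auto
    qed
    ultimately show ?thesis using e(2) by blast
  qed
  define f where "f \<sigma> \<zeta> = cos (of_real pi * (2 ^ k * \<zeta> - \<i> * of_real \<sigma>))" for \<sigma> and \<zeta> :: complex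
  have f2: "(cmod (f \<sigma> (proj z)))\<^sup>2 = cos_sq \<sigma> (2 ^ k * z $ a) (2 ^ k * z $ b)" for z \<sigma>
    using cmod_cos_cos_sq[of k "proj z" \<sigma>] by (simp add: f_def proj_def)
  have nz: "f (3/2) \<zeta> \<noteq> 0" "f (-3/2) \<zeta> \<noteq> 0" if \<zeta>: "\<zeta> \<in> ball (proj x) R" for \<zeta>
  proof -
    obtain z where z: "z \<in> Dom" "proj z = \<zeta>" using lift[OF \<zeta>] by blast
    show "f (3/2) \<zeta> \<noteq> 0" using f2[of "3/2" z] cos_sq_Dom_pos[OF z(1), of k] z(2) by auto
    have "0 \<le> 2 ^ k * z $ b" using z(1) by (simp add: Dom_def)
    then show "f (-3/2) \<zeta> \<noteq> 0"
      using f2[of "-3/2" z] cos_sq_minus_pos[of "2 ^ k * z $ b" "2 ^ k * z $ a"] z(2) by auto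
  qed
  have hol: "(\<lambda>\<zeta>. f (-3/2) \<zeta> / f (3/2) \<zeta>) holomorphic_on ball (proj x) R"
    using nz(1) unfolding f_def by (intro holomorphic_intros) auto
  have "\<exists>h. h holomorphic_on ball (proj x) R \<and> (\<forall>\<zeta>\<in>ball (proj x) R. f (-3/2) \<zeta> / f (3/2) \<zeta> = exp (h \<zeta>))"
  proof (rule contractible_imp_holomorphic_log[OF hol convex_imp_contractible[OF convex_ball]])
    show "f (-3/2) \<zeta> / f (3/2) \<zeta> \<noteq> 0" if "\<zeta> \<in> ball (proj x) R" for \<zeta>
      using nz[OF that] by simp
  qed blast
  then obtain h where h: "h holomorphic_on ball (proj x) R"
      "\<And>\<zeta>. \<zeta> \<in> ball (proj x) R \<Longrightarrow> f (-3/2) \<zeta> / f (3/2) \<zeta> = exp (h \<zeta>)"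
    by blast
  have potential_h: "potential k z = Re (h (proj z))" if z: "z \<in> cball x r" for z
  proof -
    have zR: "proj z \<in> ball (proj x) R"
      using norm_proj_le[of "x - z"] z e(1) by (simp add: dist_norm proj_diff R_def)
    have pos: "0 < cmod (f (3/2) (proj z))" "0 < cmod (f (-3/2) (proj z))" using nz[OF zR] by auto
    have "exp (Re (h (proj z))) = cmod (f (-3/2) (proj z)) / cmod (f (3/2) (proj z))"
      using h(2)[OF zR] by (metis norm_divide norm_exp_eq_Re)
    then have "Re (h (proj z)) = ln (cmod (f (-3/2) (proj z)) / cmod (f (3/2) (proj z)))"
      by (metis ln_exp)
    also have "\<dots> = ln (cmod (f (-3/2) (proj z))) - ln (cmod (f (3/2) (proj z)))"
      using pos by (simp add: ln_div)
    finally have R1: "Re (h (proj z)) = ln (cmod (f (-3/2) (proj z))) - ln (cmod (f (3/2) (proj z)))" .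
    have "potential k z = (ln ((cmod (f (-3/2) (proj z)))\<^sup>2) - ln ((cmod (f (3/2) (proj z)))\<^sup>2)) / 2"
      unfolding potential_def green_def f2 ..
    then show ?thesis using pos R1 by (simp add: ln_realpow)
  qed
  have "(LINT y:cball x r|lborel. potential k y) = (LINT y:cball x r|lborel. Re (h (proj y)))"
    by (rule set_lebesgue_integral_cong) (auto simp: potential_h)
  also have "\<dots> = measure lborel (cball x r) * Re (h (proj x))"
    by (rule integral_holomorphic_ball[OF h(1)]) (use r e in \<open>auto simp: R_def\<close>)
  finally show "(LINT y:cball x r|lborel. potential k y) = measure lborel (cball x r) * potential k x"
    using potential_h[of x] r by simp
qed

end

lemma sum_two_sided_geometric: "(\<Sum>k\<in>{1..N}. (1/2::real) ^ nat \<bar>int k - j\<bar>) \<le> 4"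
proof -
  have half: "(\<Sum>k\<in>A. (1/2::real) ^ g k) \<le> 2" if "finite A" "inj_on g A" for A :: "nat set" and g :: "nat \<Rightarrow> nat"
  proof -
    have "(\<Sum>k\<in>A. (1/2::real) ^ g k) = (\<Sum>i\<in>g ` A. (1/2) ^ i)" using that by (simp add: sum.reindex)
    also have "\<dots> \<le> (\<Sum>i. (1/2) ^ i)" using that by (intro sum_le_suminf) (auto simp: summable_geometric)
    also have "\<dots> = 2" by (simp add: suminf_geometric)
    finally show ?thesis .
  qed
  let ?A = "{k\<in>{1..N}. int k \<le> j}" and ?B = "{k\<in>{1..N}. j < int k}"
  have "{1..N} = ?A \<union> ?B" by auto
  then have "(\<Sum>k\<in>{1..N}. (1/2::real) ^ nat \<bar>int k - j\<bar>) = (\<Sum>k\<in>?A. (1/2::real) ^ nat \<bar>int k - j\<bar>) + (\<Sum>k\<in>?B. (1/2::real) ^ nat \<bar>int k - j\<bar>)"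
    by (metis (no_types, lifting) sum.union_disjoint[of ?A ?B] disjoint_iff finite_atLeastAtMost finite_Collect_conjI finite_Un mem_Collect_eq not_le)
  also have "\<dots> \<le> 2 + 2" by (intro add_mono half) (auto intro!: inj_onI)
  finally show ?thesis by simp
qed

context two_axes begin

lemma scaled_height:
  assumes t: "side j \<le> t" "t < 2 * side j"
  shows "int k < j \<Longrightarrow> 2 ^ k * t \<le> 2 * (1/2) ^ nat \<bar>int k - j\<bar>"
    and "j < int k \<Longrightarrow> 2 ^ nat \<bar>int k - j\<bar> \<le> 2 ^ k * t"
    and "int k = j \<Longrightarrow> 1 \<le> 2 ^ k * t \<and> 2 ^ k * t \<le> 2"
proof -
  define n where "n = nat \<bar>int k - j\<bar>"
  show "2 ^ k * t \<le> 2 * (1/2) ^ nat \<bar>int k - j\<bar>" if "int k < j"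
  proof -
    have "j = int k + int n" using that by (simp add: n_def)
    then have "side j = 1 / 2 ^ k / 2 ^ n" using side_add[of "int k" n] by (simp add: side_nat)
    then have "2 ^ k * side j = (1/2) ^ n" by (simp add: power_one_over)
    then have "2 ^ k * (2 * side j) = 2 * (1/2) ^ n" by (simp only: mult.left_commute)
    moreover have "2 ^ k * t \<le> 2 ^ k * (2 * side j)" using t by (intro mult_left_mono) auto
    ultimately show ?thesis by (simp only: n_def)
  qed
  show "2 ^ nat \<bar>int k - j\<bar> \<le> 2 ^ k * t" if "j < int k"
  proof -
    have "int k = j + int n" using that by (simp add: n_def)
    then have "1 / 2 ^ k = side j / 2 ^ n" using side_add[of j n] side_nat[of k] by simp
    then have "2 ^ k * side j = 2 ^ n" by (simp add: field_simps)
    moreover have "2 ^ k * side j \<le> 2 ^ k * t" using t by (intro mult_left_mono) auto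
    ultimately show ?thesis by (simp add: n_def)
  qed
  show "1 \<le> 2 ^ k * t \<and> 2 ^ k * t \<le> 2" if "int k = j"
  proof -
    have one: "2 ^ k * side j = 1" using side_nat[of k] that by simp
    then have two: "2 ^ k * (2 * side j) = 2" by (simp only: mult.left_commute mult_1_right)
    have "2 ^ k * side j \<le> 2 ^ k * t" "2 ^ k * t \<le> 2 ^ k * (2 * side j)"
      using t by (intro mult_left_mono; simp)+
    then show ?thesis unfolding one two by simp
  qed
qed

text \<open>Let \<open>z\<close> belong to generation \<open>j\<close>. Generations \<open>k > j\<close> lie below \<open>z\<close> and contribute \<open>3 pi\<close> each; generations
  \<open>k < j\<close> lie above and contribute nothing; both up to geometrically decaying errors. Generation \<open>j\<close> itself
  contributes at most the logarithm of the relative size of its obstacles, in absolute value, that is \<open>j * ln 2\<close> up to a constant,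
  which is no more than the \<open>3 pi j\<close> that generations \<open>1\<close> to \<open>j\<close> have left unused. This is where it matters
  that the obstacles do not shrink too fast.\<close>
lemma sum_potential_le:
  "\<exists>Q>0. \<forall>z\<in>Dom. \<forall>N. (\<Sum>k\<in>{1..N}. potential k z) \<le> 3 * pi * real N + Q"
proof -
  obtain C1 where C1: "C1 \<ge> 0" "\<And>X t. 0 \<le> t \<Longrightarrow> t \<le> 1 \<Longrightarrow> green X t \<le> C1 * t"
    using green_le_low by blast
  obtain C2 where C2: "C2 \<ge> 0" "\<And>X t. 2 \<le> t \<Longrightarrow> \<bar>green X t - 3 * pi\<bar> \<le> C2 / t"
    using green_high by blast
  obtain C3 where C3: "C3 \<ge> 0" "\<And>X t \<epsilon>. 1 \<le> t \<Longrightarrow> t \<le> 2 \<Longrightarrow> 0 < \<epsilon> \<Longrightarrow> 4 * \<epsilon>\<^sup>2 \<le> cos_sq (3/2) X t \<Longrightarrow> green X t \<le> C3 - ln (2 * \<epsilon>)"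
    using green_le_mid by blast
  define C where "C = 2 * C1 + C2"
  define D where "D = C3 + ln 4"
  have D: "D \<ge> 0" using C3(1) by (simp add: D_def)
  have "(\<Sum>k\<in>{1..N}. potential k z) \<le> 3 * pi * real N + (4 * C + D)" if z: "z \<in> Dom" for z N
  proof -
    have zb: "0 < z $ b" using z by (simp add: Dom_def)
    obtain j where j: "side j \<le> z $ b" "z $ b < 2 * side j" using side_slab[OF zb] by blast
    \<comment> \<open>The main term of generation \<open>k\<close>.\<close>
    define \<beta> where "\<beta> k = (if j < int k then 3 * pi else if int k = j then 3 * pi * real k + D else 0)" for k
    have tm: "potential k z \<le> C * (1/2) ^ nat \<bar>int k - j\<bar> + \<beta> k" for k
    proof -
      let ?n = "nat \<bar>int k - j\<bar>"
      consider "int k < j" | "j < int k" | "int k = j" by linarith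
      then show ?thesis
      proof cases
        case 1
        have t: "2 ^ k * z $ b \<le> 2 * (1/2) ^ ?n" using scaled_height(1)[OF j 1] .
        have "(1/2::real) ^ ?n \<le> (1/2) ^ 1" using 1 by (intro power_decreasing) auto
        then have "2 ^ k * z $ b \<le> 1" using t by simp
        then have "potential k z \<le> C1 * (2 ^ k * z $ b)" unfolding potential_def using zb by (intro C1(2)) auto
        also have "\<dots> \<le> C1 * (2 * (1/2) ^ ?n)" using t C1(1) by (intro mult_left_mono) auto
        also have "\<dots> \<le> C * (1/2) ^ ?n" unfolding C_def using C2(1) by (simp add: distrib_right)
        finally show ?thesis using 1 by (simp add: \<beta>_def)
      next
        case 2
        have t: "2 ^ ?n \<le> 2 ^ k * z $ b" using scaled_height(2)[OF j 2] .
        have "(2::real) ^ 1 \<le> 2 ^ ?n" using 2 by (intro power_increasing) auto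
        then have "2 \<le> 2 ^ k * z $ b" using t by simp
        then have "potential k z \<le> 3 * pi + C2 / (2 ^ k * z $ b)"
          unfolding potential_def using C2(2)[of "2 ^ k * z $ b" "2 ^ k * z $ a"] by (simp add: abs_le_iff)
        also have "C2 / (2 ^ k * z $ b) \<le> C2 / 2 ^ ?n" using t C2(1) zb by (intro divide_left_mono) auto
        also have "C2 / 2 ^ ?n = C2 * (1/2) ^ ?n" by (simp add: power_one_over)
        also have "\<dots> \<le> C * (1/2) ^ ?n"
          using C1(1) by (intro mult_right_mono) (auto simp: C_def)
        finally show ?thesis using 2 by (simp add: \<beta>_def)
      next
        case 3
        have p1: "potential k z \<le> C3 - ln (2 * (1 / 8 / 2 ^ k))"
          unfolding potential_def using scaled_height(3)[OF j 3] cos_sq_Dom[OF z, of k] by (intro C3(2)) auto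
        have p2: "- ln (2 * (1 / 8 / 2 ^ k)) = ln (4 * 2 ^ k :: real)"
          by (subst ln_inverse[symmetric]) (auto simp: field_simps)
        have p3: "ln (4 * 2 ^ k :: real) = ln 4 + real k * ln 2" by (simp add: ln_mult ln_realpow)
        have p4: "real k * ln 2 \<le> real k * (3 * pi)"
          using ln_2_less_1 pi_gt3 by (intro mult_left_mono) auto
        have "\<beta> k = real k * (3 * pi) + (C3 + ln 4)" using 3 by (simp add: \<beta>_def D_def mult_ac)
        then have "potential k z \<le> \<beta> k" using p1 p2 p3 p4 by argo
        moreover have "0 \<le> C * (1/2) ^ ?n" using C1(1) C2(1) by (simp add: C_def)
        ultimately show ?thesis by simp
      qed
    qed
    \<comment> \<open>The sum is \<open>0\<close> until generation \<open>j\<close> pays for all its predecessors at once.\<close>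
    have b: "(\<Sum>k\<in>{1..N}. \<beta> k) \<le> (if int N < j then 0 else 3 * pi * real N + D)"
    proof (induction N)
      case (Suc N)
      consider "int (Suc N) < j" | "int (Suc N) = j" | "j < int (Suc N)" by linarith
      then show ?case
        by cases (use Suc D in \<open>auto simp: \<beta>_def algebra_simps split: if_splits\<close>)
    qed (use D in auto)
    also have "\<dots> \<le> 3 * pi * real N + D" using D by simp
    finally have b': "(\<Sum>k\<in>{1..N}. \<beta> k) \<le> 3 * pi * real N + D" .
    have "(\<Sum>k\<in>{1..N}. potential k z) \<le> (\<Sum>k\<in>{1..N}. C * (1/2) ^ nat \<bar>int k - j\<bar> + \<beta> k)"
      by (intro sum_mono tm)
    also have "\<dots> = C * (\<Sum>k\<in>{1..N}. (1/2) ^ nat \<bar>int k - j\<bar>) + (\<Sum>k\<in>{1..N}. \<beta> k)"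
      by (simp add: sum.distrib sum_distrib_left)
    also have "\<dots> \<le> C * 4 + (3 * pi * real N + D)"
      using b' sum_two_sided_geometric C1(1) C2(1) by (intro add_mono mult_left_mono) (auto simp: C_def)
    finally show ?thesis by simp
  qed
  moreover have "0 < 4 * C + D + 1" using D C1(1) C2(1) by (simp add: C_def)
  ultimately show ?thesis by (intro exI[of _ "4 * C + D + 1"]) (fastforce intro: order_trans)
qed

text \<open>All generations from some index on lie below the point \<open>p\<close>.\<close>
lemma sum_potential_ge:
  assumes p: "p \<in> Dom"
  shows "\<exists>K. \<forall>N. 3 * pi * real N - K \<le> (\<Sum>k\<in>{1..N}. potential k p)"
proof -
  obtain C2 where C2: "C2 \<ge> 0" "\<And>X t. 2 \<le> t \<Longrightarrow> \<bar>green X t - 3 * pi\<bar> \<le> C2 / t"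
    using green_high by blast
  have pb: "0 < p $ b" using p by (simp add: Dom_def)
  obtain j where j: "side j \<le> p $ b" "p $ b < 2 * side j" using side_slab[OF pb] by blast
  define \<beta> where "\<beta> k = (if j < int k then 3 * pi else 0)" for k
  have tm: "\<beta> k - C2 * (1/2) ^ nat \<bar>int k - j\<bar> \<le> potential k p" for k
  proof (cases "j < int k")
    case True
    let ?n = "nat \<bar>int k - j\<bar>"
    have t: "2 ^ ?n \<le> 2 ^ k * p $ b" using scaled_height(2)[OF j True] .
    have "(2::real) ^ 1 \<le> 2 ^ ?n" using True by (intro power_increasing) auto
    then have "2 \<le> 2 ^ k * p $ b" using t by simp
    then have "3 * pi - C2 / (2 ^ k * p $ b) \<le> potential k p"
      unfolding potential_def using C2(2)[of "2 ^ k * p $ b" "2 ^ k * p $ a"] by (simp add: abs_le_iff)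
    moreover have "C2 / (2 ^ k * p $ b) \<le> C2 / 2 ^ ?n" using t C2(1) pb by (intro divide_left_mono) auto
    moreover have "C2 / 2 ^ ?n = C2 * (1/2) ^ ?n" by (simp add: power_one_over)
    ultimately show ?thesis using True by (simp add: \<beta>_def)
  next
    case False
    have "0 \<le> potential k p" unfolding potential_def using cos_sq_Dom_pos[OF p] pb by (intro green_nonneg) auto
    moreover have "0 \<le> C2 * (1/2) ^ nat \<bar>int k - j\<bar>" using C2(1) by simp
    moreover have "\<beta> k = 0" using False by (simp add: \<beta>_def)
    ultimately show ?thesis by linarith
  qed
  have b: "3 * pi * real N - 3 * pi * \<bar>real_of_int j\<bar> \<le> (\<Sum>k\<in>{1..N}. \<beta> k)" for N
  proof (induction N)
    case (Suc N)
    show ?case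
    proof (cases "j < int (Suc N)")
      case True
      then show ?thesis using Suc by (simp add: \<beta>_def algebra_simps)
    next
      case False
      then have "real (Suc N) \<le> \<bar>real_of_int j\<bar>" by linarith
      then have "3 * pi * real (Suc N) \<le> 3 * pi * \<bar>real_of_int j\<bar>" by (intro mult_left_mono) auto
      moreover have "0 \<le> (\<Sum>k\<in>{1..Suc N}. \<beta> k)" by (intro sum_nonneg) (simp add: \<beta>_def)
      ultimately show ?thesis by linarith
    qed
  qed simp
  have "3 * pi * real N - (3 * pi * \<bar>real_of_int j\<bar> + C2 * 4) \<le> (\<Sum>k\<in>{1..N}. potential k p)" for N
  proof -
    have "C2 * (\<Sum>k\<in>{1..N}. (1/2) ^ nat \<bar>int k - j\<bar>) \<le> C2 * 4"
      using C2(1) by (intro mult_left_mono sum_two_sided_geometric)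
    then have "3 * pi * real N - (3 * pi * \<bar>real_of_int j\<bar> + C2 * 4)
        \<le> (\<Sum>k\<in>{1..N}. \<beta> k) - C2 * (\<Sum>k\<in>{1..N}. (1/2) ^ nat \<bar>int k - j\<bar>)"
      using b[of N] by linarith
    also have "\<dots> = (\<Sum>k\<in>{1..N}. \<beta> k - C2 * (1/2) ^ nat \<bar>int k - j\<bar>)"
      by (simp add: sum_subtractf sum_distrib_left)
    also have "\<dots> \<le> (\<Sum>k\<in>{1..N}. potential k p)" by (intro sum_mono tm)
    finally show ?thesis .
  qed
  then show ?thesis by blast
qed

text \<open>The potentials of generations \<open>1\<close> to \<open>N\<close>, normalised by their common upper bound, vanish on the hyperplane
  and are at most \<open>1\<close> everywhere in the domain; at a fixed point they tend to \<open>1\<close> with \<open>N\<close>.\<close>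
lemma barrier:
  assumes p: "p \<in> Dom" and \<epsilon>: "0 < \<epsilon>"
  shows "\<exists>u\<in>upper_class Dom (indicator {z. z $ b = 0}). u p < \<epsilon>"
proof -
  obtain Q where Q: "Q > 0" "\<And>z N. z \<in> Dom \<Longrightarrow> (\<Sum>k\<in>{1..N}. potential k z) \<le> 3 * pi * real N + Q"
    using sum_potential_le by blast
  obtain K where K: "\<And>N. 3 * pi * real N - K \<le> (\<Sum>k\<in>{1..N}. potential k p)" using sum_potential_ge[OF p] by blast
  obtain N :: nat where N: "(\<bar>Q + K\<bar> + 1) / \<epsilon> < real N" using reals_Archimedean2 by blast
  define M where "M = 3 * pi * real N + Q"
  have M: "M > 0" using Q(1) by (simp add: M_def add_nonneg_pos)
  define u where "u z = 1 + (- 1 / M) * (\<Sum>k\<in>{1..N}. potential k z)" for z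
  have u0: "0 \<le> u z" if "z \<in> Dom" for z
    using Q(2)[OF that, of N] M by (simp add: u_def M_def[symmetric] divide_le_eq)
  have up: "u p < \<epsilon>"
  proof -
    have "real N \<le> 3 * pi * real N" using pi_gt3 mult_right_mono[of 1 "3 * pi" "real N"] by simp
    then have "real N \<le> M" using Q(1) by (simp add: M_def)
    then have "(\<bar>Q + K\<bar> + 1) / \<epsilon> < M" using N by linarith
    then have "\<bar>Q + K\<bar> + 1 < \<epsilon> * M" using \<epsilon> by (simp add: divide_less_eq mult.commute)
    then have "M - (\<Sum>k\<in>{1..N}. potential k p) < \<epsilon> * M" using K[of N] unfolding M_def by linarith
    moreover have "u p = (M - (\<Sum>k\<in>{1..N}. potential k p)) / M" using M by (simp add: u_def field_simps)
    ultimately show ?thesis using M by (simp add: divide_less_eq)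
  qed
  have "mean_value_on u Dom"
    unfolding u_def by (intro mean_value_on_add mean_value_on_const mean_value_on_cmult mean_value_on_sum mean_value_potential)
  then have "superharmonic_on u Dom" using open_Dom by (rule mean_value_imp_superharmonic)
  moreover have "bdd_below (u ` Dom)" using u0 by (intro bdd_belowI2[of _ 0]) auto
  moreover have "\<forall>\<^sub>F x in at \<zeta> within Dom. t < u x"
    if \<zeta>: "\<zeta> \<in> frontier Dom" and t: "t < indicator {z. z $ b = 0} \<zeta>" for \<zeta> t
  proof (cases "\<zeta> $ b = 0")
    case True
    have "0 < cos_sq (3/2) X 0" for X
      unfolding cos_sq_def by (intro add_nonneg_pos) auto
    then have "continuous_on (insert \<zeta> Dom) (potential k)" for k
      using True cos_sq_Dom_pos by (intro continuous_on_potential) (auto simp: Dom_def intro: less_imp_le)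
    then have "continuous_on (insert \<zeta> Dom) u"
      unfolding u_def by (intro continuous_intros)
    then have "(u \<longlongrightarrow> u \<zeta>) (at \<zeta> within insert \<zeta> Dom)" by (simp add: continuous_on_def)
    then have "(u \<longlongrightarrow> u \<zeta>) (at \<zeta> within Dom)" by (rule tendsto_within_subset) auto
    moreover have "u \<zeta> = 1" using True by (simp add: u_def potential_def green_zero)
    ultimately show ?thesis using t True by (intro order_tendstoD) auto
  next
    case False
    then have "t < 0" using t by simp
    have "\<forall>\<^sub>F x in at \<zeta> within Dom. x \<in> Dom" by (simp add: eventually_at_filter)
    then show ?thesis by eventually_elim (use u0 \<open>t < 0\<close> in force)
  qed
  moreover have "\<forall>\<^sub>F x in inf at_infinity (principal Dom). t < u x" if "t < 0" for t
    unfolding eventually_inf_principal using u0 that by (intro always_eventually) force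
  ultimately have "u \<in> upper_class Dom (indicator {z. z $ b = 0})" unfolding upper_class_iff by blast
  then show ?thesis using up by blast
qed

end

theorem mainTheorem2:
  fixes d :: nat and s :: real
  assumes "d \<ge> 2" and "CARD('n::finite) = d + 1"
    and "real d - 1 < s" and "s < real d"
  shows "\<exists>\<Omega> :: (real ^ 'n) set.
    uniform_domain \<Omega> \<and>
    lower_AD_regular s (frontier \<Omega>) \<and>
    locally_finite_hausdorff (real d) (frontier \<Omega>) \<and>
    (\<exists>E. E \<subseteq> frontier \<Omega> \<and> E \<in> sets borel \<and>
         hausdorff_measure (real d) E > 0 \<and>
         harmonic_measurable \<Omega> E \<and> (\<forall>p\<in>\<Omega>. harmonic_measure \<Omega> p E = 0))"
proof -
  have "\<not> card (UNIV :: 'n set) \<le> Suc 0" using assms by simp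
  then obtain a b :: 'n where "a \<noteq> b" by (auto simp: card_le_Suc0_iff_eq)
  then interpret two_axes a b by unfold_locales
  let ?E = "{z :: (real, 'n) vec. z $ b = 0}"
  have d: "d > 0" using assms(1) by simp
  have "closed ?E" by (intro closed_Collect_eq continuous_intros)
  then have "?E \<in> sets borel" by simp
  moreover have "?E \<subseteq> frontier Dom" using plane_frontier by auto
  moreover have "hausdorff_measure (real d) ?E > 0"
    using hausdorff_measure_plane_pos[OF assms(2) d] .
  moreover note harmonic_null_if_barriers[OF open_Dom barrier]
  ultimately show ?thesis
    using uniform_Dom lower_AD_regular_frontier[OF assms(2) d assms(4)] locally_finite_frontier[OF assms(2)]
    by blast
qed

end
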